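(* Let $D\subset\operatorname{Irr}G$ be a finite subset satisfying Hypothesis (H), and let $\mathcal F$ be a $(G,h)$-constellation on $X$. Then $\mathcal F$ has a unique filtration $$0=\mathcal G^D_0\subsetneq\mathcal G^D_1\subsetneq\mathcal G^D_2\subsetneq\cdots\subsetneq\mathcal G^D_{p_D}\subsetneq\mathcal G^D_{p_D+1}=\mathcal F$$ such that (i) each $\mathcal G^D_i$ is an $(\mathcal O_X,G)$-submodule generated in $D_-$; (ii) each quotient $\mathcal G^{D,i}:=\mathcal G^D_i/\mathcal G^D_{i-1}$ is $\mu_D$-semistable; and (iii) the slopes of the quotients are strictly decreasing: $\mu_D(\mathcal G^{D,1})>\mu_D(\mathcal G^{D,2})>\cdots>\mu_D(\mathcal G^{D,p_D})>\mu_D(\mathcal G^{D,p_D+1})$.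
   Context: We work over $\mathbb C$. $G$ is an infinite reductive algebraic group (possibly non-connected), $\operatorname{Irr}G$ is the set of isomorphism classes of irreducible $G$-modules $\rho:G\to \mathrm{GL}(V_\rho)$, and $X$ is an affine $G$-scheme of finite type. An $(\mathcal O_X,G)$-module is a $G$-equivariant coherent $\mathcal O_X$-module $\mathcal F$ whose $G$-module of global sections has finite multiplicities; write $H^0(\mathcal F)=\bigoplus_{\rho}\mathcal F_\rho\otimes V_\rho$ with $\mathcal F_\rho=\operatorname{Hom}_G(V_\rho,H^0(\mathcal F))$. The Hilbert function of $\mathcal F$ is $\rho\mapsto\dim\mathcal F_\rho$. Fix a non-zero Hilbert function $h:\operatorname{Irr}G\to\mathbb Z_{\ge0}$. Stability function: a fixed sequence of rationals $\theta=(\theta_\rho)_{\rho\in\operatorname{Irr}G}$ with $\theta_\rho<0$ for only finitely many $\rho$; $\theta_\rho>0$ for infinitely many $\rho$; $\theta_\rho=0$ if $h(\rho)=0$; and $\sum_\rho\theta_\rho h(\rho)=0$. $D_-,D_0,D_+$ are the sets of $\rho$ with $\theta_\rho<0,=0,>0$. $\mathcal F$ is generated in $D_-$ if it is generated as an $\mathcal O_X$-module by its negative part $\bigoplus_{\rho\in D_-}\mathcal F_\rho\otimes V_\rho$. A $(G,h)$-constellation on $X$ is an $(\mathcal O_X,G)$-module generated in $D_-$ with Hilbert function $h$. Hypothesis (H): let $A_\rho=\mathbb C^{h(\rho)}$ for $\rho\in D_-$ and $\mathcal H=\left(\bigoplus_{\rho\in D_-}A_\rho\otimes V_\rho\right)\otimes\mathcal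 O_X$. $Q=\mathrm{Quot}^G(\mathcal H,h)$ is the invariant Quot scheme parametrizing quotients $[q:\mathcal H\twoheadrightarrow\mathcal F]$ with $\mathcal F$ a $(G,h)$-constellation, up to equality of kernels. A finite subset $D\subset\operatorname{Irr}G$ satisfies (H) if $D\supseteq D_-$, $D\cap D_+\neq\emptyset$, $h(\rho)\ne0$ for all $\rho\in D$, and for suitable finite-dimensional subspaces $H_\rho\subset\operatorname{Hom}_G(V_\rho,H^0(\mathcal H))$ ($\rho\in D$), stable under $\prod_{\sigma\in D_-}\mathrm{GL}(A_\sigma)$ and surjecting onto $\mathcal F_\rho$ for all $[q]\in Q$, the morphism $Q\to\prod_{\rho\in D}\mathbb P(\Lambda^{h(\rho)}H_\rho)$, $[q]\mapsto(\Lambda^{h(\rho)}H_\rho\twoheadrightarrow\Lambda^{h(\rho)}\mathcal F_\rho)_\rho$, is a locally closed immersion. $\mu_D$: let $r(h)=\sum_{\rho\in D_-}h(\rho)$, $d=\#(D\setminus D_-)$, $S_D=\sum_{\rho\notin D}\theta_\rho h(\rho)$. Fix $\kappa_\rho\in\mathbb Q_{>0}$ for $\rho\in D_-$ (independent of $D$); put $\kappa_\rho=\theta_\rho+\frac{S_D}{d\,h(\rho)}$ for $\rho\in D\setminus D_-$, $\kappa(h)=\sum_{\rho\in D}\kappa_\rho h(\rho)$ (independent of $D$), $\chi_\rho=\theta_\rho-\kappa_\rho+\frac{\kappa(h)}{r(h)}$ for $\rho\in D_-$; $\kappa_D(\mathcal F)=\sum_{\rho\in D}\kappa_\rho\dim\mathcal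 F_\rho$, $\chi(\mathcal F)=\sum_{\rho\in D_-}\chi_\rho\dim\mathcal F_\rho$, $r(\mathcal F)=\sum_{\rho\in D_-}\dim\mathcal F_\rho$; and, for $\mathcal F$ with non-zero negative part, $\mu_D(\mathcal F)=\frac{-\kappa_D(\mathcal F)-\chi(\mathcal F)}{r(\mathcal F)}+\frac{\kappa(h)}{r(h)}$. An $(\mathcal O_X,G)$-module $\mathcal F$ generated in $D_-$ is $\mu_D$-semistable if $\mu_D(\mathcal F')\le\mu_D(\mathcal F)$ for every $(\mathcal O_X,G)$-submodule $0\neq\mathcal F'\subsetneq\mathcal F$ generated in $D_-$. *)

theory Defs
  imports
    "HOL-Analysis.Infinite_Sum"
    "HOL-Algebra.Ideal"
    "HOL-Algebra.Subrings"
    "Jordan_Normal_Form.Determinant"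
    "Jordan_Normal_Form.Missing_VectorSpace"
begin

hide_const (open) Polynomial.smult

section \<open>Linear algebraic groups and their irreducible representations\<close>

definition GL :: "nat \<Rightarrow> complex mat monoid" where
  "GL n = units_of (ring_mat TYPE(complex) n ())"

inductive_set mat_poly :: "nat \<Rightarrow> (complex mat \<Rightarrow> complex) set" for n :: nat where
  const: "(\<lambda>_. c) \<in> mat_poly n"
| entry: "i < n \<Longrightarrow> j < n \<Longrightarrow> (\<lambda>g. g $$ (i, j)) \<in> mat_poly n"
| add: "p \<in> mat_poly n \<Longrightarrow> q \<in> mat_poly n \<Longrightarrow> (\<lambda>g. p g + q g) \<in> mat_poly n"
| mult: "p \<in> mat_poly n \<Longrightarrow> q \<in> mat_poly n \<Longrightarrow> (\<lambda>g. p g * q g) \<in> mat_poly n"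

text \<open>The coordinate ring of \<open>GL n\<close>; its elements restrict to the regular functions on a closed
  subgroup.\<close>

definition reg_fun :: "nat \<Rightarrow> (complex mat \<Rightarrow> complex) set" where
  "reg_fun n = {\<lambda>g. p g / det g ^ k | p k. p \<in> mat_poly n}"

definition zariski_closed :: "nat \<Rightarrow> complex mat set \<Rightarrow> bool" where
  "zariski_closed n Z \<longleftrightarrow>
     (\<exists>S \<subseteq> mat_poly n. Z = {g \<in> carrier (GL n). \<forall>p\<in>S. p g = 0})"

definition zariski_connected :: "nat \<Rightarrow> complex mat set \<Rightarrow> bool" where
  "zariski_connected n Z \<longleftrightarrow>
     (\<forall>U V. zariski_closed n U \<and> zariski_closed n V \<and> Z = U \<union> V \<and> U \<inter> V = {}
        \<longrightarrow> U = {} \<or> V = {})"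

definition algebraic_group :: "nat \<Rightarrow> complex mat set \<Rightarrow> bool" where
  "algebraic_group n G \<longleftrightarrow> subgroup G (GL n) \<and> zariski_closed n G"

definition unipotent :: "nat \<Rightarrow> complex mat \<Rightarrow> bool" where
  "unipotent n g \<longleftrightarrow> (\<exists>k. (g - 1\<^sub>m n) ^\<^sub>m k = 0\<^sub>m n n)"

text \<open>Triviality of the unipotent radical. \<open>G\<close> need not be connected.\<close>

definition reductive_group :: "nat \<Rightarrow> complex mat set \<Rightarrow> bool" where
  "reductive_group n G \<longleftrightarrow> algebraic_group n G \<and>
     (\<forall>N. N \<lhd> (GL n)\<lparr>carrier := G\<rparr> \<and> zariski_closed n N \<and> zariski_connected n N
          \<and> (\<forall>g\<in>N. unipotent n g) \<longrightarrow> N = {1\<^sub>m n})"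

text \<open>A representation on \<open>\<complex>\<^sup>m\<close> is a pair \<open>(m, r)\<close>. Only the values of \<open>r\<close> on \<open>G\<close> matter, and
  the relation \<open>rep_iso\<close> below ignores the others.\<close>

type_synonym mrep = "nat \<times> (complex mat \<Rightarrow> complex mat)"

definition matrix_rep :: "nat \<Rightarrow> complex mat set \<Rightarrow> mrep \<Rightarrow> bool" where
  "matrix_rep n G = (\<lambda>(m, r).
     (\<forall>g\<in>G. r g \<in> carrier_mat m m) \<and> r (1\<^sub>m n) = 1\<^sub>m m \<and>
     (\<forall>g\<in>G. \<forall>k\<in>G. r (g * k) = r g * r k) \<and>
     (\<forall>i<m. \<forall>j<m. \<exists>f\<in>reg_fun n. \<forall>g\<in>G. r g $$ (i, j) = f g))"

definition irreducible_rep :: "nat \<Rightarrow> complex mat set \<Rightarrow> mrep \<Rightarrow> bool" where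
  "irreducible_rep n G = (\<lambda>(m, r). matrix_rep n G (m, r) \<and> m > 0 \<and>
     (\<forall>W \<subseteq> carrier_vec m. 0\<^sub>v m \<in> W \<and> (\<forall>u\<in>W. \<forall>v\<in>W. u + v \<in> W) \<and>
        (\<forall>c. \<forall>v\<in>W. c \<cdot>\<^sub>v v \<in> W) \<and> (\<forall>g\<in>G. \<forall>v\<in>W. r g *\<^sub>v v \<in> W)
        \<longrightarrow> W = {0\<^sub>v m} \<or> W = carrier_vec m))"

definition rep_iso :: "nat \<Rightarrow> complex mat set \<Rightarrow> (mrep \<times> mrep) set" where
  "rep_iso n G = {((m, r), (m', r')).
     irreducible_rep n G (m, r) \<and> irreducible_rep n G (m', r') \<and> m = m' \<and>
     (\<exists>P \<in> carrier (GL m). \<forall>g\<in>G. P * r g = r' g * P)}"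

type_synonym irrep = "mrep set"

definition Irr :: "nat \<Rightarrow> complex mat set \<Rightarrow> irrep set" where
  "Irr n G = {\<rho>. irreducible_rep n G \<rho>} // rep_iso n G"

text \<open>The chosen representative \<open>V\<^sub>\<rho>\<close> of a class.\<close>

definition Vdim :: "irrep \<Rightarrow> nat" where
  "Vdim \<rho> = fst (SOME x. x \<in> \<rho>)"

definition Vact :: "irrep \<Rightarrow> complex mat \<Rightarrow> complex mat" where
  "Vact \<rho> = snd (SOME x. x \<in> \<rho>)"


section \<open>Modules with a group action\<close>

text \<open>Modules are records over a ring, as in \<^theory>\<open>HOL-Algebra.Module\<close>, with an
  additional action; the fields \<^const>\<open>mult\<close> and \<^const>\<open>one\<close> are only used for algebras.\<close>

record ('r, 'g, 'm) gmodule = "('r, 'm) module" +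
  gact :: "'g \<Rightarrow> 'm \<Rightarrow> 'm"

text \<open>The field \<open>\<complex>\<close>, as an algebra over itself.\<close>

definition Cx :: "(complex, complex) module" where
  "Cx = \<lparr>carrier = UNIV, mult = (*), one = 1, zero = 0, add = (+), smult = (*)\<rparr>"

definition struct_map :: "('c, 'r, 'x) module_scheme \<Rightarrow> 'c \<Rightarrow> 'r" where
  "struct_map R c = c \<odot>\<^bsub>R\<^esub> \<one>\<^bsub>R\<^esub>"

definition restrict_scalars ::
    "('r \<Rightarrow> 's) \<Rightarrow> ('s, 'g, 'm) gmodule \<Rightarrow> ('r, 'g, 'm) gmodule" where
  "restrict_scalars f M = \<lparr>carrier = carrier M, mult = mult M, one = one M, zero = zero M,
     add = add M, smult = (\<lambda>r. smult M (f r)), gact = gact M\<rparr>"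

definition quot_module :: "('r, 'g, 'm) gmodule \<Rightarrow> 'm set \<Rightarrow> ('r, 'g, 'm set) gmodule" where
  "quot_module M N = \<lparr>carrier = a_rcosets\<^bsub>M\<^esub> N, mult = undefined, one = undefined,
     zero = N, add = (\<lambda>C D. C <+>\<^bsub>M\<^esub> D),
     smult = (\<lambda>r C. \<Union>x\<in>C. N +>\<^bsub>M\<^esub> (r \<odot>\<^bsub>M\<^esub> x)),
     gact = (\<lambda>g C. \<Union>x\<in>C. N +>\<^bsub>M\<^esub> (gact M g x))\<rparr>"

text \<open>The last conjunct says that the action is algebraic: it is given by a coaction
  \<open>V \<rightarrow> \<O>(G) \<otimes> V\<close>, \<open>v \<mapsto> \<Sum>\<^sub>i c\<^sub>i \<otimes> w\<^sub>i\<close>.\<close>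

definition rational_gmodule ::
    "nat \<Rightarrow> complex mat set \<Rightarrow> (complex, complex mat, 'v) gmodule \<Rightarrow> bool" where
  "rational_gmodule n G V \<longleftrightarrow> module Cx V \<and>
     (\<forall>g\<in>G. gact V g \<in> module_hom Cx V V) \<and>
     (\<forall>v\<in>carrier V. gact V (1\<^sub>m n) v = v) \<and>
     (\<forall>g\<in>G. \<forall>k\<in>G. \<forall>v\<in>carrier V. gact V (g * k) v = gact V g (gact V k v)) \<and>
     (\<forall>v\<in>carrier V. \<exists>(k::nat) w c. (\<forall>i<k. w i \<in> carrier V \<and> c i \<in> reg_fun n) \<and>
        (\<forall>g\<in>G. gact V g v = (\<Oplus>\<^bsub>V\<^esub>i\<in>{..<k}. c i g \<odot>\<^bsub>V\<^esub> w i)))"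

definition fg_algebra :: "(complex, 'a, 'x) module_scheme \<Rightarrow> bool" where
  "fg_algebra A \<longleftrightarrow> algebra Cx A \<and>
     (\<exists>S. finite S \<and> S \<subseteq> carrier A \<and>
        (\<forall>B. subring B A \<and> S \<subseteq> B \<and> (\<forall>c. \<forall>b\<in>B. c \<odot>\<^bsub>A\<^esub> b \<in> B) \<longrightarrow> B = carrier A))"

text \<open>The affine \<open>G\<close>-scheme \<open>X\<close> is given by its coordinate ring \<open>A\<close>.\<close>

definition affine_G_scheme ::
    "nat \<Rightarrow> complex mat set \<Rightarrow> (complex, complex mat, 'a) gmodule \<Rightarrow> bool" where
  "affine_G_scheme n G A \<longleftrightarrow> fg_algebra A \<and> rational_gmodule n G A \<and>
     (\<forall>g\<in>G. gact A g \<in> Ring.ring_hom A A)"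

text \<open>\<open>Hom\<^sub>G(V\<^sub>\<rho>, M)\<close> for an \<open>R\<close>-module \<open>M\<close> with \<open>R\<close>-linear \<open>G\<close>-action, where \<open>R\<close> is a
  \<open>\<complex>\<close>-algebra. It is an \<open>R\<close>-module, and \<open>G\<close> acts trivially on it.\<close>

definition Hom_G :: "complex mat set \<Rightarrow> (complex, 'r) module \<Rightarrow> irrep \<Rightarrow>
    ('r, complex mat, 'm) gmodule \<Rightarrow> ('r, complex mat, complex vec \<Rightarrow> 'm) gmodule" where
  "Hom_G G R \<rho> M = (let V = (carrier_vec (Vdim \<rho>) :: complex vec set) in
     \<lparr>carrier = {\<phi> \<in> V \<rightarrow>\<^sub>E carrier M.
        (\<forall>u\<in>V. \<forall>v\<in>V. \<phi> (u + v) = \<phi> u \<oplus>\<^bsub>M\<^esub> \<phi> v) \<and>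
        (\<forall>c. \<forall>v\<in>V. \<phi> (c \<cdot>\<^sub>v v) = struct_map R c \<odot>\<^bsub>M\<^esub> \<phi> v) \<and>
        (\<forall>g\<in>G. \<forall>v\<in>V. \<phi> (Vact \<rho> g *\<^sub>v v) = gact M g (\<phi> v))},
      mult = undefined, one = undefined,
      zero = (\<lambda>v\<in>V. \<zero>\<^bsub>M\<^esub>), add = (\<lambda>\<phi> \<psi>. \<lambda>v\<in>V. \<phi> v \<oplus>\<^bsub>M\<^esub> \<psi> v),
      smult = (\<lambda>r \<phi>. \<lambda>v\<in>V. r \<odot>\<^bsub>M\<^esub> \<phi> v), gact = (\<lambda>_ \<phi>. \<phi>)\<rparr>)"


section \<open>Equivariant modules and constellations\<close>

definition as_complex :: "(complex, complex mat, 'a) gmodule \<Rightarrow>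
    ('a, complex mat, 'm) gmodule \<Rightarrow> (complex, complex mat, 'm) gmodule" where
  "as_complex A M = restrict_scalars (struct_map A) M"

definition F_comp :: "complex mat set \<Rightarrow> (complex, complex mat, 'a) gmodule \<Rightarrow> irrep \<Rightarrow>
    ('a, complex mat, 'm) gmodule \<Rightarrow> (complex, complex mat, complex vec \<Rightarrow> 'm) gmodule" where
  "F_comp G A \<rho> M = Hom_G G Cx \<rho> (as_complex A M)"

definition hilb :: "complex mat set \<Rightarrow> (complex, complex mat, 'a) gmodule \<Rightarrow>
    ('a, complex mat, 'm) gmodule \<Rightarrow> irrep \<Rightarrow> nat" where
  "hilb G A M \<rho> = vectorspace.dim Cx (F_comp G A \<rho> M)"

text \<open>\<open>\<Oplus>\<^sub>\<rho>\<^sub>\<in>\<^sub>E F\<^sub>\<rho> \<otimes> V\<^sub>\<rho>\<close> as a subspace of \<open>M\<close>, via the evaluation maps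
  \<open>F\<^sub>\<rho> \<otimes> V\<^sub>\<rho> \<rightarrow> M\<close>, which are jointly injective by Schur's lemma.\<close>

definition isotypic_part :: "complex mat set \<Rightarrow> (complex, complex mat, 'a) gmodule \<Rightarrow>
    irrep set \<Rightarrow> ('a, complex mat, 'm) gmodule \<Rightarrow> 'm set" where
  "isotypic_part G A E M = module.span Cx (as_complex A M)
     (\<Union>\<rho>\<in>E. \<Union>\<phi>\<in>carrier (F_comp G A \<rho> M). \<phi> ` carrier_vec (Vdim \<rho>))"

text \<open>Coherent equivariant sheaves on \<open>X\<close> correspond to finitely generated \<open>A\<close>-modules with
  compatible rational \<open>G\<close>-action. The last two conjuncts express that the multiplicities are
  finite and that \<open>H\<^sup>0(F) = \<Oplus>\<^sub>\<rho> F\<^sub>\<rho> \<otimes> V\<^sub>\<rho>\<close>; for reductive \<open>G\<close> the latter always holds.\<close>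

definition OG_module :: "nat \<Rightarrow> complex mat set \<Rightarrow> (complex, complex mat, 'a) gmodule \<Rightarrow>
    ('a, complex mat, 'm) gmodule \<Rightarrow> bool" where
  "OG_module n G A M \<longleftrightarrow> module A M \<and>
     (\<exists>S. finite S \<and> S \<subseteq> carrier M \<and> module.span A M S = carrier M) \<and>
     rational_gmodule n G (as_complex A M) \<and>
     (\<forall>g\<in>G. \<forall>a\<in>carrier A. \<forall>x\<in>carrier M.
        gact M g (a \<odot>\<^bsub>M\<^esub> x) = gact A g a \<odot>\<^bsub>M\<^esub> gact M g x) \<and>
     (\<forall>\<rho>\<in>Irr n G. vectorspace.fin_dim Cx (F_comp G A \<rho> M)) \<and>
     isotypic_part G A (Irr n G) M = carrier M"

definition OG_submodule :: "nat \<Rightarrow> complex mat set \<Rightarrow> (complex, complex mat, 'a) gmodule \<Rightarrow>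
    'm set \<Rightarrow> ('a, complex mat, 'm) gmodule \<Rightarrow> bool" where
  "OG_submodule n G A N M \<longleftrightarrow> submodule A N M \<and> OG_module n G A (M\<lparr>carrier := N\<rparr>)"

definition generated_in :: "complex mat set \<Rightarrow> (complex, complex mat, 'a) gmodule \<Rightarrow>
    irrep set \<Rightarrow> ('a, complex mat, 'm) gmodule \<Rightarrow> bool" where
  "generated_in G A E M \<longleftrightarrow> module.span A M (isotypic_part G A E M) = carrier M"

definition Dneg :: "nat \<Rightarrow> complex mat set \<Rightarrow> (irrep \<Rightarrow> rat) \<Rightarrow> irrep set" where
  "Dneg n G \<theta> = {\<rho> \<in> Irr n G. \<theta> \<rho> < 0}"

definition Dpos :: "nat \<Rightarrow> complex mat set \<Rightarrow> (irrep \<Rightarrow> rat) \<Rightarrow> irrep set" where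
  "Dpos n G \<theta> = {\<rho> \<in> Irr n G. \<theta> \<rho> > 0}"

definition stability_function ::
    "nat \<Rightarrow> complex mat set \<Rightarrow> (irrep \<Rightarrow> nat) \<Rightarrow> (irrep \<Rightarrow> rat) \<Rightarrow> bool" where
  "stability_function n G h \<theta> \<longleftrightarrow> finite (Dneg n G \<theta>) \<and> infinite (Dpos n G \<theta>) \<and>
     (\<forall>\<rho>\<in>Irr n G. h \<rho> = 0 \<longrightarrow> \<theta> \<rho> = 0) \<and>
     ((\<lambda>\<rho>. real_of_rat (\<theta> \<rho>) * real (h \<rho>)) has_sum 0) (Irr n G)"

definition constellation :: "nat \<Rightarrow> complex mat set \<Rightarrow> (complex, complex mat, 'a) gmodule \<Rightarrow>
    (irrep \<Rightarrow> nat) \<Rightarrow> (irrep \<Rightarrow> rat) \<Rightarrow> ('a, complex mat, 'm) gmodule \<Rightarrow> bool" where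
  "constellation n G A h \<theta> M \<longleftrightarrow> OG_module n G A M \<and> generated_in G A (Dneg n G \<theta>) M \<and>
     (\<forall>\<rho>\<in>Irr n G. hilb G A M \<rho> = h \<rho>)"


section \<open>The slope\<close>

definition S_D :: "nat \<Rightarrow> complex mat set \<Rightarrow> (irrep \<Rightarrow> nat) \<Rightarrow> (irrep \<Rightarrow> rat) \<Rightarrow> irrep set \<Rightarrow> real" where
  "S_D n G h \<theta> D = (\<Sum>\<^sub>\<infinity>\<rho>\<in>Irr n G - D. real_of_rat (\<theta> \<rho>) * real (h \<rho>))"

text \<open>The parameter \<open>\<kappa>\<close> is only used on \<open>D\<^sub>-\<close>.\<close>

definition kap :: "nat \<Rightarrow> complex mat set \<Rightarrow> (irrep \<Rightarrow> nat) \<Rightarrow> (irrep \<Rightarrow> rat) \<Rightarrow>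
    (irrep \<Rightarrow> rat) \<Rightarrow> irrep set \<Rightarrow> irrep \<Rightarrow> real" where
  "kap n G h \<theta> \<kappa> D \<rho> = (if \<rho> \<in> Dneg n G \<theta> then real_of_rat (\<kappa> \<rho>)
     else real_of_rat (\<theta> \<rho>) + S_D n G h \<theta> D / (real (card (D - Dneg n G \<theta>)) * real (h \<rho>)))"

definition kap_h :: "nat \<Rightarrow> complex mat set \<Rightarrow> (irrep \<Rightarrow> nat) \<Rightarrow> (irrep \<Rightarrow> rat) \<Rightarrow>
    (irrep \<Rightarrow> rat) \<Rightarrow> irrep set \<Rightarrow> real" where
  "kap_h n G h \<theta> \<kappa> D = (\<Sum>\<rho>\<in>D. kap n G h \<theta> \<kappa> D \<rho> * real (h \<rho>))"

definition r_h :: "nat \<Rightarrow> complex mat set \<Rightarrow> (irrep \<Rightarrow> nat) \<Rightarrow> (irrep \<Rightarrow> rat) \<Rightarrow> real" where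
  "r_h n G h \<theta> = (\<Sum>\<rho>\<in>Dneg n G \<theta>. real (h \<rho>))"

definition chi :: "nat \<Rightarrow> complex mat set \<Rightarrow> (irrep \<Rightarrow> nat) \<Rightarrow> (irrep \<Rightarrow> rat) \<Rightarrow>
    (irrep \<Rightarrow> rat) \<Rightarrow> irrep set \<Rightarrow> irrep \<Rightarrow> real" where
  "chi n G h \<theta> \<kappa> D \<rho> =
     real_of_rat (\<theta> \<rho>) - kap n G h \<theta> \<kappa> D \<rho> + kap_h n G h \<theta> \<kappa> D / r_h n G h \<theta>"

definition slope :: "nat \<Rightarrow> complex mat set \<Rightarrow> (complex, complex mat, 'a) gmodule \<Rightarrow>
    (irrep \<Rightarrow> nat) \<Rightarrow> (irrep \<Rightarrow> rat) \<Rightarrow> (irrep \<Rightarrow> rat) \<Rightarrow> irrep set \<Rightarrow>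
    ('a, complex mat, 'm) gmodule \<Rightarrow> real" where
  "slope n G A h \<theta> \<kappa> D M =
     (- (\<Sum>\<rho>\<in>D. kap n G h \<theta> \<kappa> D \<rho> * real (hilb G A M \<rho>))
      - (\<Sum>\<rho>\<in>Dneg n G \<theta>. chi n G h \<theta> \<kappa> D \<rho> * real (hilb G A M \<rho>)))
       / (\<Sum>\<rho>\<in>Dneg n G \<theta>. real (hilb G A M \<rho>))
     + kap_h n G h \<theta> \<kappa> D / r_h n G h \<theta>"

definition slope_semistable :: "nat \<Rightarrow> complex mat set \<Rightarrow> (complex, complex mat, 'a) gmodule \<Rightarrow>
    (irrep \<Rightarrow> nat) \<Rightarrow> (irrep \<Rightarrow> rat) \<Rightarrow> (irrep \<Rightarrow> rat) \<Rightarrow> irrep set \<Rightarrow>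
    ('a, complex mat, 'm) gmodule \<Rightarrow> bool" where
  "slope_semistable n G A h \<theta> \<kappa> D M \<longleftrightarrow>
     OG_module n G A M \<and> generated_in G A (Dneg n G \<theta>) M \<and>
     (\<forall>N. OG_submodule n G A N M \<and> generated_in G A (Dneg n G \<theta>) (M\<lparr>carrier := N\<rparr>) \<and>
          N \<noteq> {\<zero>\<^bsub>M\<^esub>} \<and> N \<subset> carrier M \<longrightarrow>
          slope n G A h \<theta> \<kappa> D (M\<lparr>carrier := N\<rparr>) \<le> slope n G A h \<theta> \<kappa> D M)"


section \<open>Free modules, scalar extension, exterior powers\<close>

text \<open>The free \<open>R\<close>-module on the set \<open>B\<close>, with the action induced by an action \<open>\<alpha>\<close> on \<open>B\<close>.\<close>

definition free_module :: "('r, 'x) ring_scheme \<Rightarrow> 'b set \<Rightarrow> ('g \<Rightarrow> 'b \<Rightarrow> 'b) \<Rightarrow>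
    ('r, 'g, 'b \<Rightarrow> 'r) gmodule" where
  "free_module R B \<alpha> =
     \<lparr>carrier = {f. (\<forall>b. f b \<in> carrier R) \<and> finite {b. f b \<noteq> \<zero>\<^bsub>R\<^esub>} \<and> (\<forall>b. b \<notin> B \<longrightarrow> f b = \<zero>\<^bsub>R\<^esub>)},
      mult = undefined, one = undefined, zero = (\<lambda>_. \<zero>\<^bsub>R\<^esub>),
      add = (\<lambda>f f' b. f b \<oplus>\<^bsub>R\<^esub> f' b), smult = (\<lambda>r f b. r \<otimes>\<^bsub>R\<^esub> f b),
      gact = (\<lambda>g f b. \<Oplus>\<^bsub>R\<^esub>b'\<in>{b' \<in> B. f b' \<noteq> \<zero>\<^bsub>R\<^esub> \<and> \<alpha> g b' = b}. f b')\<rparr>"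

definition delta :: "('r, 'x) ring_scheme \<Rightarrow> 'b \<Rightarrow> 'b \<Rightarrow> 'r" where
  "delta R b = (\<lambda>b'. if b' = b then \<one>\<^bsub>R\<^esub> else \<zero>\<^bsub>R\<^esub>)"

definition presented :: "('r, 'x) ring_scheme \<Rightarrow> 'b set \<Rightarrow> ('g \<Rightarrow> 'b \<Rightarrow> 'b) \<Rightarrow>
    ('b \<Rightarrow> 'r) set \<Rightarrow> ('r, 'g, ('b \<Rightarrow> 'r) set) gmodule" where
  "presented R B \<alpha> rels =
     quot_module (free_module R B \<alpha>) (module.span R (free_module R B \<alpha>) rels)"

definition presented_gen :: "('r, 'x) ring_scheme \<Rightarrow> 'b set \<Rightarrow> ('b \<Rightarrow> 'r) set \<Rightarrow> 'b \<Rightarrow> ('b \<Rightarrow> 'r) set" where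
  "presented_gen R B rels b =
     (let F = free_module R B (\<lambda>(_::unit) b. b) in module.span R F rels +>\<^bsub>F\<^esub> delta R b)"

text \<open>The \<open>R\<close>-linear map into \<open>N\<close> from a module presented by generators and relations that is
  induced by a map \<open>\<phi>\<close> on the generators. It is meaningful if \<open>\<phi>\<close> respects the relations:
  then all representatives \<open>f\<close> of the class \<open>C\<close> give the same value.\<close>

definition induced_map :: "('r, 'x) ring_scheme \<Rightarrow> ('r, 'g, 'n) gmodule \<Rightarrow> ('b \<Rightarrow> 'n) \<Rightarrow>
    ('b \<Rightarrow> 'r) set \<Rightarrow> 'n" where
  "induced_map R N \<phi> C =
     the_elem ((\<lambda>f. \<Oplus>\<^bsub>N\<^esub>b\<in>{b. f b \<noteq> \<zero>\<^bsub>R\<^esub>}. f b \<odot>\<^bsub>N\<^esub> \<phi> b) ` C)"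

text \<open>\<open>W \<otimes>\<^sub>\<complex> R\<close>: the \<open>R\<close>-module with generators \<open>w \<otimes> 1\<close>, \<open>w \<in> W\<close>, which are additive and
  \<open>\<complex>\<close>-linear in \<open>w\<close>.\<close>

definition tensor_rels :: "(complex, 'r) module \<Rightarrow> (complex, 'g, 'w) gmodule \<Rightarrow> ('w \<Rightarrow> 'r) set" where
  "tensor_rels R W = (let F = free_module R (carrier W) (gact W) in
     {delta R (u \<oplus>\<^bsub>W\<^esub> v) \<ominus>\<^bsub>F\<^esub> (delta R u \<oplus>\<^bsub>F\<^esub> delta R v) | u v. u \<in> carrier W \<and> v \<in> carrier W} \<union>
     {delta R (c \<odot>\<^bsub>W\<^esub> u) \<ominus>\<^bsub>F\<^esub> (struct_map R c \<odot>\<^bsub>F\<^esub> delta R u) | c u. u \<in> carrier W})"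

definition tensor :: "(complex, 'r) module \<Rightarrow> (complex, 'g, 'w) gmodule \<Rightarrow>
    ('r, 'g, ('w \<Rightarrow> 'r) set) gmodule" where
  "tensor R W = presented R (carrier W) (gact W) (tensor_rels R W)"

definition tensor_one :: "(complex, 'r) module \<Rightarrow> (complex, 'g, 'w) gmodule \<Rightarrow> 'w \<Rightarrow> ('w \<Rightarrow> 'r) set" where
  "tensor_one R W w = presented_gen R (carrier W) (tensor_rels R W) w"

text \<open>\<open>\<Lambda>\<^sup>k\<^sub>R M\<close> for \<open>k \<ge> 1\<close>: generators \<open>x\<^sub>1 \<and> \<dots> \<and> x\<^sub>k\<close>, encoded as lists, subject to
  multilinearity and alternation.\<close>

definition wedge_rels :: "('r, 'x) ring_scheme \<Rightarrow> ('r, 'g, 'm) gmodule \<Rightarrow> nat \<Rightarrow> ('m list \<Rightarrow> 'r) set" where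
  "wedge_rels R M k = (let B = {xs. length xs = k \<and> set xs \<subseteq> carrier M};
       F = free_module R B (\<lambda>(_::unit) xs. xs) in
     {delta R (xs[i := x \<oplus>\<^bsub>M\<^esub> y]) \<ominus>\<^bsub>F\<^esub> (delta R (xs[i := x]) \<oplus>\<^bsub>F\<^esub> delta R (xs[i := y]))
        | xs i x y. xs \<in> B \<and> i < k \<and> x \<in> carrier M \<and> y \<in> carrier M} \<union>
     {delta R (xs[i := r \<odot>\<^bsub>M\<^esub> x]) \<ominus>\<^bsub>F\<^esub> (r \<odot>\<^bsub>F\<^esub> delta R (xs[i := x]))
        | xs i r x. xs \<in> B \<and> i < k \<and> r \<in> carrier R \<and> x \<in> carrier M} \<union>
     {delta R xs | xs i j. xs \<in> B \<and> i < j \<and> j < k \<and> xs ! i = xs ! j})"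

definition ext_power :: "('r, 'x) ring_scheme \<Rightarrow> nat \<Rightarrow> ('r, 'g, 'm) gmodule \<Rightarrow>
    ('r, 'g, ('m list \<Rightarrow> 'r) set) gmodule" where
  "ext_power R k M = presented R {xs. length xs = k \<and> set xs \<subseteq> carrier M}
     (\<lambda>g. map (gact M g)) (wedge_rels R M k)"

definition wedge :: "('r, 'x) ring_scheme \<Rightarrow> nat \<Rightarrow> ('r, 'g, 'm) gmodule \<Rightarrow> 'm list \<Rightarrow> ('m list \<Rightarrow> 'r) set" where
  "wedge R k M xs =
     presented_gen R {xs. length xs = k \<and> set xs \<subseteq> carrier M} (wedge_rels R M k) xs"

text \<open>\<open>N\<close> is locally free of rank \<open>k\<close>: there is a covering of \<open>Spec R\<close> by open sets \<open>D(f)\<close> such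
  that \<open>N\<^sub>f\<close> has an \<open>R\<^sub>f\<close>-basis of \<open>k\<close> elements. After multiplication by powers of \<open>f\<close> the basis
  comes from elements of \<open>N\<close>, and generation and linear independence over \<open>R\<^sub>f\<close> unfold
  as stated.\<close>

definition locally_free :: "('r, 'x) ring_scheme \<Rightarrow> nat \<Rightarrow> ('r, 'g, 'm) gmodule \<Rightarrow> bool" where
  "locally_free R k N \<longleftrightarrow>
     (\<exists>S \<subseteq> carrier R. genideal R S = carrier R \<and>
        (\<forall>f\<in>S. \<exists>x :: nat \<Rightarrow> 'm. (\<forall>i<k. x i \<in> carrier N) \<and>
           (\<forall>y\<in>carrier N. \<exists>l::nat. \<exists>a \<in> {..<k} \<rightarrow> carrier R.
              (f [^]\<^bsub>R\<^esub> l) \<odot>\<^bsub>N\<^esub> y = (\<Oplus>\<^bsub>N\<^esub>i\<in>{..<k}. a i \<odot>\<^bsub>N\<^esub> x i)) \<and>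
           (\<forall>a \<in> {..<k} \<rightarrow> carrier R.
              (\<Oplus>\<^bsub>N\<^esub>i\<in>{..<k}. a i \<odot>\<^bsub>N\<^esub> x i) = \<zero>\<^bsub>N\<^esub> \<longrightarrow>
              (\<forall>i<k. \<exists>l::nat. (f [^]\<^bsub>R\<^esub> l) \<otimes>\<^bsub>R\<^esub> a i = \<zero>\<^bsub>R\<^esub>))))"


section \<open>Functors of points\<close>

text \<open>\<open>\<complex>\<close>-schemes of finite type are described by their points over finitely generated
  \<open>\<complex>\<close>-algebras. Such an algebra has at most continuum many elements, so up to isomorphism its
  carrier is a set of complex numbers; its operations are unrelated to those of \<open>\<complex>\<close>.\<close>

type_synonym test_ring = "(complex, complex) module"

definition alg_hom :: "test_ring \<Rightarrow> test_ring \<Rightarrow> (complex \<Rightarrow> complex) set" where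
  "alg_hom R R' = {\<phi> \<in> Ring.ring_hom R R'. \<forall>c. \<forall>x\<in>carrier R. \<phi> (c \<odot>\<^bsub>R\<^esub> x) = c \<odot>\<^bsub>R'\<^esub> \<phi> x}"

text \<open>The base change \<open>W \<otimes> R \<rightarrow> W \<otimes> R'\<close> along \<open>\<phi>\<close>, and the pull-back of a quotient of \<open>W \<otimes> R\<close>
  (represented by its kernel).\<close>

definition base_change :: "(complex \<Rightarrow> complex) \<Rightarrow> test_ring \<Rightarrow> test_ring \<Rightarrow>
    (complex, 'g, 'w) gmodule \<Rightarrow> ('w \<Rightarrow> complex) set \<Rightarrow> ('w \<Rightarrow> complex) set" where
  "base_change \<phi> R R' W = induced_map R (restrict_scalars \<phi> (tensor R' W)) (tensor_one R' W)"

definition pull_back :: "(complex \<Rightarrow> complex) \<Rightarrow> test_ring \<Rightarrow> test_ring \<Rightarrow>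
    (complex, 'g, 'w) gmodule \<Rightarrow> ('w \<Rightarrow> complex) set set \<Rightarrow> ('w \<Rightarrow> complex) set set" where
  "pull_back \<phi> R R' W L = module.span R' (tensor R' W) (base_change \<phi> R R' W ` L)"

text \<open>The \<open>R\<close>-points of \<open>\<P>(W)\<close>: kernels of invertible quotients of \<open>W \<otimes> R\<close>.\<close>

definition proj_points :: "(complex, 'g, 'w) gmodule \<Rightarrow> test_ring \<Rightarrow> ('w \<Rightarrow> complex) set set set" where
  "proj_points W R =
     {L. submodule R L (tensor R W) \<and> locally_free R 1 (quot_module (tensor R W) L)}"

text \<open>A morphism \<open>F\<close> from a functor \<open>Q\<close> to a functor \<open>P\<close> (with functoriality \<open>pb\<close>) is a locally
  closed immersion if for every \<open>y : Spec R \<rightarrow> P\<close> the projection \<open>Q \<times>\<^sub>P Spec R \<rightarrow> Spec R\<close> is an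
  isomorphism onto a locally closed subscheme \<open>V(I) \<inter> D(J)\<close>. A morphism
  \<open>Spec R' \<rightarrow> Spec R\<close> given by \<open>\<phi>\<close> factors through the latter if and only if \<open>\<phi>(I) = 0\<close> and
  \<open>\<phi>(J)\<close> generates the unit ideal. All locally closed subschemes have this form as \<open>R\<close> is
  Noetherian.\<close>

definition locally_closed_immersion :: "(test_ring \<Rightarrow> 'q set) \<Rightarrow> (test_ring \<Rightarrow> 'p set) \<Rightarrow>
    ((complex \<Rightarrow> complex) \<Rightarrow> test_ring \<Rightarrow> test_ring \<Rightarrow> 'p \<Rightarrow> 'p) \<Rightarrow>
    (test_ring \<Rightarrow> 'q \<Rightarrow> 'p) \<Rightarrow> bool" where
  "locally_closed_immersion Q P pb F \<longleftrightarrow>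
     (\<forall>R. fg_algebra R \<longrightarrow> (\<forall>y\<in>P R. \<exists>I J. ideal I R \<and> ideal J R \<and>
        (\<forall>R' \<phi>. fg_algebra R' \<and> \<phi> \<in> alg_hom R R' \<longrightarrow>
           (if \<phi> ` I \<subseteq> {\<zero>\<^bsub>R'\<^esub>} \<and> genideal R' (\<phi> ` J) = carrier R'
            then \<exists>!q. q \<in> Q R' \<and> F R' q = pb \<phi> R R' y
            else \<not> (\<exists>q. q \<in> Q R' \<and> F R' q = pb \<phi> R R' y)))))"


section \<open>The invariant Quot scheme and Hypothesis (H)\<close>

text \<open>The module \<open>H = (\<Oplus>\<^sub>\<rho> A\<^sub>\<rho> \<otimes> V\<^sub>\<rho>) \<otimes> A\<close>, the sum over \<open>\<rho> \<in> D\<^sub>-\<close>: the entry of \<open>u\<close> at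
  \<open>(\<rho>, k, j)\<close> is the coefficient of \<open>e\<^sub>k \<otimes> v\<^sub>j\<close>, where \<open>e\<^sub>k\<close> and \<open>v\<^sub>j\<close> are the standard bases of
  \<open>A\<^sub>\<rho> = \<complex>\<^bsup>h(\<rho>)\<^esup>\<close> and \<open>V\<^sub>\<rho>\<close>.\<close>

type_synonym 'a helem = "irrep \<times> nat \<times> nat \<Rightarrow> 'a"

definition H_index :: "irrep set \<Rightarrow> (irrep \<Rightarrow> nat) \<Rightarrow> (irrep \<times> nat \<times> nat) set" where
  "H_index Dm h = {(\<rho>, k, j). \<rho> \<in> Dm \<and> k < h \<rho> \<and> j < Vdim \<rho>}"

definition H_module :: "(complex, complex mat, 'a) gmodule \<Rightarrow> irrep set \<Rightarrow> (irrep \<Rightarrow> nat) \<Rightarrow>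
    ('a, complex mat, 'a helem) gmodule" where
  "H_module A Dm h =
     \<lparr>carrier = H_index Dm h \<rightarrow>\<^sub>E carrier A, mult = undefined, one = undefined,
      zero = (\<lambda>i\<in>H_index Dm h. \<zero>\<^bsub>A\<^esub>),
      add = (\<lambda>u v. \<lambda>i\<in>H_index Dm h. u i \<oplus>\<^bsub>A\<^esub> v i),
      smult = (\<lambda>a u. \<lambda>i\<in>H_index Dm h. a \<otimes>\<^bsub>A\<^esub> u i),
      gact = (\<lambda>g u. \<lambda>(\<rho>, k, j)\<in>H_index Dm h.
        \<Oplus>\<^bsub>A\<^esub>l\<in>{..<Vdim \<rho>}. (Vact \<rho> g $$ (j, l)) \<odot>\<^bsub>A\<^esub> gact A g (u (\<rho>, k, l)))\<rparr>"

text \<open>The action of \<open>\<gamma> \<in> \<Prod>\<^sub>\<sigma> GL(A\<^sub>\<sigma>)\<close>.\<close>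

definition GL_act :: "(complex, complex mat, 'a) gmodule \<Rightarrow> irrep set \<Rightarrow> (irrep \<Rightarrow> nat) \<Rightarrow>
    (irrep \<Rightarrow> complex mat) \<Rightarrow> 'a helem \<Rightarrow> 'a helem" where
  "GL_act A Dm h \<gamma> u = (\<lambda>(\<rho>, k, j)\<in>H_index Dm h.
     \<Oplus>\<^bsub>A\<^esub>l\<in>{..<h \<rho>}. (\<gamma> \<rho> $$ (k, l)) \<odot>\<^bsub>A\<^esub> u (\<rho>, l, j))"

definition H_cx :: "(complex, complex mat, 'a) gmodule \<Rightarrow> irrep set \<Rightarrow> (irrep \<Rightarrow> nat) \<Rightarrow>
    (complex, complex mat, 'a helem) gmodule" where
  "H_cx A Dm h = as_complex A (H_module A Dm h)"

text \<open>The family of quotients \<open>(H \<otimes> R)/K\<close>, viewed as an \<open>R\<close>-module with \<open>G\<close>-action.\<close>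

definition H_quot :: "(complex, complex mat, 'a) gmodule \<Rightarrow> irrep set \<Rightarrow> (irrep \<Rightarrow> nat) \<Rightarrow>
    test_ring \<Rightarrow> ('a helem \<Rightarrow> complex) set set \<Rightarrow>
    (complex, complex mat, ('a helem \<Rightarrow> complex) set set) gmodule" where
  "H_quot A Dm h R K = quot_module (tensor R (H_cx A Dm h)) K"

text \<open>The \<open>R\<close>-points of \<open>Quot\<^sup>G(H, h)\<close>: kernels \<open>K\<close>, that is \<open>G\<close>-stable \<open>A \<otimes> R\<close>-submodules of
  \<open>H \<otimes> R\<close>, for which all \<open>F\<^sub>\<rho>\<close> are locally free \<open>R\<close>-modules of rank \<open>h(\<rho>)\<close>. As quotients of
  \<open>H \<otimes> R\<close>, the families \<open>F\<close> are automatically generated in \<open>D\<^sub>-\<close>.\<close>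

definition quot_points :: "nat \<Rightarrow> complex mat set \<Rightarrow> (complex, complex mat, 'a) gmodule \<Rightarrow>
    irrep set \<Rightarrow> (irrep \<Rightarrow> nat) \<Rightarrow> test_ring \<Rightarrow> ('a helem \<Rightarrow> complex) set set set" where
  "quot_points n G A Dm h R = (let H = H_module A Dm h; HR = tensor R (H_cx A Dm h) in
     {K. submodule R K HR \<and>
         (\<forall>a\<in>carrier A. \<forall>x\<in>K.
            induced_map R HR (\<lambda>w. tensor_one R (H_cx A Dm h) (a \<odot>\<^bsub>H\<^esub> w)) x \<in> K) \<and>
         (\<forall>g\<in>G. \<forall>x\<in>K. gact HR g x \<in> K) \<and>
         (\<forall>\<rho>\<in>Irr n G. locally_free R (h \<rho>) (Hom_G G R \<rho> (H_quot A Dm h R K)))})"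

text \<open>\<open>Hom\<^sub>G(V\<^sub>\<rho>, H) \<rightarrow> F\<^sub>\<rho>\<close> for the point \<open>K\<close>.\<close>

definition q_map :: "(complex, complex mat, 'a) gmodule \<Rightarrow> irrep set \<Rightarrow> (irrep \<Rightarrow> nat) \<Rightarrow>
    test_ring \<Rightarrow> ('a helem \<Rightarrow> complex) set set \<Rightarrow> irrep \<Rightarrow>
    (complex vec \<Rightarrow> 'a helem) \<Rightarrow> complex vec \<Rightarrow> ('a helem \<Rightarrow> complex) set set" where
  "q_map A Dm h R K \<rho> \<phi> = (\<lambda>v\<in>carrier_vec (Vdim \<rho>).
     K +>\<^bsub>tensor R (H_cx A Dm h)\<^esub> tensor_one R (H_cx A Dm h) (\<phi> v))"

definition H_sub :: "complex mat set \<Rightarrow> (complex, complex mat, 'a) gmodule \<Rightarrow> irrep set \<Rightarrow>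
    (irrep \<Rightarrow> nat) \<Rightarrow> (irrep \<Rightarrow> (complex vec \<Rightarrow> 'a helem) set) \<Rightarrow> irrep \<Rightarrow>
    (complex, complex mat, complex vec \<Rightarrow> 'a helem) gmodule" where
  "H_sub G A Dm h Hs \<rho> = (Hom_G G Cx \<rho> (H_cx A Dm h))\<lparr>carrier := Hs \<rho>\<rparr>"

text \<open>The kernel of \<open>\<Lambda>\<^bsup>h(\<rho>)\<^esup> H\<^sub>\<rho> \<otimes> R \<rightarrow> \<Lambda>\<^bsup>h(\<rho>)\<^esup>\<^sub>R F\<^sub>\<rho>\<close>.\<close>

definition pluecker :: "complex mat set \<Rightarrow> (complex, complex mat, 'a) gmodule \<Rightarrow> irrep set \<Rightarrow>
    (irrep \<Rightarrow> nat) \<Rightarrow> (irrep \<Rightarrow> (complex vec \<Rightarrow> 'a helem) set) \<Rightarrow>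
    test_ring \<Rightarrow> ('a helem \<Rightarrow> complex) set set \<Rightarrow> irrep \<Rightarrow>
    (((complex vec \<Rightarrow> 'a helem) list \<Rightarrow> complex) set \<Rightarrow> complex) set set" where
  "pluecker G A Dm h Hs R K \<rho> =
     (let Frho = Hom_G G R \<rho> (H_quot A Dm h R K);
          target = ext_power R (h \<rho>) Frho;
          on_wedge = induced_map Cx (restrict_scalars (struct_map R) target)
            (\<lambda>xs. wedge R (h \<rho>) Frho (map (q_map A Dm h R K \<rho>) xs))
      in {w \<in> carrier (tensor R (ext_power Cx (h \<rho>) (H_sub G A Dm h Hs \<rho>))).
            induced_map R target on_wedge w = \<zero>\<^bsub>target\<^esub>})"

definition hypothesis_H :: "nat \<Rightarrow> complex mat set \<Rightarrow> (complex, complex mat, 'a) gmodule \<Rightarrow>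
    (irrep \<Rightarrow> nat) \<Rightarrow> (irrep \<Rightarrow> rat) \<Rightarrow> irrep set \<Rightarrow> bool" where
  "hypothesis_H n G A h \<theta> D \<longleftrightarrow>
     finite D \<and> D \<subseteq> Irr n G \<and> Dneg n G \<theta> \<subseteq> D \<and> D \<inter> Dpos n G \<theta> \<noteq> {} \<and> (\<forall>\<rho>\<in>D. h \<rho> \<noteq> 0) \<and>
     (\<exists>Hs :: irrep \<Rightarrow> (complex vec \<Rightarrow> 'a helem) set.
        let Dm = Dneg n G \<theta>;
            W = (\<lambda>\<rho>. ext_power Cx (h \<rho>) (H_sub G A Dm h Hs \<rho>))
        in (\<forall>\<rho>\<in>D.
              subspace Cx (Hs \<rho>) (Hom_G G Cx \<rho> (H_cx A Dm h)) \<and>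
              vectorspace.fin_dim Cx (H_sub G A Dm h Hs \<rho>) \<and>
              (\<forall>\<gamma>. (\<forall>\<sigma>\<in>Dm. \<gamma> \<sigma> \<in> carrier (GL (h \<sigma>))) \<longrightarrow>
                 (\<forall>\<phi>\<in>Hs \<rho>. (\<lambda>v\<in>carrier_vec (Vdim \<rho>). GL_act A Dm h \<gamma> (\<phi> v)) \<in> Hs \<rho>)) \<and>
              (\<forall>K\<in>quot_points n G A Dm h Cx.
                 q_map A Dm h Cx K \<rho> ` Hs \<rho> = carrier (Hom_G G Cx \<rho> (H_quot A Dm h Cx K)))) \<and>
           locally_closed_immersion
             (quot_points n G A Dm h)
             (\<lambda>R. \<Pi>\<^sub>E \<rho>\<in>D. proj_points (W \<rho>) R)
             (\<lambda>\<phi> R R' y. \<lambda>\<rho>\<in>D. pull_back \<phi> R R' (W \<rho>) (y \<rho>))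
             (\<lambda>R K. \<lambda>\<rho>\<in>D. pluecker G A Dm h Hs R K \<rho>))"

end

theory Submission
  imports Defs
begin

text \<open>
  The submodules of \<open>F\<close> generated in \<open>D\<^sub>-\<close> form a lattice of finite length: the join is the sum, the
  meet is the submodule generated by the \<open>D\<^sub>-\<close>-part of the intersection. On it the rank \<open>r\<close> is
  modular and strictly monotone. The degree \<open>-\<kappa>\<^sub>D - \<chi>\<close> is supermodular, because passing from the
  intersection to the meet does not change the multiplicities in \<open>D\<^sub>-\<close>, and can only decrease those
  in \<open>D \<setminus> D\<^sub>-\<close>, where \<open>\<kappa>\<^sub>\<rho> \<ge> 0\<close>. This is all that the classical argument of Harder and Narasimhan
  needs. Additivity of the Hilbert function comes from complete reducibility, which is inherited by
  submodules and quotients: a module that is the sum of its irreducible submodules is semisimple.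
\<close>

section \<open>Harder--Narasimhan filtrations in lattices\<close>

text \<open>Conditions (ii) and (iii) speak of quotients, the lattice argument of members of one
  lattice. The link is additivity of Hilbert functions: the slope of Z/X is a difference quotient of
  the degrees and ranks of X and Z, plus a constant common to all modules, which cancels in every
  comparison. Semistability of Y/X becomes a condition on the members of the lattice between X and
  Y, because the preimage in Y of a submodule of Y/X generated in D_- is again generated in D_-:
  maps from irreducibles lift along surjections.

  The obstacle is that an intersection of submodules generated in D_- need not be generated in D_-,
  so the degree is not modular. The defect has the right sign: \<theta> is non-negative outside D_-,
  hence so is S_D, hence so are the weights on D outside D_-.

  The rank is strictly monotone since a module generated in D_- without D_--part vanishes. The
  degree takes finitely many values since it depends only on multiplicities in the finite set D,
  bounded by those of F. Finite generation of the members of the lattice comes from D_- itself: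
  finitely many irreducibles, each with a finite-dimensional multiplicity space.\<close>

locale slope_lattice =
  fixes L :: "'b::order set" and J K :: "'b \<Rightarrow> 'b \<Rightarrow> 'b" and T :: 'b
    and r :: "'b \<Rightarrow> nat" and w :: "'b \<Rightarrow> real"
  assumes join: "X \<in> L \<Longrightarrow> Y \<in> L \<Longrightarrow> J X Y \<in> L \<and> X \<le> J X Y \<and> Y \<le> J X Y"
    and meet: "X \<in> L \<Longrightarrow> Y \<in> L \<Longrightarrow> K X Y \<in> L \<and> K X Y \<le> X \<and> K X Y \<le> Y"
    and meet_greatest: "X \<in> L \<Longrightarrow> Y \<in> L \<Longrightarrow> Z \<in> L \<Longrightarrow> Z \<le> X \<Longrightarrow> Z \<le> Y \<Longrightarrow> Z \<le> K X Y"
    and top: "T \<in> L" "X \<in> L \<Longrightarrow> X \<le> T"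
    and r_strict_mono: "X \<in> L \<Longrightarrow> Y \<in> L \<Longrightarrow> X < Y \<Longrightarrow> r X < r Y"
    and r_modular: "X \<in> L \<Longrightarrow> Y \<in> L \<Longrightarrow> r (J X Y) + r (K X Y) = r X + r Y"
    and w_supermodular: "X \<in> L \<Longrightarrow> Y \<in> L \<Longrightarrow> w X + w Y \<le> w (J X Y) + w (K X Y)"
    and finite_w: "finite (w ` L)"
begin

text \<open>In the application this is the slope of the quotient of \<open>Y\<close> by
  \<open>X\<close>, up to the additive constant shared by all slopes.\<close>

definition rel_slope :: "'b \<Rightarrow> 'b \<Rightarrow> real" where
  "rel_slope X Y = (w Y - w X) / (real (r Y) - real (r X))"

definition semistable :: "'b \<Rightarrow> 'b \<Rightarrow> bool" where
  "semistable X Y \<longleftrightarrow> (\<forall>Z\<in>L. X < Z \<and> Z < Y \<longrightarrow> rel_slope X Z \<le> rel_slope X Y)"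

text \<open>A list may start at any member of the lattice, not only at the bottom. The tail of a
  longer list is then a list of the same kind, a filtration of \<open>T\<close> relative to
  \<open>Y\<close>, which allows induction.\<close>

inductive hn :: "'b list \<Rightarrow> bool" where
  last: "X \<in> L \<Longrightarrow> X < T \<Longrightarrow> semistable X T \<Longrightarrow> hn [X, T]"
| step: "X \<in> L \<Longrightarrow> X < Y \<Longrightarrow> semistable X Y \<Longrightarrow> hn (Y # Z # zs) \<Longrightarrow> rel_slope Y Z < rel_slope X Y
    \<Longrightarrow> hn (X # Y # Z # zs)"

lemma w_eq_rel_slope: "X \<in> L \<Longrightarrow> Y \<in> L \<Longrightarrow> X < Y \<Longrightarrow> w Y - w X = rel_slope X Y * (real (r Y) - real (r X))"
  using r_strict_mono[of X Y] by (simp add: rel_slope_def)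

lemma r_mono: "X \<in> L \<Longrightarrow> Y \<in> L \<Longrightarrow> X \<le> Y \<Longrightarrow> r X \<le> r Y"
  using r_strict_mono[of X Y] by (cases "X = Y") (auto simp: order.strict_iff_order)

text \<open>Clearing the denominator turns semistability into a linear inequality that also holds at
  the ends, in particular at \<open>Z = X\<close>, where the relative slope is 0/0.\<close>

lemma semistable_bound:
  assumes "X \<in> L" "Y \<in> L" "Z \<in> L" "X < Y" "semistable X Y" "X \<le> Z" "Z \<le> Y"
  shows "w Z - w X \<le> rel_slope X Y * (real (r Z) - real (r X))"
proof (cases "Z = X \<or> Z = Y")
  case True
  then show ?thesis using w_eq_rel_slope[of X Y] assms by auto
next
  case False
  then have *: "X < Z" "Z < Y" using assms by auto
  then have "rel_slope X Z \<le> rel_slope X Y" using assms by (auto simp: semistable_def)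
  then have "rel_slope X Z * (real (r Z) - real (r X)) \<le> rel_slope X Y * (real (r Z) - real (r X))"
    using r_strict_mono[of X Z] assms * by (intro mult_right_mono) auto
  then show ?thesis using w_eq_rel_slope[of X Z] assms * by auto
qed

lemma hn_in: "hn xs \<Longrightarrow> set xs \<subseteq> L"
  by (induction rule: hn.induct) (auto simp: top)

text \<open>Splitting along \<open>Y\<close>, supermodularity bounds the degree of \<open>Z\<close> by the degrees of
  \<open>K Z Y\<close>, controlled by semistability, and of \<open>J Z Y\<close>, controlled by the rest of the filtration.\<close>

lemma hn_bound:
  assumes "hn xs" "xs = X # Y # zs" "Z \<in> L" "X \<le> Z"
  shows "w Z - w X \<le> rel_slope X Y * (real (r Z) - real (r X)) \<and>
    (w Z - w X = rel_slope X Y * (real (r Z) - real (r X)) \<longrightarrow> Z \<le> Y)"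
  using assms
proof (induction arbitrary: X Y zs Z rule: hn.induct)
  case (last X')
  then show ?case using semistable_bound[of X T Z] top by auto
next
  case (step X' Y' Y2 zs')
  then have eq: "X' = X" "Y' = Y" "zs = Y2 # zs'" by auto
  have X: "X \<in> L" and XY: "X < Y" and semistable: "semistable X Y" and less: "rel_slope Y Y2 < rel_slope X Y"
    and hnY: "hn (Y # Y2 # zs')" using step.hyps eq by auto
  have Y: "Y \<in> L" using hn_in[OF hnY] by auto
  have Z: "Z \<in> L" "X \<le> Z" using step.prems by auto
  note j = join[OF Z(1) Y] and k = meet[OF Z(1) Y]
  have kX: "X \<le> K Z Y" using meet_greatest[OF Z(1) Y X Z(2)] XY by auto
  have A: "w (J Z Y) - w Y \<le> rel_slope Y Y2 * (real (r (J Z Y)) - real (r Y))"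
    using step.IH[of Y Y2 zs' "J Z Y"] eq j by auto
  have B: "w (K Z Y) - w X \<le> rel_slope X Y * (real (r (K Z Y)) - real (r X))"
    using semistable_bound[OF X Y _ XY semistable kX] k by auto
  have m: "real (r (J Z Y)) + real (r (K Z Y)) = real (r Z) + real (r Y)"
    using r_modular[OF Z(1) Y] by (metis of_nat_add)
  have s: "w Z + w Y \<le> w (J Z Y) + w (K Z Y)" using w_supermodular[OF Z(1) Y] .
  have rj: "r Y \<le> r (J Z Y)" using r_mono j Y by auto
  have C: "rel_slope Y Y2 * (real (r (J Z Y)) - real (r Y)) \<le> rel_slope X Y * (real (r (J Z Y)) - real (r Y))"
    using less rj by (intro mult_right_mono) auto
  have D: "rel_slope X Y * (real (r (J Z Y)) - real (r Y)) + rel_slope X Y * (real (r (K Z Y)) - real (r X))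
      = rel_slope X Y * (real (r Z) - real (r X))"
    using m by (simp add: distrib_left[symmetric])
  have 1: "w Z - w X \<le> rel_slope X Y * (real (r Z) - real (r X))"
    using A B C D s by linarith
  \<comment> \<open>Were \<open>J Z Y\<close> strictly above \<open>Y\<close>, its part above
    \<open>Y\<close> would have positive rank and at most the strictly smaller slope
    \<open>rel_slope Y Y2\<close>, so the bound would be strict.\<close>
  have "Z \<le> Y" if e: "w Z - w X = rel_slope X Y * (real (r Z) - real (r X))"
  proof (rule ccontr)
    assume "\<not> Z \<le> Y"
    then have "Y < J Z Y" using j by (metis order.not_eq_order_implies_strict)
    then have "r Y < r (J Z Y)" using r_strict_mono Y j by auto
    then have "rel_slope Y Y2 * (real (r (J Z Y)) - real (r Y)) < rel_slope X Y * (real (r (J Z Y)) - real (r Y))"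
      using less by (intro mult_strict_right_mono) auto
    then show False using A B D s e by linarith
  qed
  then show ?case using 1 eq by auto
qed

text \<open>By \<open>hn_bound\<close>, the second entry of a filtration is the largest among the
  members of maximal relative slope over \<open>X\<close>. Two such members lie below each
  other.\<close>

lemma hn_first_unique:
  assumes "hn (X # Y # zs)" "hn (X # Y' # zs')"
  shows "Y = Y'"
proof -
  have X: "X < Y" "X < Y'" using assms by (auto elim: hn.cases)
  have L: "X \<in> L" "Y \<in> L" "Y' \<in> L" using hn_in assms by fastforce+
  have le: "rel_slope X B \<le> rel_slope X C \<and> (rel_slope X B = rel_slope X C \<longrightarrow> B \<le> C)"
    if h: "hn (X # C # cs)" and B: "X < B" "B \<in> L" for B C cs
  proof -
    note b = hn_bound[OF h refl, of B]
    have e: "w B - w X = rel_slope X B * (real (r B) - real (r X))" using w_eq_rel_slope B L by auto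
    have p: "real (r B) - real (r X) > 0" using r_strict_mono B L by auto
    then show ?thesis using b e B by (auto simp: mult_le_cancel_right)
  qed
  show ?thesis using le[OF assms(1) X(2) L(3)] le[OF assms(2) X(1) L(2)] by auto
qed

text \<open>Forces two filtrations to end together: once \<open>T\<close> is reached, no further
  entry can follow.\<close>

lemma hn_T: "\<not> hn (T # zs)"
proof
  assume h: "hn (T # zs)"
  then obtain Y where "T < Y" "Y \<in> set (T # zs)" by (auto elim: hn.cases)
  then show False using hn_in[OF h] top(2)[of Y] by auto
qed

lemma hn_unique: "hn xs \<Longrightarrow> hn ys \<Longrightarrow> hd xs = hd ys \<Longrightarrow> xs = ys"
proof (induction arbitrary: ys rule: hn.induct)
  case (last X)
  then have "hn [X, T]" by (auto intro: hn.last)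
  from \<open>hn ys\<close> show ?case
  proof cases
    case (step X' Y Z zs)
    then have "Y = T" using hn_first_unique[OF \<open>hn [X, T]\<close>, of Y] last by auto
    then show ?thesis using step hn_T by auto
  qed (use last in auto)
next
  case (step X Y Z zs)
  then have h: "hn (X # Y # Z # zs)" by (auto intro: hn.step)
  from \<open>hn ys\<close> show ?case
  proof cases
    case (last X')
    then have "Y = T" using hn_first_unique[OF h] step.prems by auto
    then show ?thesis using step.hyps hn_T by auto
  next
    case s: (step X' Y' Z' zs')
    then have "Y' = Y" using hn_first_unique[OF h, of Y' "Z' # zs'"] step.prems by auto
    then show ?thesis using step.IH[of "Y' # Z' # zs'"] s step.prems by auto
  qed
qed

text \<open>The second entry is the maximal destabilising member: of largest relative slope over
  \<open>X\<close> and, among those, of largest rank. The remaining entries come from induction on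
  the corank.\<close>

lemma hn_exists: "X \<in> L \<Longrightarrow> X < T \<Longrightarrow> \<exists>Y zs. hn (X # Y # zs)"
proof (induction "r T - r X" arbitrary: X rule: less_induct)
  case less
  let ?S = "{Y\<in>L. X < Y}"
  have TS: "T \<in> ?S" using less top by auto
  have rb: "r ` L \<subseteq> {..r T}" using r_mono top by auto
  \<comment> \<open>Ranks are bounded by \<open>r T\<close> and \<open>w\<close> takes finitely many
    values, so finitely many slopes occur and a maximum exists.\<close>
  have fin: "finite (rel_slope X ` ?S)"
  proof (rule finite_subset)
    show "rel_slope X ` ?S \<subseteq> (\<lambda>(a, b). (a - w X) / (real b - real (r X))) ` (w ` L \<times> r ` L)"
      by (force simp: rel_slope_def)
    show "finite \<dots>" using finite_w finite_subset[OF rb] by auto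
  qed
  define s where "s = Max (rel_slope X ` ?S)"
  have smax: "rel_slope X Y \<le> s" if "Y \<in> L" "X < Y" for Y using that fin by (auto simp: s_def)
  have "s \<in> rel_slope X ` ?S" unfolding s_def using fin TS by (intro Max_in) auto
  then obtain Y0 where Y0: "Y0 \<in> L \<and> X < Y0 \<and> rel_slope X Y0 = s" by auto
  have "\<forall>Y. Y \<in> L \<and> X < Y \<and> rel_slope X Y = s \<longrightarrow> r Y < Suc (r T)"
    using rb by (auto simp: less_Suc_eq_le)
  from ex_has_greatest_nat[of "\<lambda>Y. Y \<in> L \<and> X < Y \<and> rel_slope X Y = s", OF Y0 this]
  obtain Y where Y: "Y \<in> L" "X < Y" "rel_slope X Y = s"
    and Ymax: "\<And>Z. Z \<in> L \<Longrightarrow> X < Z \<Longrightarrow> rel_slope X Z = s \<Longrightarrow> r Z \<le> r Y" by blast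
  have semistable_Y: "semistable X Y" using smax Y by (auto simp: semistable_def)
  show ?case
  proof (cases "Y = T")
    case True
    then show ?thesis using hn.last less Y semistable_Y by blast
  next
    case False
    then have YT: "Y < T" using top Y by (simp add: order.not_eq_order_implies_strict)
    have "r T - r Y < r T - r X"
      using r_strict_mono[of X Y] r_strict_mono[of Y T] less Y YT top by auto
    then obtain Z zs where h: "hn (Y # Z # zs)" using less.hyps[of Y] YT Y by auto
    then have YZ: "Y < Z" by (auto elim: hn.cases)
    have Z: "Z \<in> L" using hn_in[OF h] by auto
    have XZ: "X < Z" using YZ Y by auto
    \<comment> \<open>\<open>Z\<close> has larger rank than \<open>Y\<close>, so by the choice of
      \<open>Y\<close> it cannot reach the slope \<open>s\<close>. As \<open>rel_slope X Z\<close>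
      is the rank-weighted mean of \<open>rel_slope X Y = s\<close> and
      \<open>rel_slope Y Z\<close>, the latter lies below \<open>s\<close>.\<close>
    have "rel_slope X Z < s"
      using smax[OF Z XZ] Ymax[OF Z XZ] r_strict_mono[OF Y(1) Z YZ] by fastforce
    moreover have "w Z - w X = rel_slope X Z * (real (r Z) - real (r X))" using w_eq_rel_slope less Z XZ by auto
    moreover have "w Y - w X = s * (real (r Y) - real (r X))" using w_eq_rel_slope less Y by auto
    moreover have "w Z - w Y = rel_slope Y Z * (real (r Z) - real (r Y))" using w_eq_rel_slope Z Y YZ by auto
    moreover have "real (r X) < real (r Z)" using r_strict_mono less Z XZ by auto
    moreover have "real (r Y) < real (r Z)" using r_strict_mono Y Z YZ by auto
    ultimately have "rel_slope Y Z * (real (r Z) - real (r Y)) < s * (real (r Z) - real (r Y))"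
      by (smt (verit) mult_strict_right_mono right_diff_distrib)
    then have "rel_slope Y Z < rel_slope X Y"
      using \<open>real (r Y) < real (r Z)\<close> Y by (simp add: mult_less_cancel_right)
    then show ?thesis using hn.step[OF \<open>X \<in> L\<close> Y(2) semistable_Y h] by blast
  qed
qed

text \<open>Connects the inductive form, used for the arguments, with the indexed form in which the
  filtration is finally stated. Passing to the tail lowers \<open>p\<close> and all indices by
  one.\<close>

lemma hn_iff_nth:
  "hn xs \<longleftrightarrow> (\<exists>p. length xs = p + 2 \<and> xs ! (p + 1) = T \<and>
     (\<forall>i\<le>p. xs ! i < xs ! (i + 1)) \<and> (\<forall>i\<le>p + 1. xs ! i \<in> L) \<and>
     (\<forall>i\<in>{1..p + 1}. semistable (xs ! (i - 1)) (xs ! i)) \<and>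
     (\<forall>i\<in>{1..p}. rel_slope (xs ! (i - 1)) (xs ! i) > rel_slope (xs ! i) (xs ! (i + 1))))"
  (is "_ \<longleftrightarrow> ?Q xs")
proof
  assume "hn xs"
  then show "?Q xs"
  proof induction
    case (last X)
    then show ?case by (intro exI[of _ 0]) (auto simp: top le_Suc_eq)
  next
    case (step X Y Z zs)
    then obtain p where p: "length (Y # Z # zs) = p + 2"
      "(Y # Z # zs) ! (p + 1) = T"
      "\<forall>i\<le>p. (Y # Z # zs) ! i < (Y # Z # zs) ! (i + 1)" "\<forall>i\<le>p + 1. (Y # Z # zs) ! i \<in> L"
      "\<forall>i\<in>{1..p + 1}. semistable ((Y # Z # zs) ! (i - 1)) ((Y # Z # zs) ! i)"
      "\<forall>i\<in>{1..p}. rel_slope ((Y # Z # zs) ! (i - 1)) ((Y # Z # zs) ! i)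
        > rel_slope ((Y # Z # zs) ! i) ((Y # Z # zs) ! (i + 1))" by blast
    \<comment> \<open>The subtraction \<open>i - 1\<close> truncates at zero, so
      \<open>i = 1\<close> is split off; for \<open>i = k + 2\<close> both indices fall into the
      tail.\<close>
    have 1: "semistable ((X # Y # Z # zs) ! (i - 1)) ((X # Y # Z # zs) ! i)" if "i \<in> {1..Suc p + 1}" for i
    proof (cases "i = 1")
      case False
      then have "2 \<le> i" using that by auto
      then obtain k where "i = Suc (Suc k)" using le_Suc_ex[of 2 i] by auto
      then show ?thesis using p(5)[rule_format, of "Suc k"] that by simp
    qed (use step in auto)
    have 2: "rel_slope ((X # Y # Z # zs) ! (i - 1)) ((X # Y # Z # zs) ! i)
        > rel_slope ((X # Y # Z # zs) ! i) ((X # Y # Z # zs) ! (i + 1))" if "i \<in> {1..Suc p}" for i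
    proof (cases "i = 1")
      case False
      then have "2 \<le> i" using that by auto
      then obtain k where "i = Suc (Suc k)" using le_Suc_ex[of 2 i] by auto
      then show ?thesis using p(6)[rule_format, of "Suc k"] that by simp
    qed (use step in auto)
    have 3: "(X # Y # Z # zs) ! i < (X # Y # Z # zs) ! (i + 1)" if "i \<le> Suc p" for i
      using that p(3) step by (cases i) auto
    have 4: "(X # Y # Z # zs) ! i \<in> L" if "i \<le> Suc p + 1" for i
      using that p(4) step by (cases i) auto
    show ?case
      using p(1,2) 1 2 3 4 by (intro exI[of _ "Suc p"]) auto
  qed
next
  assume "?Q xs"
  then obtain p where "length xs = p + 2 \<and> xs ! (p + 1) = T \<and>
     (\<forall>i\<le>p. xs ! i < xs ! (i + 1)) \<and> (\<forall>i\<le>p + 1. xs ! i \<in> L) \<and>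
     (\<forall>i\<in>{1..p + 1}. semistable (xs ! (i - 1)) (xs ! i)) \<and>
     (\<forall>i\<in>{1..p}. rel_slope (xs ! (i - 1)) (xs ! i) > rel_slope (xs ! i) (xs ! (i + 1)))" by blast
  then show "hn xs"
  proof (induction p arbitrary: xs)
    case 0
    then obtain X Y where "xs = [X, Y]"
      by (metis One_nat_def Suc_1 add_0 length_0_conv length_Suc_conv)
    then show ?case using 0 by (auto intro!: hn.last)
  next
    case (Suc p)
    then obtain X Y Z zs where xs: "xs = X # Y # Z # zs"
      by (metis add_2_eq_Suc' length_Suc_conv)
    have "hn (Y # Z # zs)"
    proof (rule Suc.IH, intro conjI)
      show "length (Y # Z # zs) = p + 2" "(Y # Z # zs) ! (p + 1) = T" using Suc.prems xs by auto
      show "\<forall>i\<le>p. (Y # Z # zs) ! i < (Y # Z # zs) ! (i + 1)"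
        using Suc.prems xs by (metis Suc_eq_plus1 Suc_le_mono nth_Cons_Suc)
      show "\<forall>i\<le>p + 1. (Y # Z # zs) ! i \<in> L"
        using Suc.prems xs by (metis Suc_eq_plus1 Suc_le_mono nth_Cons_Suc)
      show "\<forall>i\<in>{1..p + 1}. semistable ((Y # Z # zs) ! (i - 1)) ((Y # Z # zs) ! i)"
      proof
        fix i assume "i \<in> {1..p + 1}"
        then show "semistable ((Y # Z # zs) ! (i - 1)) ((Y # Z # zs) ! i)"
          using Suc.prems xs by (auto dest!: bspec[of _ _ "Suc i"] simp: nth_Cons')
      qed
      show "\<forall>i\<in>{1..p}. rel_slope ((Y # Z # zs) ! (i - 1)) ((Y # Z # zs) ! i)
        > rel_slope ((Y # Z # zs) ! i) ((Y # Z # zs) ! (i + 1))"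
      proof
        fix i assume "i \<in> {1..p}"
        then show "rel_slope ((Y # Z # zs) ! (i - 1)) ((Y # Z # zs) ! i)
          > rel_slope ((Y # Z # zs) ! i) ((Y # Z # zs) ! (i + 1))"
          using Suc.prems xs by (auto dest!: bspec[of _ _ "Suc i"] simp: nth_Cons')
      qed
    qed
    moreover have "X \<in> L" "X < Y" using Suc.prems xs by auto
    moreover have "semistable X Y"
      using Suc.prems xs by (auto dest!: bspec[of _ _ 1])
    moreover have "rel_slope Y Z < rel_slope X Y"
      using Suc.prems xs by (auto dest!: bspec[of _ _ 1])
    ultimately show ?case using hn.step xs by auto
  qed
qed

theorem hn_ex1:
  assumes "B \<in> L" "B < T"
  shows "\<exists>!xs. hn xs \<and> xs ! 0 = B"
proof -
  obtain Y zs where h: "hn (B # Y # zs)" using hn_exists assms by blast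
  show ?thesis
  proof (rule ex1I[of _ "B # Y # zs"])
    fix xs assume x: "hn xs \<and> xs ! 0 = B"
    then have "xs \<noteq> []" by (auto elim: hn.cases)
    then show "xs = B # Y # zs" using hn_unique x h by (auto simp: hd_conv_nth)
  qed (use h in auto)
qed

end

section \<open>Semisimple representations\<close>

lemma Cx_simps [simp]:
  "carrier Cx = UNIV" "mult Cx = (*)" "one Cx = 1" "zero Cx = 0" "add Cx = (+)"
  "module.smult Cx = (*)"
  by (simp_all add: Cx_def)

lemma field_Cx: "field Cx"
proof -
  have "cring Cx"
  proof (rule cringI)
    show "abelian_group Cx"
      by (rule abelian_groupI) (auto simp: add.assoc add.commute intro: exI[of _ "- _"] ab_left_minus)
    show "comm_monoid Cx" by (rule comm_monoidI) auto
  qed (auto simp: distrib_right)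
  then interpret cring Cx .
  show ?thesis
  proof (rule cring_fieldI)
    have "\<exists>y. y * x = 1 \<and> x * y = 1" if "x \<noteq> 0" for x :: complex
      using that by (intro exI[of _ "inverse x"]) auto
    then show "Units Cx = carrier Cx - {\<zero>\<^bsub>Cx\<^esub>}"
      by (auto simp: Units_def)
  qed
qed

lemma cring_Cx: "cring Cx"
  using field_Cx by (simp add: field_def domain_def)

lemma vectorspace_Cx_iff: "vectorspace Cx V \<longleftrightarrow> module Cx V"
  using field_Cx by (simp add: vectorspace_def)

lemma struct_map_Cx [simp]: "struct_map Cx c = c"
  by (simp add: struct_map_def)

text \<open>\<open>Vdim\<close> and \<open>Vact\<close> rest on an arbitrary choice from the class,
  so the class must be non-empty: the identity matrix relates a representation to itself. All
  members are irreducible because \<open>rep_iso\<close> demands it of both sides.\<close>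

lemma Irr_rep:
  assumes "\<rho> \<in> Irr n G"
  shows "irreducible_rep n G (Vdim \<rho>, Vact \<rho>)"
proof -
  obtain x where x: "irreducible_rep n G x" "\<rho> = rep_iso n G `` {x}"
    using assms by (auto simp: Irr_def quotient_def)
  obtain m r where mr: "x = (m, r)" by (cases x)
  have "(x, x) \<in> rep_iso n G"
  proof -
    have "\<forall>g\<in>G. r g \<in> carrier_mat m m"
      using x mr by (auto simp: irreducible_rep_def matrix_rep_def)
    moreover have "1\<^sub>m m \<in> carrier (GL m)"
      by (auto simp: GL_def units_of_def Units_def ring_mat_def intro!: bexI[of _ "1\<^sub>m m"])
    ultimately show ?thesis
      using x mr by (auto simp: rep_iso_def intro!: bexI[of _ "1\<^sub>m m"])
  qed
  then have "x \<in> \<rho>" using x by auto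
  then have "(SOME y. y \<in> \<rho>) \<in> \<rho>" by (rule someI)
  then have "irreducible_rep n G (SOME y. y \<in> \<rho>)"
    using x by (auto simp: rep_iso_def)
  then show ?thesis by (simp add: Vdim_def Vact_def)
qed

lemma Vact_carrier: "\<rho> \<in> Irr n G \<Longrightarrow> g \<in> G \<Longrightarrow> Vact \<rho> g \<in> carrier_mat (Vdim \<rho>) (Vdim \<rho>)"
  using Irr_rep[of \<rho> n G] by (auto simp: irreducible_rep_def matrix_rep_def)

lemma Vact_vec [simp, intro]:
  "\<rho> \<in> Irr n G \<Longrightarrow> g \<in> G \<Longrightarrow> v \<in> carrier_vec (Vdim \<rho>) \<Longrightarrow> Vact \<rho> g *\<^sub>v v \<in> carrier_vec (Vdim \<rho>)"
  using Vact_carrier by (rule mult_mat_vec_carrier)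

section \<open>Complex vector spaces with linear operators indexed by the group, and their
  semisimplicity\<close>

definition gspace :: "complex mat set \<Rightarrow> (complex, complex mat, 'v) gmodule \<Rightarrow> bool" where
  "gspace G V \<longleftrightarrow> module Cx V \<and> (\<forall>g\<in>G. gact V g \<in> module_hom Cx V V)"

definition gsubspace :: "complex mat set \<Rightarrow> (complex, complex mat, 'v) gmodule \<Rightarrow> 'v set \<Rightarrow> bool" where
  "gsubspace G V N \<longleftrightarrow> submodule Cx N V \<and> (\<forall>g\<in>G. \<forall>x\<in>N. gact V g x \<in> N)"

definition gmap :: "complex mat set \<Rightarrow> (complex, complex mat, 'v) gmodule \<Rightarrow>
    (complex, complex mat, 'w) gmodule \<Rightarrow> ('v \<Rightarrow> 'w) \<Rightarrow> bool" where
  "gmap G V W f \<longleftrightarrow> f \<in> module_hom Cx V W \<and>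
     (\<forall>g\<in>G. \<forall>x\<in>carrier V. f (gact V g x) = gact W g (f x))"

abbreviation homs :: "complex mat set \<Rightarrow> irrep \<Rightarrow> (complex, complex mat, 'v) gmodule \<Rightarrow>
    (complex vec \<Rightarrow> 'v) set" where
  "homs G \<rho> V \<equiv> carrier (Hom_G G Cx \<rho> V)"

definition hom_images :: "complex mat set \<Rightarrow> irrep set \<Rightarrow> (complex, complex mat, 'v) gmodule \<Rightarrow> 'v set" where
  "hom_images G E V = (\<Union>\<rho>\<in>E. \<Union>\<phi>\<in>homs G \<rho> V. \<phi> ` carrier_vec (Vdim \<rho>))"

text \<open>The images of irreducibles span the space. Quantifying over subspaces instead of using
  \<open>span\<close> makes the property easy to transport, since subspaces pull back along linear
  maps.\<close>

definition semisimple :: "nat \<Rightarrow> complex mat set \<Rightarrow> (complex, complex mat, 'v) gmodule \<Rightarrow> bool" where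
  "semisimple n G V \<longleftrightarrow> gspace G V \<and>
     (\<forall>N. submodule Cx N V \<and> hom_images G (Irr n G) V \<subseteq> N \<longrightarrow> carrier V \<subseteq> N)"

lemma gspaceD:
  assumes "gspace G V"
  shows "module Cx V" "g \<in> G \<Longrightarrow> x \<in> carrier V \<Longrightarrow> gact V g x \<in> carrier V"
    "g \<in> G \<Longrightarrow> x \<in> carrier V \<Longrightarrow> y \<in> carrier V \<Longrightarrow> gact V g (x \<oplus>\<^bsub>V\<^esub> y) = gact V g x \<oplus>\<^bsub>V\<^esub> gact V g y"
    "g \<in> G \<Longrightarrow> x \<in> carrier V \<Longrightarrow> gact V g (c \<odot>\<^bsub>V\<^esub> x) = c \<odot>\<^bsub>V\<^esub> gact V g x"
  using assms by (auto simp: gspace_def module_hom_def)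

lemma gspace_zero:
  assumes "gspace G V" "g \<in> G"
  shows "gact V g \<zero>\<^bsub>V\<^esub> = \<zero>\<^bsub>V\<^esub>"
proof -
  interpret V: module Cx V by (rule gspaceD(1)[OF assms(1)])
  have "gact V g (0 \<odot>\<^bsub>V\<^esub> \<zero>\<^bsub>V\<^esub>) = 0 \<odot>\<^bsub>V\<^esub> gact V g \<zero>\<^bsub>V\<^esub>"
    using gspaceD(4)[OF assms(1,2)] V.zero_closed by blast
  then show ?thesis
    using V.smult_l_null gspaceD(2)[OF assms, of "\<zero>\<^bsub>V\<^esub>"] by simp
qed

lemma gmapD:
  assumes "gmap G V W f"
  shows "x \<in> carrier V \<Longrightarrow> f x \<in> carrier W"
    "x \<in> carrier V \<Longrightarrow> y \<in> carrier V \<Longrightarrow> f (x \<oplus>\<^bsub>V\<^esub> y) = f x \<oplus>\<^bsub>W\<^esub> f y"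
    "x \<in> carrier V \<Longrightarrow> f (c \<odot>\<^bsub>V\<^esub> x) = c \<odot>\<^bsub>W\<^esub> f x"
    "g \<in> G \<Longrightarrow> x \<in> carrier V \<Longrightarrow> f (gact V g x) = gact W g (f x)"
  using assms by (auto simp: gmap_def module_hom_def)

lemma gmapI:
  assumes "\<And>x. x \<in> carrier V \<Longrightarrow> f x \<in> carrier W"
    "\<And>x y. x \<in> carrier V \<Longrightarrow> y \<in> carrier V \<Longrightarrow> f (x \<oplus>\<^bsub>V\<^esub> y) = f x \<oplus>\<^bsub>W\<^esub> f y"
    "\<And>c x. x \<in> carrier V \<Longrightarrow> f (c \<odot>\<^bsub>V\<^esub> x) = c \<odot>\<^bsub>W\<^esub> f x"
    "\<And>g x. g \<in> G \<Longrightarrow> x \<in> carrier V \<Longrightarrow> f (gact V g x) = gact W g (f x)"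
  shows "gmap G V W f"
  using assms by (auto simp: gmap_def module_hom_def)

lemma gmap_mod_hom: "gspace G V \<Longrightarrow> gspace G W \<Longrightarrow> gmap G V W f \<Longrightarrow> mod_hom Cx V W f"
  by (simp add: mod_hom_def mod_hom_axioms_def gspace_def gmap_def)

lemma homs_iff:
  "\<phi> \<in> homs G \<rho> V \<longleftrightarrow> \<phi> \<in> carrier_vec (Vdim \<rho>) \<rightarrow>\<^sub>E carrier V \<and>
    (\<forall>u\<in>carrier_vec (Vdim \<rho>). \<forall>v\<in>carrier_vec (Vdim \<rho>). \<phi> (u + v) = \<phi> u \<oplus>\<^bsub>V\<^esub> \<phi> v) \<and>
    (\<forall>c. \<forall>v\<in>carrier_vec (Vdim \<rho>). \<phi> (c \<cdot>\<^sub>v v) = c \<odot>\<^bsub>V\<^esub> \<phi> v) \<and>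
    (\<forall>g\<in>G. \<forall>v\<in>carrier_vec (Vdim \<rho>). \<phi> (Vact \<rho> g *\<^sub>v v) = gact V g (\<phi> v))"
  by (simp add: Hom_G_def Let_def)

lemma Hom_G_sel [simp]:
  "zero (Hom_G G Cx \<rho> V) = (\<lambda>v\<in>carrier_vec (Vdim \<rho>). \<zero>\<^bsub>V\<^esub>)"
  "add (Hom_G G Cx \<rho> V) \<phi> \<psi> = (\<lambda>v\<in>carrier_vec (Vdim \<rho>). \<phi> v \<oplus>\<^bsub>V\<^esub> \<psi> v)"
  "module.smult (Hom_G G Cx \<rho> V) c \<phi> = (\<lambda>v\<in>carrier_vec (Vdim \<rho>). c \<odot>\<^bsub>V\<^esub> \<phi> v)"
  by (simp_all add: Hom_G_def Let_def)

lemma homsD: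
  assumes "\<phi> \<in> homs G \<rho> V"
  shows "v \<in> carrier_vec (Vdim \<rho>) \<Longrightarrow> \<phi> v \<in> carrier V"
    "u \<in> carrier_vec (Vdim \<rho>) \<Longrightarrow> v \<in> carrier_vec (Vdim \<rho>) \<Longrightarrow> \<phi> (u + v) = \<phi> u \<oplus>\<^bsub>V\<^esub> \<phi> v"
    "v \<in> carrier_vec (Vdim \<rho>) \<Longrightarrow> \<phi> (c \<cdot>\<^sub>v v) = c \<odot>\<^bsub>V\<^esub> \<phi> v"
    "g \<in> G \<Longrightarrow> v \<in> carrier_vec (Vdim \<rho>) \<Longrightarrow> \<phi> (Vact \<rho> g *\<^sub>v v) = gact V g (\<phi> v)"
    "v \<notin> carrier_vec (Vdim \<rho>) \<Longrightarrow> \<phi> v = undefined"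
  using assms by (auto simp: homs_iff)

lemma homs_zero:
  assumes "module Cx V" "\<phi> \<in> homs G \<rho> V"
  shows "\<phi> (0\<^sub>v (Vdim \<rho>)) = \<zero>\<^bsub>V\<^esub>"
proof -
  interpret V: module Cx V by fact
  have "\<phi> (0 \<cdot>\<^sub>v 0\<^sub>v (Vdim \<rho>)) = 0 \<odot>\<^bsub>V\<^esub> \<phi> (0\<^sub>v (Vdim \<rho>))"
    using homsD(3)[OF assms(2), of "0\<^sub>v (Vdim \<rho>)"] by simp
  moreover have "0 \<cdot>\<^sub>v 0\<^sub>v (Vdim \<rho>) = (0\<^sub>v (Vdim \<rho>) :: complex vec)" by auto
  ultimately show ?thesis
    using V.smult_l_null homsD(1)[OF assms(2), of "0\<^sub>v (Vdim \<rho>)"] by simp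
qed

lemma hom_images_carrier: "hom_images G E V \<subseteq> carrier V"
  using homsD(1) by (fastforce simp: hom_images_def)

lemma homs_compose:
  assumes "gmap G V W f" "\<phi> \<in> homs G \<rho> V" "\<rho> \<in> Irr n G"
  shows "(\<lambda>v\<in>carrier_vec (Vdim \<rho>). f (\<phi> v)) \<in> homs G \<rho> W"
  using homsD[OF assms(2)] gmapD[OF assms(1)] assms(3) by (auto simp: homs_iff)

lemma hom_images_map:
  assumes "gmap G V W f" "E \<subseteq> Irr n G"
  shows "f ` hom_images G E V \<subseteq> hom_images G E W"
proof -
  have "f (\<phi> v) \<in> hom_images G E W"
    if "\<rho> \<in> E" "\<phi> \<in> homs G \<rho> V" "v \<in> carrier_vec (Vdim \<rho>)" for \<rho> \<phi> v
  proof -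
    have "(\<lambda>v\<in>carrier_vec (Vdim \<rho>). f (\<phi> v)) \<in> homs G \<rho> W"
      using homs_compose assms that by blast
    moreover have "f (\<phi> v) = (\<lambda>v\<in>carrier_vec (Vdim \<rho>). f (\<phi> v)) v" using that by simp
    ultimately show ?thesis using that unfolding hom_images_def by blast
  qed
  then show ?thesis by (auto simp: hom_images_def)
qed

lemma submodule_vimage:
  assumes "module R M" "f \<in> module_hom R M M'" "submodule R N M'" "f \<zero>\<^bsub>M\<^esub> = \<zero>\<^bsub>M'\<^esub>"
  shows "submodule R {x \<in> carrier M. f x \<in> N} M"
proof -
  interpret M: module R M by fact
  show ?thesis
    using assms by (auto simp: submodule_def module_hom_def)
qed

lemma gmap_zero: "gspace G V \<Longrightarrow> gspace G W \<Longrightarrow> gmap G V W f \<Longrightarrow> f \<zero>\<^bsub>V\<^esub> = \<zero>\<^bsub>W\<^esub>"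
  using mod_hom.f0_is_0[OF gmap_mod_hom] .

text \<open>A subspace of \<open>W\<close> that contains all images of irreducibles pulls back along
  \<open>f\<close> to a subspace of \<open>V\<close> with the same property.\<close>

lemma semisimple_surj:
  assumes "semisimple n G V" "gspace G W" "gmap G V W f" "f ` carrier V = carrier W"
  shows "semisimple n G W"
proof -
  have V: "gspace G V" using assms by (simp add: semisimple_def)
  have "carrier W \<subseteq> N" if N: "submodule Cx N W" "hom_images G (Irr n G) W \<subseteq> N" for N
  proof -
    have "submodule Cx {x \<in> carrier V. f x \<in> N} V"
      using submodule_vimage[of Cx V f W N] N assms V gmap_zero[OF V assms(2,3)]
      by (auto simp: gspace_def gmap_def)
    moreover have "hom_images G (Irr n G) V \<subseteq> {x \<in> carrier V. f x \<in> N}"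
      using hom_images_map[OF assms(3) subset_refl] N(2) hom_images_carrier[of G "Irr n G" V] by blast
    ultimately have "carrier V \<subseteq> {x \<in> carrier V. f x \<in> N}"
      using assms(1) unfolding semisimple_def by blast
    then show ?thesis unfolding assms(4)[symmetric] by auto
  qed
  then show ?thesis using assms by (auto simp: semisimple_def)
qed

lemma gspace_sub:
  assumes "gspace G V" "gsubspace G V N"
  shows "gspace G (V\<lparr>carrier := N\<rparr>)"
proof -
  interpret V: module Cx V by (rule gspaceD(1)[OF assms(1)])
  have N: "submodule Cx N V" using assms by (simp add: gsubspace_def)
  then have "N \<subseteq> carrier V" by (simp add: submodule_def)
  then show ?thesis
    using V.submodule_is_module[OF N] assms
    by (auto simp: gspace_def module_hom_def gsubspace_def subset_iff)
qed

section \<open>Sums, complements, projections and sections\<close>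

lemma (in module) submodule_inter:
  "submodule R N M \<Longrightarrow> submodule R N' M \<Longrightarrow> submodule R (N \<inter> N') M"
  by (auto simp: submodule_def)

lemma (in module) submodule_minus:
  assumes "submodule R N M" "x \<in> N" shows "\<ominus>\<^bsub>M\<^esub> x \<in> N"
proof -
  have "x \<in> carrier M" using assms by (auto simp: submodule_def)
  then have "\<ominus>\<^bsub>M\<^esub> x = (\<ominus>\<^bsub>R\<^esub> \<one>\<^bsub>R\<^esub>) \<odot>\<^bsub>M\<^esub> x" using smult_minus_1 by simp
  then show ?thesis using assms by (simp add: submodule_def)
qed

lemma (in module) submodule_diff:
  assumes "submodule R N M" "x \<in> N" "y \<in> N" shows "x \<ominus>\<^bsub>M\<^esub> y \<in> N"
  using assms submodule_minus by (simp add: a_minus_def submodule_def)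

lemma (in module) mem_submodule_sum:
  "z \<in> submodule_sum N C \<longleftrightarrow> (\<exists>x\<in>N. \<exists>y\<in>C. z = x \<oplus>\<^bsub>M\<^esub> y)"
  by (auto simp: submodule_sum_def)

lemma gsubspace_sum:
  assumes "gspace G V" "gsubspace G V N" "gsubspace G V C"
  shows "gsubspace G V (module.submodule_sum V N C)"
proof -
  interpret V: module Cx V by (rule gspaceD(1)[OF assms(1)])
  have s: "N \<subseteq> carrier V" "C \<subseteq> carrier V" using assms by (auto simp: gsubspace_def submodule_def)
  show ?thesis
    unfolding gsubspace_def
  proof (intro conjI ballI)
    show "submodule Cx (V.submodule_sum N C) V"
      using assms by (intro V.sum_is_submodule) (auto simp: gsubspace_def)
    fix g z assume "g \<in> G" "z \<in> V.submodule_sum N C"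
    then show "gact V g z \<in> V.submodule_sum N C"
      using assms s gspaceD(3)[OF assms(1)] by (fastforce simp: V.mem_submodule_sum gsubspace_def subset_iff)
  qed
qed

lemma gsubspace_hom_image:
  assumes "gspace G V" "\<phi> \<in> homs G \<rho> V" "\<rho> \<in> Irr n G"
  shows "gsubspace G V (\<phi> ` carrier_vec (Vdim \<rho>))"
proof -
  interpret V: module Cx V by (rule gspaceD(1)[OF assms(1)])
  note h = homsD[OF assms(2)]
  show ?thesis
    unfolding gsubspace_def submodule_def
  proof (intro conjI ballI allI impI)
    show "\<zero>\<^bsub>V\<^esub> \<in> \<phi> ` carrier_vec (Vdim \<rho>)"
      using homs_zero[OF V.module_axioms assms(2)] by (metis imageI zero_carrier_vec)
  qed (use h V.module_axioms assms(3) in \<open>auto simp flip: h(2,3,4)\<close>)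
qed

text \<open>The preimage of \<open>S\<close> under \<open>\<phi>\<close> is an invariant subspace of
  an irreducible representation and is not the whole of it, so it is zero.\<close>

lemma hom_image_disjoint:
  assumes "gspace G V" "\<phi> \<in> homs G \<rho> V" "\<rho> \<in> Irr n G" "gsubspace G V S"
    "\<not> \<phi> ` carrier_vec (Vdim \<rho>) \<subseteq> S" "v \<in> carrier_vec (Vdim \<rho>)" "\<phi> v \<in> S"
  shows "v = 0\<^sub>v (Vdim \<rho>)"
proof -
  note h = homsD[OF assms(2)]
  let ?W = "{v \<in> carrier_vec (Vdim \<rho>). \<phi> v \<in> S}"
  have S: "submodule Cx S V" using assms by (simp add: gsubspace_def)
  have "irreducible_rep n G (Vdim \<rho>, Vact \<rho>)" using Irr_rep assms by blast
  then have "?W = {0\<^sub>v (Vdim \<rho>)} \<or> ?W = carrier_vec (Vdim \<rho>)"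
    unfolding irreducible_rep_def prod.case
    apply (elim conjE)
    apply (erule allE[of _ ?W], erule mp[OF mp])
    using S assms homs_zero[OF gspaceD(1)[OF assms(1)] assms(2)] h
    by (auto simp: submodule_def gsubspace_def)
  then show ?thesis using assms by auto
qed

text \<open>Zorn's lemma gives a maximal invariant \<open>C\<close> meeting \<open>N\<close>
  trivially. An image \<open>P\<close> of an irreducible outside \<open>N + C\<close> would meet
  \<open>N + C\<close> trivially, so \<open>C + P\<close> would still meet \<open>N\<close>
  trivially, against maximality. Hence \<open>N + C\<close> contains every such image and is
  everything.\<close>

lemma semisimple_complement:
  assumes "semisimple n G V" "gsubspace G V N"
  obtains C where "gsubspace G V C" "N \<inter> C = {\<zero>\<^bsub>V\<^esub>}" "module.submodule_sum V N C = carrier V"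
proof -
  have gV: "gspace G V" using assms by (simp add: semisimple_def)
  interpret V: module Cx V by (rule gspaceD(1)[OF gV])
  define \<C> where "\<C> = {C. gsubspace G V C \<and> N \<inter> C = {\<zero>\<^bsub>V\<^esub>}}"
  have N: "submodule Cx N V" using assms by (simp add: gsubspace_def)
  have z: "{\<zero>\<^bsub>V\<^esub>} \<in> \<C>"
    using N gspace_zero[OF gV] V.module_axioms by (auto simp: \<C>_def gsubspace_def submodule_def)
  have "\<exists>M\<in>\<C>. \<forall>X\<in>\<C>. M \<subseteq> X \<longrightarrow> X = M"
  proof (rule subset_Zorn_nonempty)
    show "\<C> \<noteq> {}" using z by auto
    fix \<D> assume ne: "\<D> \<noteq> {}" and ch: "subset.chain \<C> \<D>"
    then have sub: "\<D> \<subseteq> \<C>" and lin: "\<And>x y. x \<in> \<D> \<Longrightarrow> y \<in> \<D> \<Longrightarrow> x \<subseteq> y \<or> y \<subseteq> x"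
      by (auto simp: subset_chain_def)
    have "submodule Cx (\<Union>\<D>) V"
      unfolding submodule_def
    proof (intro conjI allI impI)
      fix v w assume "v \<in> \<Union>\<D>" "w \<in> \<Union>\<D>"
      then obtain x y where xy: "x \<in> \<D>" "y \<in> \<D>" "v \<in> x" "w \<in> y" by auto
      then obtain z where z: "z \<in> \<D>" "v \<in> z" "w \<in> z" using lin by blast
      then have "submodule Cx z V" using sub by (auto simp: \<C>_def gsubspace_def)
      then show "v \<oplus>\<^bsub>V\<^esub> w \<in> \<Union>\<D>" using z by (auto simp: submodule_def)
    qed (use sub ne V.module_axioms in \<open>fastforce simp: \<C>_def gsubspace_def submodule_def\<close>)+
    then show "\<Union>\<D> \<in> \<C>"
      using sub ne by (fastforce simp: \<C>_def gsubspace_def)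
  qed
  then obtain C where C: "gsubspace G V C" "N \<inter> C = {\<zero>\<^bsub>V\<^esub>}"
    and max: "\<And>X. gsubspace G V X \<Longrightarrow> N \<inter> X = {\<zero>\<^bsub>V\<^esub>} \<Longrightarrow> C \<subseteq> X \<Longrightarrow> X = C"
    by (auto simp: \<C>_def)
  let ?S = "V.submodule_sum N C"
  have C': "submodule Cx C V" using C by (simp add: gsubspace_def)
  have S: "gsubspace G V ?S" using gsubspace_sum gV assms C by auto
  then have S': "submodule Cx ?S V" by (simp add: gsubspace_def)
  have "hom_images G (Irr n G) V \<subseteq> ?S"
  proof -
    have "\<phi> ` carrier_vec (Vdim \<rho>) \<subseteq> ?S" if \<phi>: "\<rho> \<in> Irr n G" "\<phi> \<in> homs G \<rho> V" for \<rho> \<phi>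
    proof (rule ccontr)
      assume no: "\<not> \<phi> ` carrier_vec (Vdim \<rho>) \<subseteq> ?S"
      let ?P = "\<phi> ` carrier_vec (Vdim \<rho>)"
      let ?X = "V.submodule_sum C ?P"
      have P: "gsubspace G V ?P" using gsubspace_hom_image gV \<phi> by blast
      then have P': "submodule Cx ?P V" by (simp add: gsubspace_def)
      have X: "gsubspace G V ?X" using gsubspace_sum gV P C by auto
      have CX: "C \<subseteq> ?X" using V.in_sum C' P' by auto
      have PX: "?P \<subseteq> ?X" using V.in_sum[OF P' C'] V.msum_comm[OF P' C'] by auto
      have "N \<inter> ?X \<subseteq> {\<zero>\<^bsub>V\<^esub>}"
      proof
        fix x assume "x \<in> N \<inter> ?X"
        then obtain c v where c: "x \<in> N" "c \<in> C" "v \<in> carrier_vec (Vdim \<rho>)" "x = c \<oplus>\<^bsub>V\<^esub> \<phi> v"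
          by (auto simp: V.mem_submodule_sum)
        have car: "x \<in> carrier V" "c \<in> carrier V" "\<phi> v \<in> carrier V"
          using c N C' homsD(1)[OF \<phi>(2)] by (auto simp: submodule_def)
        \<comment> \<open>The component of \<open>x\<close> in the irreducible image is the
          difference of an element of \<open>N\<close> and one of \<open>C\<close>, so it lies in
          \<open>N + C\<close> and vanishes by irreducibility.\<close>
        have "\<phi> v = x \<oplus>\<^bsub>V\<^esub> \<ominus>\<^bsub>V\<^esub> c"
          using c car by (metis V.add.m_comm V.minus_other_side V.add.inv_closed V.r_neg1 a_minus_def)
        then have "\<phi> v \<in> ?S" using c V.submodule_minus[OF C'] by (auto simp: V.mem_submodule_sum)
        then have "v = 0\<^sub>v (Vdim \<rho>)" using hom_image_disjoint[OF gV \<phi>(2,1) S no] c by auto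
        then have "x = c" using homs_zero[OF V.module_axioms \<phi>(2)] c car by simp
        then show "x \<in> {\<zero>\<^bsub>V\<^esub>}" using C c by auto
      qed
      then have "N \<inter> ?X = {\<zero>\<^bsub>V\<^esub>}" using N X by (auto simp: submodule_def gsubspace_def)
      then have "?X = C" using max X CX by auto
      then have "?P \<subseteq> ?S" using PX V.in_sum[OF C' N] V.msum_comm[OF C' N] by auto
      then show False using no by auto
    qed
    then show ?thesis by (auto simp: hom_images_def)
  qed
  then have "carrier V \<subseteq> ?S" using S' assms by (auto simp: semisimple_def)
  moreover have "?S \<subseteq> carrier V" using S' by (auto simp: submodule_def)
  ultimately show ?thesis using that C by auto
qed

lemma (in module) diff_eq_zero: "x \<in> carrier M \<Longrightarrow> y \<in> carrier M \<Longrightarrow> x \<ominus>\<^bsub>M\<^esub> y = \<zero>\<^bsub>M\<^esub> \<longleftrightarrow> x = y"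
  by (metis M.add.inv_closed M.minus_equality M.minus_minus M.r_neg a_minus_def)

lemma gsubspace_ker:
  assumes "gspace G V" "gspace G W" "gmap G V W f"
  shows "gsubspace G V {x \<in> carrier V. f x = \<zero>\<^bsub>W\<^esub>}"
proof -
  interpret f: mod_hom Cx V W f using gmap_mod_hom assms .
  have "submodule Cx {x \<in> carrier V. f x = \<zero>\<^bsub>W\<^esub>} V"
    using f.ker_is_submodule by (simp add: f.ker_def)
  then show ?thesis
    using gspaceD(2)[OF assms(1)] gmapD(4)[OF assms(3)] gspace_zero[OF assms(2)]
    by (auto simp: gsubspace_def)
qed

text \<open>Projection along a complement. It presents a submodule as a quotient as well, so that
  whatever passes along surjections also passes to submodules.\<close>

lemma semisimple_projection:
  assumes "semisimple n G V" "gsubspace G V N"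
  obtains \<pi> where "gmap G V (V\<lparr>carrier := N\<rparr>) \<pi>" "\<forall>x\<in>N. \<pi> x = x"
    "\<pi> ` carrier V = carrier (V\<lparr>carrier := N\<rparr>)"
proof -
  have gV: "gspace G V" using assms by (simp add: semisimple_def)
  interpret V: module Cx V by (rule gspaceD(1)[OF gV])
  obtain C where C: "gsubspace G V C" "N \<inter> C = {\<zero>\<^bsub>V\<^esub>}" "V.submodule_sum N C = carrier V"
    using semisimple_complement assms by blast
  have N': "submodule Cx N V" and C': "submodule Cx C V"
    using assms C by (auto simp: gsubspace_def)
  then have sub: "N \<subseteq> carrier V" "C \<subseteq> carrier V" by (auto simp: submodule_def)
  define \<pi> where "\<pi> x = (THE a. a \<in> N \<and> (\<exists>c\<in>C. x = a \<oplus>\<^bsub>V\<^esub> c))" for x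
  have \<pi>: "\<pi> (a \<oplus>\<^bsub>V\<^esub> c) = a" if ac: "a \<in> N" "c \<in> C" for a c
    unfolding \<pi>_def
  proof (rule the_equality)
    fix b assume "b \<in> N \<and> (\<exists>d\<in>C. a \<oplus>\<^bsub>V\<^esub> c = b \<oplus>\<^bsub>V\<^esub> d)"
    then obtain d where b: "b \<in> N" "d \<in> C" "a \<oplus>\<^bsub>V\<^esub> c = b \<oplus>\<^bsub>V\<^esub> d" by auto
    have car: "a \<in> carrier V" "b \<in> carrier V" "c \<in> carrier V" "d \<in> carrier V" using ac b sub by auto
    have "b \<ominus>\<^bsub>V\<^esub> a = c \<ominus>\<^bsub>V\<^esub> d"
    proof -
      have "b \<ominus>\<^bsub>V\<^esub> a = (b \<oplus>\<^bsub>V\<^esub> d) \<ominus>\<^bsub>V\<^esub> (a \<oplus>\<^bsub>V\<^esub> d)"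
        using car by (simp add: a_minus_def V.minus_add V.a_ac V.r_neg V.r_neg1 V.r_neg2)
      also have "\<dots> = (a \<oplus>\<^bsub>V\<^esub> c) \<ominus>\<^bsub>V\<^esub> (a \<oplus>\<^bsub>V\<^esub> d)" using b by simp
      also have "\<dots> = (a \<ominus>\<^bsub>V\<^esub> a) \<oplus>\<^bsub>V\<^esub> (c \<ominus>\<^bsub>V\<^esub> d)"
        using car by (simp add: a_minus_def V.minus_add V.a_ac)
      also have "\<dots> = c \<ominus>\<^bsub>V\<^esub> d" using car by (simp add: V.diff_eq_zero)
      finally show ?thesis .
    qed
    then have "b \<ominus>\<^bsub>V\<^esub> a \<in> N \<inter> C"
      using V.submodule_diff[OF N' b(1) ac(1)] V.submodule_diff[OF C' ac(2) b(2)] by auto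
    then have "b \<ominus>\<^bsub>V\<^esub> a = \<zero>\<^bsub>V\<^esub>" using C(2) by blast
    then show "b = a" using V.diff_eq_zero car by auto
  qed (use ac in auto)
  have dec: "\<exists>a\<in>N. \<exists>c\<in>C. x = a \<oplus>\<^bsub>V\<^esub> c" if "x \<in> carrier V" for x
    using that C(3) V.mem_submodule_sum by blast
  have hom: "gmap G V (V\<lparr>carrier := N\<rparr>) \<pi>"
  proof (rule gmapI)
    fix x assume "x \<in> carrier V"
    then obtain a c where x: "a \<in> N" "c \<in> C" "x = a \<oplus>\<^bsub>V\<^esub> c" using dec by blast
    then have car: "a \<in> carrier V" "c \<in> carrier V" using sub by auto
    show "\<pi> x \<in> carrier (V\<lparr>carrier := N\<rparr>)" using \<pi> x by simp
    show "\<pi> (t \<odot>\<^bsub>V\<^esub> x) = t \<odot>\<^bsub>V\<lparr>carrier := N\<rparr>\<^esub> \<pi> x" for t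
    proof -
      have "t \<odot>\<^bsub>V\<^esub> x = t \<odot>\<^bsub>V\<^esub> a \<oplus>\<^bsub>V\<^esub> t \<odot>\<^bsub>V\<^esub> c"
        using x car by (simp add: V.smult_r_distr)
      moreover have "t \<odot>\<^bsub>V\<^esub> a \<in> N" "t \<odot>\<^bsub>V\<^esub> c \<in> C" using N' C' x by (auto simp: submodule_def)
      ultimately show ?thesis using \<pi> x by simp
    qed
    show "\<pi> (gact V g x) = gact (V\<lparr>carrier := N\<rparr>) g (\<pi> x)" if "g \<in> G" for g
    proof -
      have "gact V g a \<in> N" "gact V g c \<in> C" using that x assms C by (auto simp: gsubspace_def)
      then show ?thesis using \<pi> x gspaceD(3)[OF gV that car] by simp
    qed
    fix y assume "y \<in> carrier V"
    then obtain b d where y: "b \<in> N" "d \<in> C" "y = b \<oplus>\<^bsub>V\<^esub> d" using dec by blast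
    then have car': "b \<in> carrier V" "d \<in> carrier V" using sub by auto
    have "x \<oplus>\<^bsub>V\<^esub> y = (a \<oplus>\<^bsub>V\<^esub> b) \<oplus>\<^bsub>V\<^esub> (c \<oplus>\<^bsub>V\<^esub> d)" using x y car car' by (simp add: V.a_ac)
    moreover have "a \<oplus>\<^bsub>V\<^esub> b \<in> N" "c \<oplus>\<^bsub>V\<^esub> d \<in> C" using N' C' x y by (auto simp: submodule_def)
    ultimately show "\<pi> (x \<oplus>\<^bsub>V\<^esub> y) = \<pi> x \<oplus>\<^bsub>V\<lparr>carrier := N\<rparr>\<^esub> \<pi> y"
      using \<pi> x y by simp
  qed
  have id: "\<pi> x = x" if "x \<in> N" for x
  proof -
    have "\<zero>\<^bsub>V\<^esub> \<in> C" using C' by (auto simp: submodule_def)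
    then have "\<pi> (x \<oplus>\<^bsub>V\<^esub> \<zero>\<^bsub>V\<^esub>) = x" using \<pi> that by blast
    moreover have "x \<oplus>\<^bsub>V\<^esub> \<zero>\<^bsub>V\<^esub> = x" using sub that by auto
    ultimately show ?thesis by simp
  qed
  have "\<pi> ` carrier V = carrier (V\<lparr>carrier := N\<rparr>)"
    using gmapD(1)[OF hom] id sub(1) by (force simp: image_iff)
  then show ?thesis using that hom id by blast
qed

text \<open>A complement of the kernel is mapped bijectively onto \<open>W\<close>, and the inverse
  bijection is the section.\<close>

lemma semisimple_section:
  assumes "semisimple n G V" "gspace G W" "gmap G V W f" "f ` carrier V = carrier W"
  obtains s where "gmap G W V s" "\<And>y. y \<in> carrier W \<Longrightarrow> f (s y) = y"
proof -
  have gV: "gspace G V" using assms by (simp add: semisimple_def)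
  interpret V: module Cx V by (rule gspaceD(1)[OF gV])
  interpret f: mod_hom Cx V W f using gmap_mod_hom gV assms(2,3) .
  let ?K = "{x \<in> carrier V. f x = \<zero>\<^bsub>W\<^esub>}"
  obtain C where C: "gsubspace G V C" "?K \<inter> C = {\<zero>\<^bsub>V\<^esub>}" "V.submodule_sum ?K C = carrier V"
    using semisimple_complement assms gsubspace_ker[OF gV assms(2,3)] by blast
  have C': "submodule Cx C V" using C by (auto simp: gsubspace_def)
  then have sub: "C \<subseteq> carrier V" by (auto simp: submodule_def)
  have inj: "inj_on f C"
  proof (rule inj_onI)
    fix c d assume cd: "c \<in> C" "d \<in> C" "f c = f d"
    then have car: "c \<in> carrier V" "d \<in> carrier V" using sub by auto
    have "f (c \<ominus>\<^bsub>V\<^esub> d) = \<zero>\<^bsub>W\<^esub>"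
      using car cd f.N.diff_eq_zero f.f_im by (metis f.f_minus)
    then have "c \<ominus>\<^bsub>V\<^esub> d \<in> ?K \<inter> C" using V.submodule_diff[OF C'] cd car by auto
    then have "c \<ominus>\<^bsub>V\<^esub> d = \<zero>\<^bsub>V\<^esub>" using C(2) by blast
    then show "c = d" using V.diff_eq_zero car by auto
  qed
  have surj: "\<exists>c\<in>C. y = f c" if "y \<in> carrier W" for y
  proof -
    obtain x where x: "x \<in> carrier V" "y = f x" using assms(4) \<open>y \<in> carrier W\<close> by auto
    then obtain k c where kc: "k \<in> ?K" "c \<in> C" "x = k \<oplus>\<^bsub>V\<^esub> c"
      using C(3) V.mem_submodule_sum by blast
    then have "f x = f c" using sub by (auto simp: subset_iff)
    then show ?thesis using kc x by auto
  qed
  define s where "s = inv_into C f"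
  have s: "s (f c) = c" if "c \<in> C" for c using inj that by (simp add: s_def)
  have "gmap G W V s"
  proof (rule gmapI)
    fix y assume "y \<in> carrier W"
    then obtain c where y: "c \<in> C" "y = f c" using surj by blast
    then have car: "c \<in> carrier V" using sub by auto
    show "s y \<in> carrier V" using s y car by simp
    show "s (t \<odot>\<^bsub>W\<^esub> y) = t \<odot>\<^bsub>V\<^esub> s y" for t
    proof -
      have "t \<odot>\<^bsub>V\<^esub> c \<in> C" using C' y by (auto simp: submodule_def)
      then show ?thesis using s[of "t \<odot>\<^bsub>V\<^esub> c"] s[of c] y car gmapD(3)[OF assms(3) car, of t] by simp
    qed
    show "s (gact W g y) = gact V g (s y)" if "g \<in> G" for g
    proof -
      have "gact V g c \<in> C" using that y C by (auto simp: gsubspace_def)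
      then show ?thesis using s[of "gact V g c"] s[of c] y gmapD(4)[OF assms(3) that car] by simp
    qed
    fix y' assume "y' \<in> carrier W"
    then obtain c' where y': "c' \<in> C" "y' = f c'" using surj by blast
    then have car': "c' \<in> carrier V" using sub by auto
    have "c \<oplus>\<^bsub>V\<^esub> c' \<in> C" using C' y y' by (auto simp: submodule_def)
    then show "s (y \<oplus>\<^bsub>W\<^esub> y') = s y \<oplus>\<^bsub>V\<^esub> s y'"
      using s[of "c \<oplus>\<^bsub>V\<^esub> c'"] s[of c] s[of c'] y y' gmapD(2)[OF assms(3) car car'] by simp
  qed
  moreover have "f (s y) = y" if "y \<in> carrier W" for y using surj[OF that] s by auto
  ultimately show ?thesis using that by blast
qed

section \<open>Multiplicity spaces and their exactness\<close>

lemma module_Hom_G: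
  assumes "gspace G V" "\<rho> \<in> Irr n G"
  shows "module Cx (Hom_G G Cx \<rho> V)"
proof -
  interpret V: module Cx V by (rule gspaceD(1)[OF assms(1)])
  let ?H = "Hom_G G Cx \<rho> V" and ?V = "carrier_vec (Vdim \<rho>) :: complex vec set"
  note gs = gspaceD(2-4)[OF assms(1)]
  show ?thesis
  proof (rule module_criteria)
    show zero: "\<zero>\<^bsub>?H\<^esub> \<in> carrier ?H"
      using assms gspace_zero[OF assms(1)] by (auto simp: homs_iff)
    have add: "\<phi> \<oplus>\<^bsub>?H\<^esub> \<psi> \<in> carrier ?H" if "\<phi> \<in> carrier ?H" "\<psi> \<in> carrier ?H" for \<phi> \<psi>
      using homsD(1-4)[OF that(1)] homsD(1-4)[OF that(2)] gs assms
      by (auto simp: homs_iff V.smult_r_distr V.a_ac)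
    then show "\<forall>v w. v \<in> carrier ?H \<and> w \<in> carrier ?H \<longrightarrow> v \<oplus>\<^bsub>?H\<^esub> w \<in> carrier ?H" by blast
    have smult: "c \<odot>\<^bsub>?H\<^esub> \<phi> \<in> carrier ?H" if "\<phi> \<in> carrier ?H" for c \<phi>
      using homsD(1-4)[OF that] gs assms
      by (auto simp: homs_iff V.smult_r_distr V.smult_assoc1[symmetric] mult.commute)
    then show "\<forall>c v. c \<in> carrier Cx \<and> v \<in> carrier ?H \<longrightarrow> c \<odot>\<^bsub>?H\<^esub> v \<in> carrier ?H" by blast
    show "\<forall>v\<in>carrier ?H. \<exists>neg_v\<in>carrier ?H. v \<oplus>\<^bsub>?H\<^esub> neg_v = \<zero>\<^bsub>?H\<^esub>"
    proof
      fix \<phi> assume \<phi>: "\<phi> \<in> carrier ?H"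
      have "\<phi> v \<oplus>\<^bsub>V\<^esub> (- 1) \<odot>\<^bsub>V\<^esub> \<phi> v = \<zero>\<^bsub>V\<^esub>" if "v \<in> ?V" for v
      proof -
        have "(1 + (- 1)) \<odot>\<^bsub>V\<^esub> \<phi> v = 1 \<odot>\<^bsub>V\<^esub> \<phi> v \<oplus>\<^bsub>V\<^esub> (- 1) \<odot>\<^bsub>V\<^esub> \<phi> v"
          using V.smult_l_distr[of 1 "- 1" "\<phi> v"] homsD(1)[OF \<phi> that] by simp
        then show ?thesis using homsD(1)[OF \<phi> that] V.smult_one V.smult_l_null by simp
      qed
      then have "\<phi> \<oplus>\<^bsub>?H\<^esub> ((- 1) \<odot>\<^bsub>?H\<^esub> \<phi>) = \<zero>\<^bsub>?H\<^esub>" by (auto simp: restrict_def fun_eq_iff)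
      then show "\<exists>neg_v\<in>carrier ?H. \<phi> \<oplus>\<^bsub>?H\<^esub> neg_v = \<zero>\<^bsub>?H\<^esub>" using smult[OF \<phi>] by blast
    qed
  qed (auto simp: cring_Cx restrict_def fun_eq_iff homsD V.a_ac V.smult_r_distr
      V.smult_l_distr[simplified] V.smult_assoc1[simplified] V.smult_one[simplified])
qed

abbreviation hom_dim :: "complex mat set \<Rightarrow> irrep \<Rightarrow> (complex, complex mat, 'v) gmodule \<Rightarrow> nat" where
  "hom_dim G \<rho> V \<equiv> vectorspace.dim Cx (Hom_G G Cx \<rho> V)"

abbreviation hom_fin :: "complex mat set \<Rightarrow> irrep \<Rightarrow> (complex, complex mat, 'v) gmodule \<Rightarrow> bool" where
  "hom_fin G \<rho> V \<equiv> vectorspace.fin_dim Cx (Hom_G G Cx \<rho> V)"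

text \<open>Composition with \<open>f\<close> maps the multiplicity space of \<open>V\<close> onto
  that of \<open>W\<close>, because composition with a section of \<open>f\<close> lifts every
  element. Its kernel is the multiplicity space of the kernel of \<open>f\<close>, and rank-nullity
  gives the count.\<close>

lemma Hom_G_exact:
  assumes "semisimple n G V" "gspace G W" "gmap G V W f" "f ` carrier V = carrier W"
    and "\<rho> \<in> Irr n G" "hom_fin G \<rho> V"
  shows "hom_fin G \<rho> W"
    and "hom_dim G \<rho> V = hom_dim G \<rho> (V\<lparr>carrier := {x \<in> carrier V. f x = \<zero>\<^bsub>W\<^esub>}\<rparr>) + hom_dim G \<rho> W"
proof -
  have gV: "gspace G V" using assms by (simp add: semisimple_def)
  let ?U = "carrier_vec (Vdim \<rho>) :: complex vec set" and ?K = "{x \<in> carrier V. f x = \<zero>\<^bsub>W\<^esub>}"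
  let ?HV = "Hom_G G Cx \<rho> V" and ?HW = "Hom_G G Cx \<rho> W"
  define T where "T \<phi> = (\<lambda>v\<in>?U. f (\<phi> v))" for \<phi>
  interpret HV: vectorspace Cx ?HV
    using module_Hom_G[OF gV assms(5)] by (simp add: vectorspace_Cx_iff)
  interpret HW: vectorspace Cx ?HW
    using module_Hom_G[OF assms(2,5)] by (simp add: vectorspace_Cx_iff)
  have "T \<in> module_hom Cx ?HV ?HW"
    using homs_compose[OF assms(3) _ assms(5)] gmapD(2,3)[OF assms(3)] homsD(1)[of _ G \<rho> V]
    by (auto simp: module_hom_def T_def restrict_def fun_eq_iff)
  then interpret T: linear_map Cx ?HV ?HW T by unfold_locales
  have surj: "T ` carrier ?HV = carrier ?HW"
  proof
    show "T ` carrier ?HV \<subseteq> carrier ?HW" using homs_compose[OF assms(3) _ assms(5)] by (auto simp: T_def)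
    obtain s where s: "gmap G W V s" "\<And>y. y \<in> carrier W \<Longrightarrow> f (s y) = y"
      using semisimple_section[OF assms(1-4)] by blast
    show "carrier ?HW \<subseteq> T ` carrier ?HV"
    proof
      fix \<psi> assume \<psi>: "\<psi> \<in> carrier ?HW"
      have "\<psi> = T (\<lambda>v\<in>?U. s (\<psi> v))"
        using s(2) homsD(1,5)[OF \<psi>] by (auto simp: T_def fun_eq_iff restrict_def)
      then show "\<psi> \<in> T ` carrier ?HV" using homs_compose[OF s(1) \<psi> assms(5)] by blast
    qed
  qed
  show "hom_fin G \<rho> W" using T.rank_nullity_main(2)[OF assms(6) surj] .
  have "T.ker = homs G \<rho> (V\<lparr>carrier := ?K\<rparr>)"
  proof -
    have "T \<phi> = \<zero>\<^bsub>?HW\<^esub> \<longleftrightarrow> (\<forall>v\<in>?U. f (\<phi> v) = \<zero>\<^bsub>W\<^esub>)" for \<phi>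
      by (auto simp: T_def restrict_def fun_eq_iff)
    then show ?thesis unfolding T.ker_def by (auto simp: homs_iff PiE_iff)
  qed
  then have "?HV\<lparr>carrier := T.ker\<rparr> = Hom_G G Cx \<rho> (V\<lparr>carrier := ?K\<rparr>)"
    by (simp add: Hom_G_def Let_def)
  moreover have "?HW\<lparr>carrier := T.im\<rparr> = ?HW"
    using T.surj_imp_imT_carrier[OF surj] by simp
  ultimately show "hom_dim G \<rho> V = hom_dim G \<rho> (V\<lparr>carrier := ?K\<rparr>) + hom_dim G \<rho> W"
    using T.rank_nullity[OF assms(6)] by simp
qed

lemma hom_dim_zero_iff:
  assumes "gspace G V" "\<rho> \<in> Irr n G" "hom_fin G \<rho> V"
  shows "hom_dim G \<rho> V = 0 \<longleftrightarrow> homs G \<rho> V = {\<zero>\<^bsub>Hom_G G Cx \<rho> V\<^esub>}"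
proof -
  interpret H: vectorspace Cx "Hom_G G Cx \<rho> V"
    using module_Hom_G[OF assms(1,2)] by (simp add: vectorspace_Cx_iff)
  obtain B where B: "finite B" "H.basis B" using H.finite_basis_exists assms by auto
  have e: "H.span {} = {\<zero>\<^bsub>Hom_G G Cx \<rho> V\<^esub>}" by (rule H.span_empty)
  show ?thesis
  proof
    assume "hom_dim G \<rho> V = 0"
    then have "B = {}" using H.dim_basis[OF B] B by simp
    then show "homs G \<rho> V = {\<zero>\<^bsub>Hom_G G Cx \<rho> V\<^esub>}" using B e by (simp add: H.basis_def)
  next
    assume "homs G \<rho> V = {\<zero>\<^bsub>Hom_G G Cx \<rho> V\<^esub>}"
    then show "hom_dim G \<rho> V = 0"
      using H.gen_ge_dim[of "{}"] e by simp
  qed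
qed

text \<open>The conditions on the underlying complex space of an equivariant module, bundled because
  they pass together to images and to submodules.\<close>

definition admissible :: "nat \<Rightarrow> complex mat set \<Rightarrow> (complex, complex mat, 'v) gmodule \<Rightarrow> bool" where
  "admissible n G V \<longleftrightarrow> rational_gmodule n G V \<and> semisimple n G V \<and> (\<forall>\<rho>\<in>Irr n G. hom_fin G \<rho> V)"

lemma (in mod_hom) hom_finsum:
  "finite I \<Longrightarrow> u \<in> I \<rightarrow> carrier M \<Longrightarrow> f (\<Oplus>\<^bsub>M\<^esub>i\<in>I. u i) = (\<Oplus>\<^bsub>N\<^esub>i\<in>I. f (u i))"
proof (induction I rule: finite_induct)
  case (insert i I)
  then have "(\<Oplus>\<^bsub>N\<^esub>j\<in>insert i I. f (u j)) = f (u i) \<oplus>\<^bsub>N\<^esub> (\<Oplus>\<^bsub>N\<^esub>j\<in>I. f (u j))"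
    by (intro N.M.finsum_insert) auto
  with insert show ?case by (simp add: Pi_def)
qed simp

text \<open>The coaction on \<open>f x\<close> is that on \<open>x\<close> with the same
  coefficients \<open>c\<close> and with the vectors \<open>w i\<close> replaced by their
  images.\<close>

lemma rational_surj:
  assumes "rational_gmodule n G V" "gspace G W" "gmap G V W f" "f ` carrier V = carrier W"
    "\<And>g k. g \<in> G \<Longrightarrow> k \<in> G \<Longrightarrow> g * k \<in> G" "1\<^sub>m n \<in> G"
  shows "rational_gmodule n G W"
proof -
  have gV: "gspace G V" using assms by (simp add: rational_gmodule_def gspace_def)
  interpret f: mod_hom Cx V W f using gmap_mod_hom gV assms(2,3) .
  note gs = gspaceD(2)[OF gV] and m = gmapD[OF assms(3)]
  have W: "\<exists>x\<in>carrier V. y = f x" if "y \<in> carrier W" for y using assms(4) that by auto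
  show ?thesis
    unfolding rational_gmodule_def
  proof (intro conjI ballI)
    show "module Cx W" by (rule gspaceD(1)[OF assms(2)])
    show "gact W g \<in> module_hom Cx W W" if "g \<in> G" for g
      using assms(2) that by (auto simp: gspace_def)
    show "gact W (1\<^sub>m n) y = y" if y: "y \<in> carrier W" for y
    proof -
      obtain x where "x \<in> carrier V" "y = f x" using W[OF y] by auto
      then show ?thesis using assms(1) m(4)[OF assms(6), of x] by (simp add: rational_gmodule_def)
    qed
    show "gact W (g * k) y = gact W g (gact W k y)" if gk: "g \<in> G" "k \<in> G" "y \<in> carrier W" for g k y
    proof -
      obtain x where x: "x \<in> carrier V" "y = f x" using W gk by auto
      have "gact V (g * k) x = gact V g (gact V k x)"
        using assms(1) gk x by (auto simp: rational_gmodule_def)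
      then show ?thesis
        using m(4)[OF assms(5)[OF gk(1,2)] x(1)] m(4)[OF gk(1) gs[OF gk(2) x(1)]] m(4)[OF gk(2) x(1)] x
        by simp
    qed
    fix y assume "y \<in> carrier W"
    then obtain x where x: "x \<in> carrier V" "y = f x" using W by auto
    then obtain k :: nat and w c where kwc: "\<forall>i<k. w i \<in> carrier V \<and> c i \<in> reg_fun n"
      "\<forall>g\<in>G. gact V g x = (\<Oplus>\<^bsub>V\<^esub>i\<in>{..<k}. c i g \<odot>\<^bsub>V\<^esub> w i)"
      using assms(1) by (auto simp: rational_gmodule_def)
    have "gact W g y = (\<Oplus>\<^bsub>W\<^esub>i\<in>{..<k}. c i g \<odot>\<^bsub>W\<^esub> f (w i))" if g: "g \<in> G" for g
    proof -
      have "gact W g y = f (\<Oplus>\<^bsub>V\<^esub>i\<in>{..<k}. c i g \<odot>\<^bsub>V\<^esub> w i)"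
        using m(4)[OF g x(1)] x kwc g by simp
      also have "\<dots> = (\<Oplus>\<^bsub>W\<^esub>i\<in>{..<k}. f (c i g \<odot>\<^bsub>V\<^esub> w i))"
        using kwc by (intro f.hom_finsum) auto
      also have "\<dots> = (\<Oplus>\<^bsub>W\<^esub>i\<in>{..<k}. c i g \<odot>\<^bsub>W\<^esub> f (w i))"
        using kwc m(1,3) by (intro f.N.M.finsum_cong') auto
      finally show ?thesis .
    qed
    then show "\<exists>(k::nat) w c. (\<forall>i<k. w i \<in> carrier W \<and> c i \<in> reg_fun n) \<and>
        (\<forall>g\<in>G. gact W g y = (\<Oplus>\<^bsub>W\<^esub>i\<in>{..<k}. c i g \<odot>\<^bsub>W\<^esub> w i))"
      using kwc m(1) by (intro exI[of _ k] exI[of _ "\<lambda>i. f (w i)"] exI[of _ c]) auto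
  qed
qed

lemma admissible_surj:
  assumes "admissible n G V" "gspace G W" "gmap G V W f" "f ` carrier V = carrier W"
    "\<And>g k. g \<in> G \<Longrightarrow> k \<in> G \<Longrightarrow> g * k \<in> G" "1\<^sub>m n \<in> G"
  shows "admissible n G W"
  using rational_surj[OF _ assms(2-6)] semisimple_surj[OF _ assms(2-4)] Hom_G_exact(1)[OF _ assms(2-4)] assms(1)
  unfolding admissible_def by blast

lemma admissible_sub:
  assumes "admissible n G V" "gsubspace G V N"
    "\<And>g k. g \<in> G \<Longrightarrow> k \<in> G \<Longrightarrow> g * k \<in> G" "1\<^sub>m n \<in> G"
  shows "admissible n G (V\<lparr>carrier := N\<rparr>)"
proof -
  have s: "semisimple n G V" using assms by (simp add: admissible_def)
  then have gV: "gspace G V" by (simp add: semisimple_def)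
  obtain \<pi> where \<pi>: "gmap G V (V\<lparr>carrier := N\<rparr>) \<pi>" "\<forall>x\<in>N. \<pi> x = x"
    "\<pi> ` carrier V = carrier (V\<lparr>carrier := N\<rparr>)"
    using semisimple_projection[OF s assms(2)] by blast
  show ?thesis by (rule admissible_surj[OF assms(1) gspace_sub[OF gV assms(2)] \<pi>(1,3) assms(3,4)])
qed

section \<open>Quotient modules\<close>

text \<open>Every element of \<open>M'\<close> is an image, so each axiom is inherited from
  \<open>M\<close>. For \<open>quot_module\<close> this replaces a verification of the axioms on
  cosets.\<close>

lemma module_surj:
  assumes "module R M" "f \<in> module_hom R M M'" "f ` carrier M = carrier M'" "f \<zero>\<^bsub>M\<^esub> = \<zero>\<^bsub>M'\<^esub>"
  shows "module R M'"
proof -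
  interpret M: module R M by fact
  have cl: "\<And>x. x \<in> carrier M \<Longrightarrow> f x \<in> carrier M'"
    and add: "\<And>x y. x \<in> carrier M \<Longrightarrow> y \<in> carrier M \<Longrightarrow> f x \<oplus>\<^bsub>M'\<^esub> f y = f (x \<oplus>\<^bsub>M\<^esub> y)"
    and sm: "\<And>a x. a \<in> carrier R \<Longrightarrow> x \<in> carrier M \<Longrightarrow> a \<odot>\<^bsub>M'\<^esub> f x = f (a \<odot>\<^bsub>M\<^esub> x)"
    using assms(2) by (auto simp: module_hom_def)
  have z: "f x \<oplus>\<^bsub>M'\<^esub> \<zero>\<^bsub>M'\<^esub> = f x" if "x \<in> carrier M" for x
    using add[OF that M.zero_closed] that assms(4) by simp
  show ?thesis
    by (rule module_criteria)
      (auto simp: assms(3)[symmetric] assms(4)[symmetric] add sm cl M.R.is_cring M.a_ac M.smult_l_distr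
        M.smult_r_distr M.smult_assoc1 M.r_neg intro!: bexI[of _ "\<ominus>\<^bsub>M\<^esub> _"])
qed

lemma submodule_image:
  assumes "module R M" "f \<in> module_hom R M M'" "f \<zero>\<^bsub>M\<^esub> = \<zero>\<^bsub>M'\<^esub>" "module R M'" "submodule R N M"
  shows "submodule R (f ` N) M'"
proof -
  have cl: "\<And>x. x \<in> carrier M \<Longrightarrow> f x \<in> carrier M'"
    and add: "\<And>x y. x \<in> carrier M \<Longrightarrow> y \<in> carrier M \<Longrightarrow> f x \<oplus>\<^bsub>M'\<^esub> f y = f (x \<oplus>\<^bsub>M\<^esub> y)"
    and sm: "\<And>a x. a \<in> carrier R \<Longrightarrow> x \<in> carrier M \<Longrightarrow> a \<odot>\<^bsub>M'\<^esub> f x = f (a \<odot>\<^bsub>M\<^esub> x)"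
    using assms(2) by (auto simp: module_hom_def)
  have N: "N \<subseteq> carrier M" using assms(5) by (simp add: submodule_def)
  have zN: "\<zero>\<^bsub>M\<^esub> \<in> N" using assms(5) by (simp add: submodule_def)
  show ?thesis
    unfolding submodule_def
  proof (intro conjI allI impI)
    show "\<zero>\<^bsub>M'\<^esub> \<in> f ` N" using zN assms(3) by (metis imageI)
  qed (use N cl assms(4,5) in \<open>auto simp: add sm subset_iff submodule_def\<close>)
qed

text \<open>Trades spans for a statement about all submodules, which can be pulled back along
  homomorphisms and tested on restrictions.\<close>

lemma module_span_eq_carrier_iff:
  assumes "module R M" "U \<subseteq> carrier M"
  shows "module.span R M U = carrier M \<longleftrightarrow> (\<forall>N. submodule R N M \<and> U \<subseteq> N \<longrightarrow> carrier M \<subseteq> N)"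
proof -
  interpret M: module R M by fact
  have "submodule R (M.span U) M" "U \<subseteq> M.span U" "M.span U \<subseteq> carrier M"
    using M.span_is_submodule M.in_own_span M.span_is_subset2 assms(2) by auto
  moreover have "M.span U \<subseteq> N" if "submodule R N M" "U \<subseteq> N" for N
    using M.span_is_subset that by auto
  ultimately show ?thesis by (metis subset_antisym)
qed

lemma submodule_trans:
  assumes "module R M" "submodule R P M" "submodule R N (M\<lparr>carrier := P\<rparr>)"
  shows "submodule R N M"
  using assms by (auto simp: submodule_def)

lemma submodule_restrict:
  assumes "module R M" "submodule R P M" "submodule R N M" "N \<subseteq> P"
  shows "submodule R N (M\<lparr>carrier := P\<rparr>)"
  using assms module.submodule_is_module[OF assms(1,2)] by (auto simp: submodule_def)

context
  fixes R :: "('r, 'x) ring_scheme" and M :: "('r, 'g, 'm) gmodule" and N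
  assumes M: "module R M" and N: "submodule R N M"
begin

interpretation M: module R M by (rule M)

interpretation N: abelian_subgroup N M
proof (rule abelian_subgroupI3)
  show "abelian_group M" by (rule M.abelian_group_axioms)
  show "additive_subgroup N M"
  proof (rule additive_subgroup.intro, rule subgroup.intro)
    fix x assume "x \<in> N"
    then have "\<ominus>\<^bsub>M\<^esub> x \<in> N" using M.submodule_minus[OF N] by auto
    then show "inv\<^bsub>add_monoid M\<^esub> x \<in> N" by (simp add: a_inv_def)
  qed (use N in \<open>auto simp: submodule_def\<close>)
qed

private lemma coset_add: "k \<in> N \<Longrightarrow> x \<in> carrier M \<Longrightarrow> N +>\<^bsub>M\<^esub> (k \<oplus>\<^bsub>M\<^esub> x) = N +>\<^bsub>M\<^esub> x"
  using M.a_coset_add_assoc[OF N.a_subset, of k x] M.a_coset_join2[OF _ N.a_subgroup, of k] N.a_Hcarr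
  by auto

text \<open>The scalar multiplication and the action of \<open>quot_module\<close> are unions over
  all representatives of a coset. For an additive map preserving \<open>N\<close> all
  representatives yield the same coset, so the union collapses.\<close>

private lemma coset_union:
  assumes "h \<in> carrier M \<rightarrow> carrier M" "\<And>x. x \<in> N \<Longrightarrow> h x \<in> N"
    "\<And>x y. x \<in> carrier M \<Longrightarrow> y \<in> carrier M \<Longrightarrow> h (x \<oplus>\<^bsub>M\<^esub> y) = h x \<oplus>\<^bsub>M\<^esub> h y" "x \<in> carrier M"
  shows "(\<Union>y\<in>N +>\<^bsub>M\<^esub> x. N +>\<^bsub>M\<^esub> h y) = N +>\<^bsub>M\<^esub> h x"
proof -
  have "N +>\<^bsub>M\<^esub> h y = N +>\<^bsub>M\<^esub> h x" if y: "y \<in> N +>\<^bsub>M\<^esub> x" for y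
  proof -
    obtain k where k: "k \<in> N" "y = k \<oplus>\<^bsub>M\<^esub> x" using y by (auto simp: a_r_coset_def')
    then have "h y = h k \<oplus>\<^bsub>M\<^esub> h x" using assms(3,4) N.a_Hcarr by simp
    then show ?thesis using coset_add assms(1,2,4) k by auto
  qed
  moreover have "x \<in> N +>\<^bsub>M\<^esub> x" using N.a_rcos_self assms(4) by auto
  ultimately show ?thesis by blast
qed

lemma quot_module_hom: "(\<lambda>x. N +>\<^bsub>M\<^esub> x) \<in> module_hom R M (quot_module M N)"
proof -
  have "(\<Union>y\<in>N +>\<^bsub>M\<^esub> x. N +>\<^bsub>M\<^esub> (a \<odot>\<^bsub>M\<^esub> y)) = N +>\<^bsub>M\<^esub> (a \<odot>\<^bsub>M\<^esub> x)"
    if "a \<in> carrier R" "x \<in> carrier M" for a x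
    using that N by (intro coset_union) (auto simp: submodule_def M.smult_r_distr)
  then show ?thesis
    by (auto simp: module_hom_def quot_module_def A_RCOSETS_def' N.a_rcos_sum)
qed

lemma quot_module_surj: "(\<lambda>x. N +>\<^bsub>M\<^esub> x) ` carrier M = carrier (quot_module M N)"
  by (auto simp: quot_module_def A_RCOSETS_def')

lemma quot_module_ker: "x \<in> carrier M \<Longrightarrow> N +>\<^bsub>M\<^esub> x = \<zero>\<^bsub>quot_module M N\<^esub> \<longleftrightarrow> x \<in> N"
  using N.a_rcos_self M.a_coset_join2[OF _ N.a_subgroup] by (auto simp: quot_module_def)

lemma quot_module_gact:
  assumes "gact M g \<in> carrier M \<rightarrow> carrier M" "\<And>x. x \<in> N \<Longrightarrow> gact M g x \<in> N"
    "\<And>x y. x \<in> carrier M \<Longrightarrow> y \<in> carrier M \<Longrightarrow> gact M g (x \<oplus>\<^bsub>M\<^esub> y) = gact M g x \<oplus>\<^bsub>M\<^esub> gact M g y"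
    "x \<in> carrier M"
  shows "gact (quot_module M N) g (N +>\<^bsub>M\<^esub> x) = N +>\<^bsub>M\<^esub> gact M g x"
  using coset_union[OF assms] by (simp add: quot_module_def)

lemma quot_module_module: "module R (quot_module M N)"
proof (rule module_surj[OF M quot_module_hom quot_module_surj])
  show "N +>\<^bsub>M\<^esub> \<zero>\<^bsub>M\<^esub> = \<zero>\<^bsub>quot_module M N\<^esub>"
    using quot_module_ker[of "\<zero>\<^bsub>M\<^esub>"] N by (auto simp: submodule_def)
qed

end

lemma gspace_surj:
  assumes "gspace G V" "module Cx W" "gmap G V W f" "f ` carrier V = carrier W"
  shows "gspace G W"
  unfolding gspace_def
proof (intro conjI ballI)
  fix g assume g: "g \<in> G"
  interpret V: module Cx V by (rule gspaceD(1)[OF assms(1)])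
  note gs = gspaceD(2-4)[OF assms(1) g] and m = gmapD[OF assms(3)]
  have m4: "gact W g (f x) = f (gact V g x)" if "x \<in> carrier V" for x using m(4)[OF g that] by simp
  show "gact W g \<in> module_hom Cx W W"
    unfolding module_hom_def assms(4)[symmetric]
    using gs m4 by (auto simp flip: m(2,3))
qed (rule assms)

lemma gspace_quot:
  assumes "gspace G V" "gsubspace G V N"
  shows "gspace G (quot_module V N)" "gmap G V (quot_module V N) (\<lambda>x. N +>\<^bsub>V\<^esub> x)"
proof -
  have m: "module Cx V" "submodule Cx N V" using assms by (auto simp: gspace_def gsubspace_def)
  have "gact (quot_module V N) g (N +>\<^bsub>V\<^esub> x) = N +>\<^bsub>V\<^esub> gact V g x" if "g \<in> G" "x \<in> carrier V" for g x
    using assms gspaceD(2,3)[OF assms(1)] that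
    by (intro quot_module_gact[OF m]) (auto simp: gsubspace_def)
  then show *: "gmap G V (quot_module V N) (\<lambda>x. N +>\<^bsub>V\<^esub> x)"
    using quot_module_hom[OF m] by (auto simp: gmap_def)
  show "gspace G (quot_module V N)"
    using gspace_surj[OF assms(1) quot_module_module[OF m] * quot_module_surj[OF m]] .
qed

lemma gmap_restrict: "gmap G V W f \<Longrightarrow> N \<subseteq> carrier V \<Longrightarrow> f ` N \<subseteq> N' \<Longrightarrow>
    gmap G (V\<lparr>carrier := N\<rparr>) (W\<lparr>carrier := N'\<rparr>) f"
  by (auto simp: gmap_def module_hom_def subset_iff)

lemma hom_fin_sub:
  assumes "semisimple n G V" "gsubspace G V N" "\<rho> \<in> Irr n G" "hom_fin G \<rho> V"
  shows "semisimple n G (V\<lparr>carrier := N\<rparr>)" "hom_fin G \<rho> (V\<lparr>carrier := N\<rparr>)"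
proof -
  have gN: "gspace G (V\<lparr>carrier := N\<rparr>)" using gspace_sub assms by (auto simp: semisimple_def)
  obtain \<pi> where \<pi>: "gmap G V (V\<lparr>carrier := N\<rparr>) \<pi>" "\<forall>x\<in>N. \<pi> x = x"
    "\<pi> ` carrier V = carrier (V\<lparr>carrier := N\<rparr>)"
    using semisimple_projection[OF assms(1,2)] by blast
  show "semisimple n G (V\<lparr>carrier := N\<rparr>)" using semisimple_surj[OF assms(1) gN \<pi>(1,3)] .
  show "hom_fin G \<rho> (V\<lparr>carrier := N\<rparr>)" using Hom_G_exact(1)[OF assms(1) gN \<pi>(1,3) assms(3,4)] .
qed

text \<open>The projection of \<open>V\<close> onto \<open>X\<close> restricts to a surjection from
  \<open>Y\<close> onto \<open>X\<close>, and multiplicities do not grow under surjections.\<close>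

lemma hom_dim_mono:
  assumes "semisimple n G V" "\<rho> \<in> Irr n G" "hom_fin G \<rho> V" "gsubspace G V X" "gsubspace G V Y" "X \<subseteq> Y"
  shows "hom_dim G \<rho> (V\<lparr>carrier := X\<rparr>) \<le> hom_dim G \<rho> (V\<lparr>carrier := Y\<rparr>)"
proof -
  have gV: "gspace G V" using assms by (simp add: semisimple_def)
  have Yc: "Y \<subseteq> carrier V" using assms(5) by (simp add: gsubspace_def submodule_def)
  obtain q where q: "gmap G V (V\<lparr>carrier := X\<rparr>) q" "\<forall>x\<in>X. q x = x"
    "q ` carrier V = carrier (V\<lparr>carrier := X\<rparr>)"
    using semisimple_projection[OF assms(1,4)] by blast
  have "gmap G (V\<lparr>carrier := Y\<rparr>) (V\<lparr>carrier := X\<rparr>) q"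
    using gmap_restrict[OF q(1) Yc, of X] q(3) Yc by auto
  moreover have "q ` Y = X"
  proof
    show "q ` Y \<subseteq> X" using image_mono[OF Yc, of q] q(3) by simp
    show "X \<subseteq> q ` Y" using q(2) assms(6) by (metis image_eqI subsetD subsetI)
  qed
  ultimately show ?thesis
    using Hom_G_exact(2)[OF hom_fin_sub(1)[OF assms(1,5,2,3)] gspace_sub[OF gV assms(4)] _ _ assms(2)
        hom_fin_sub(2)[OF assms(1,5,2,3)], of q] by simp
qed

text \<open>Both \<open>X + Y\<close> and \<open>Y\<close> surject onto \<open>(X + Y)/X\<close>, with kernels \<open>X\<close> and \<open>X \<inter> Y\<close>.\<close>

lemma hom_dim_modular:
  assumes "semisimple n G V" "\<rho> \<in> Irr n G" "hom_fin G \<rho> V" "gsubspace G V X" "gsubspace G V Y"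
  shows "hom_dim G \<rho> (V\<lparr>carrier := module.submodule_sum V X Y\<rparr>) + hom_dim G \<rho> (V\<lparr>carrier := X \<inter> Y\<rparr>)
    = hom_dim G \<rho> (V\<lparr>carrier := X\<rparr>) + hom_dim G \<rho> (V\<lparr>carrier := Y\<rparr>)"
proof -
  have gV: "gspace G V" using assms by (simp add: semisimple_def)
  interpret V: module Cx V by (rule gspaceD(1)[OF gV])
  note sub = hom_fin_sub[OF assms(1) _ assms(2,3)]
  let ?S = "V.submodule_sum X Y"
  let ?VS = "V\<lparr>carrier := ?S\<rparr>"
  have X': "submodule Cx X V" and Y': "submodule Cx Y V" using assms by (auto simp: gsubspace_def)
  have S: "gsubspace G V ?S" using gsubspace_sum[OF gV assms(4,5)] .
  then have S': "submodule Cx ?S V" by (simp add: gsubspace_def)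
  have XS: "X \<subseteq> ?S" using V.in_sum[OF X' Y'] .
  have YS: "Y \<subseteq> ?S" using V.in_sum[OF Y' X'] V.msum_comm[OF Y' X'] by simp
  have XG: "gsubspace G ?VS X"
    using assms(4) submodule_restrict[OF V.module_axioms S' X' XS] by (auto simp: gsubspace_def)
  have gS: "gspace G ?VS" using gspace_sub[OF gV S] .
  let ?W = "quot_module ?VS X" and ?f = "\<lambda>x. X +>\<^bsub>?VS\<^esub> x"
  note q = gspace_quot[OF gS XG]
  have m: "module Cx ?VS" "submodule Cx X ?VS" using gS XG by (auto simp: gspace_def gsubspace_def)
  note surj = quot_module_surj[OF m] and ker = quot_module_ker[OF m]
  have "{x \<in> carrier ?VS. ?f x = \<zero>\<^bsub>?W\<^esub>} = X" using ker XS by auto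
  then have 1: "hom_dim G \<rho> ?VS = hom_dim G \<rho> (V\<lparr>carrier := X\<rparr>) + hom_dim G \<rho> ?W"
    using Hom_G_exact(2)[OF _ q surj assms(2)] sub[OF S] by simp
  have fY: "gmap G (V\<lparr>carrier := Y\<rparr>) ?W ?f"
    using gmap_restrict[OF q(2), of Y "carrier ?W"] YS surj by auto
  \<comment> \<open>The coset of a sum \<open>x + y\<close> is that of \<open>y\<close>, since
    \<open>x\<close> lies in \<open>X\<close>.\<close>
  have "carrier ?W \<subseteq> ?f ` Y"
  proof
    fix C assume "C \<in> carrier ?W"
    then obtain z where z: "z \<in> ?S" "C = ?f z" unfolding surj[symmetric] by auto
    then obtain x y where xy: "x \<in> X" "y \<in> Y" "z = x \<oplus>\<^bsub>V\<^esub> y" by (auto simp: V.mem_submodule_sum)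
    have W: "module Cx ?W" using q(1) by (simp add: gspace_def)
    interpret W: module Cx ?W by (rule W)
    have car: "x \<in> carrier ?VS" "y \<in> carrier ?VS" using xy XS YS by auto
    have "?f z = ?f x \<oplus>\<^bsub>?W\<^esub> ?f y" using gmapD(2)[OF q(2) car] xy by simp
    also have "\<dots> = ?f y" using ker[OF car(1)] xy(1) gmapD(1)[OF q(2) car(2)] W.l_zero by metis
    finally show "C \<in> ?f ` Y" using z xy by auto
  qed
  then have sY: "?f ` carrier (V\<lparr>carrier := Y\<rparr>) = carrier ?W" using gmapD(1)[OF fY] by auto
  have "{x \<in> carrier (V\<lparr>carrier := Y\<rparr>). ?f x = \<zero>\<^bsub>?W\<^esub>} = X \<inter> Y" using ker YS by auto
  then have 2: "hom_dim G \<rho> (V\<lparr>carrier := Y\<rparr>) = hom_dim G \<rho> (V\<lparr>carrier := X \<inter> Y\<rparr>) + hom_dim G \<rho> ?W"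
    using Hom_G_exact(2)[OF _ q(1) fY sY assms(2)] sub[OF assms(5)] by simp
  show ?thesis using 1 2 by simp
qed

section \<open>Equivariant modules\<close>

lemma as_complex_sel [simp]:
  "carrier (as_complex A M) = carrier M" "zero (as_complex A M) = zero M"
  "add (as_complex A M) = add M" "gact (as_complex A M) = gact M"
  "module.smult (as_complex A M) = (\<lambda>c. module.smult M (struct_map A c))"
  by (simp_all add: as_complex_def restrict_scalars_def)

lemma as_complex_carrier [simp]:
  "as_complex A (M\<lparr>carrier := N\<rparr>) = (as_complex A M)\<lparr>carrier := N\<rparr>"
  by (simp add: as_complex_def restrict_scalars_def)

lemma hilb_eq: "hilb G A M \<rho> = hom_dim G \<rho> (as_complex A M)"
  by (simp add: hilb_def F_comp_def)

lemma isotypic_part_eq: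
  "isotypic_part G A E M = module.span Cx (as_complex A M) (hom_images G E (as_complex A M))"
  by (simp add: isotypic_part_def F_comp_def hom_images_def)

text \<open>The truncations of \<open>v\<close> to its first \<open>k\<close> entries grow by one
  multiple of a unit vector at a time, from zero up to \<open>v\<close>.\<close>

lemma carrier_vec_induct:
  fixes P :: "complex vec set"
  assumes "0\<^sub>v m \<in> P" "\<And>u v. u \<in> P \<Longrightarrow> v \<in> P \<Longrightarrow> u + v \<in> P" "\<And>c v. v \<in> P \<Longrightarrow> c \<cdot>\<^sub>v v \<in> P"
    "\<And>j. j < m \<Longrightarrow> unit_vec m j \<in> P" "v \<in> carrier_vec m"
  shows "v \<in> P"
proof -
  have "vec m (\<lambda>i. if i < k then v $ i else 0) \<in> P" if "k \<le> m" for k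
    using that
  proof (induction k)
    case 0
    have "vec m (\<lambda>i. if i < 0 then v $ i else 0) = 0\<^sub>v m" by auto
    then show ?case using assms(1) by simp
  next
    case (Suc k)
    have "vec m (\<lambda>i. if i < Suc k then v $ i else 0)
        = vec m (\<lambda>i. if i < k then v $ i else 0) + v $ k \<cdot>\<^sub>v unit_vec m k"
      using Suc.prems by (intro eq_vecI) (auto simp: less_Suc_eq)
    then show ?case using Suc assms(2-4) by simp
  qed
  from this[of m] have "vec m (\<lambda>i. if i < m then v $ i else 0) \<in> P" by simp
  moreover have "vec m (\<lambda>i. if i < m then v $ i else 0) = v" using assms(5) by (intro eq_vecI) auto
  ultimately show ?thesis by simp
qed

text \<open>A linear map is determined by its values at the unit vectors, and the maps themselves
  are combinations of a finite spanning set. The values of the spanning maps at the unit vectors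
  therefore generate all images; this is the source of finite generation of submodules.\<close>

lemma hom_images_finite:
  assumes "gspace G V" "\<And>\<rho>. \<rho> \<in> E \<Longrightarrow> hom_fin G \<rho> V" "finite E" "E \<subseteq> Irr n G"
  obtains S where "finite S" "S \<subseteq> hom_images G E V"
    "\<And>N. submodule Cx N V \<Longrightarrow> S \<subseteq> N \<Longrightarrow> hom_images G E V \<subseteq> N"
proof -
  interpret V: module Cx V by (rule gspaceD(1)[OF assms(1)])
  have H: "vectorspace Cx (Hom_G G Cx \<rho> V)" if "\<rho> \<in> E" for \<rho>
    using module_Hom_G[OF assms(1)] that assms(4) by (auto simp: vectorspace_Cx_iff)
  have "\<forall>\<rho>\<in>E. \<exists>B. finite B \<and> B \<subseteq> homs G \<rho> V \<and> module.span Cx (Hom_G G Cx \<rho> V) B = homs G \<rho> V"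
    using assms(2) vectorspace.fin_dim_def[OF H] by blast
  then obtain B where B: "\<And>\<rho>. \<rho> \<in> E \<Longrightarrow> finite (B \<rho>) \<and> B \<rho> \<subseteq> homs G \<rho> V \<and>
      module.span Cx (Hom_G G Cx \<rho> V) (B \<rho>) = homs G \<rho> V"
    by metis
  define S where "S = (\<Union>\<rho>\<in>E. \<Union>\<phi>\<in>B \<rho>. \<phi> ` unit_vec (Vdim \<rho>) ` {..<Vdim \<rho>})"
  show ?thesis
  proof
    show "finite S" using B assms(3) by (auto simp: S_def)
    show "S \<subseteq> hom_images G E V"
    proof
      fix x assume "x \<in> S"
      then obtain \<rho> \<phi> j where x: "\<rho> \<in> E" "\<phi> \<in> B \<rho>" "x = \<phi> (unit_vec (Vdim \<rho>) j)"
        unfolding S_def by blast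
      then have "\<phi> \<in> homs G \<rho> V" using B by blast
      then show "x \<in> hom_images G E V"
        unfolding hom_images_def x(3) using x(1) by (intro UN_I[of \<rho>] UN_I[of \<phi>] imageI) auto
    qed
    fix N assume N: "submodule Cx N V" "S \<subseteq> N"
    have N0: "\<zero>\<^bsub>V\<^esub> \<in> N" "\<And>x y. x \<in> N \<Longrightarrow> y \<in> N \<Longrightarrow> x \<oplus>\<^bsub>V\<^esub> y \<in> N" "\<And>c x. x \<in> N \<Longrightarrow> c \<odot>\<^bsub>V\<^esub> x \<in> N"
      using N by (auto simp: submodule_def)
    have "\<phi> v \<in> N" if \<rho>: "\<rho> \<in> E" and \<phi>: "\<phi> \<in> homs G \<rho> V" and v: "v \<in> carrier_vec (Vdim \<rho>)" for \<rho> \<phi> v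
    proof -
      let ?U = "carrier_vec (Vdim \<rho>) :: complex vec set" and ?H = "Hom_G G Cx \<rho> V"
      have mH: "module Cx ?H" using H[OF \<rho>] by (simp add: vectorspace_Cx_iff)
      \<comment> \<open>The maps with values in \<open>N\<close> form a subspace of the multiplicity
        space. It contains the spanning set \<open>B \<rho>\<close>, hence every map.\<close>
      define T where "T = {\<phi> \<in> homs G \<rho> V. \<forall>v\<in>?U. \<phi> v \<in> N}"
      have "submodule Cx T ?H"
        using mH N0 module.smult_closed[OF mH] abelian_monoid.a_closed[of ?H] abelian_monoid.zero_closed[of ?H]
        unfolding submodule_def T_def
        by (auto simp: abelian_group_def module_def)
      moreover have "B \<rho> \<subseteq> T"
      proof
        fix \<psi> assume \<psi>: "\<psi> \<in> B \<rho>"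
        then have h: "\<psi> \<in> homs G \<rho> V" using B \<rho> by auto
        have "v \<in> {u \<in> ?U. \<psi> u \<in> N}" if "v \<in> ?U" for v
        proof (rule carrier_vec_induct[OF _ _ _ _ that])
          show "0\<^sub>v (Vdim \<rho>) \<in> {u \<in> ?U. \<psi> u \<in> N}"
            using N0 homs_zero[OF V.module_axioms h] by auto
          show "unit_vec (Vdim \<rho>) j \<in> {u \<in> ?U. \<psi> u \<in> N}" if "j < Vdim \<rho>" for j
          proof -
            have "\<psi> (unit_vec (Vdim \<rho>) j) \<in> S" unfolding S_def using \<psi> \<rho> that by blast
            then show ?thesis using N(2) by auto
          qed
        qed (use N0 homsD(2,3)[OF h] in auto)
        then show "\<psi> \<in> T" using h by (auto simp: T_def)
      qed
      ultimately have "homs G \<rho> V \<subseteq> T"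
        using module.span_is_subset[OF mH] B \<rho> by metis
      then show ?thesis using \<phi> v by (auto simp: T_def)
    qed
    then show "hom_images G E V \<subseteq> N" by (auto simp: hom_images_def)
  qed
qed

section \<open>Modules over the coordinate ring with a compatible group action\<close>

locale equivariant =
  fixes n :: nat and G :: "complex mat set" and A :: "(complex, complex mat, 'a) gmodule"
  assumes group: "algebraic_group n G" and scheme: "affine_G_scheme n G A"
begin

lemma G_closed: "g \<in> G \<Longrightarrow> k \<in> G \<Longrightarrow> g * k \<in> G" and G_one: "1\<^sub>m n \<in> G"
proof -
  have s: "subgroup G (GL n)" using group by (simp add: algebraic_group_def)
  have "mult (GL n) = (*)" "one (GL n) = 1\<^sub>m n" by (auto simp: GL_def units_of_def ring_mat_def)
  then show "g \<in> G \<Longrightarrow> k \<in> G \<Longrightarrow> g * k \<in> G" "1\<^sub>m n \<in> G"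
    using subgroup.m_closed[OF s] subgroup.one_closed[OF s] by auto
qed

sublocale A: algebra Cx A
  using scheme by (simp add: affine_G_scheme_def fg_algebra_def)

lemma struct_map_closed [simp]: "struct_map A c \<in> carrier A"
  by (simp add: struct_map_def)

lemma gact_A_closed: "g \<in> G \<Longrightarrow> a \<in> carrier A \<Longrightarrow> gact A g a \<in> carrier A"
  using scheme by (auto simp: affine_G_scheme_def Ring.ring_hom_def)

lemma module_as_complex:
  assumes "module A M"
  shows "module Cx (as_complex A M)"
proof -
  interpret M: module A M by fact
  have 1: "struct_map A (c + d) = struct_map A c \<oplus>\<^bsub>A\<^esub> struct_map A d" for c d
    using A.smult_l_distr[of c d "\<one>\<^bsub>A\<^esub>"] by (simp add: struct_map_def)
  have 2: "struct_map A (c * d) = struct_map A c \<otimes>\<^bsub>A\<^esub> struct_map A d" for c d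
    using A.smult_assoc1[of c d "\<one>\<^bsub>A\<^esub>"] A.smult_assoc2[of c "\<one>\<^bsub>A\<^esub>" "d \<odot>\<^bsub>A\<^esub> \<one>\<^bsub>A\<^esub>"]
    by (simp add: struct_map_def)
  have 3: "struct_map A 1 = \<one>\<^bsub>A\<^esub>"
    using A.smult_one[of "\<one>\<^bsub>A\<^esub>"] by (simp add: struct_map_def)
  have neg: "\<forall>v\<in>carrier M. \<exists>w\<in>carrier M. v \<oplus>\<^bsub>M\<^esub> w = \<zero>\<^bsub>M\<^esub>"
    using M.r_neg M.add.inv_closed by blast
  show ?thesis
    by (rule module_criteria)
      (use neg in \<open>auto simp: cring_Cx 1 2 3 M.a_ac M.smult_l_distr M.smult_r_distr M.smult_assoc1\<close>)
qed

lemma submodule_as_complex: "module A M \<Longrightarrow> submodule A N M \<Longrightarrow> submodule Cx N (as_complex A M)"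
  using module_as_complex by (auto simp: submodule_def)

definition fin_gen :: "('a, complex mat, 'm) gmodule \<Rightarrow> bool" where
  "fin_gen M \<longleftrightarrow> (\<exists>S. finite S \<and> S \<subseteq> carrier M \<and> (\<forall>N. submodule A N M \<and> S \<subseteq> N \<longrightarrow> carrier M \<subseteq> N))"

text \<open>The decomposition into isotypic parts is \<open>semisimple\<close> in other words:
  \<open>isotypic_part\<close> is the complex span of the images of irreducibles. This splits the
  notion into an \<open>A\<close>-linear half and a half about the underlying complex space.\<close>

lemma OG_module_iff:
  "OG_module n G A M \<longleftrightarrow> module A M \<and> fin_gen M \<and> admissible n G (as_complex A M) \<and>
     (\<forall>g\<in>G. \<forall>a\<in>carrier A. \<forall>x\<in>carrier M. gact M g (a \<odot>\<^bsub>M\<^esub> x) = gact A g a \<odot>\<^bsub>M\<^esub> gact M g x)"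
proof -
  have 1: "(\<exists>S. finite S \<and> S \<subseteq> carrier M \<and> module.span A M S = carrier M) \<longleftrightarrow> fin_gen M"
    if "module A M"
    unfolding fin_gen_def
    by (intro ex_cong1 conj_cong refl) (rule module_span_eq_carrier_iff[OF that])
  have 2: "semisimple n G (as_complex A M) \<longleftrightarrow> isotypic_part G A (Irr n G) M = carrier M"
    if "rational_gmodule n G (as_complex A M)"
    using that module_span_eq_carrier_iff[of Cx "as_complex A M", OF _ hom_images_carrier]
    by (simp add: semisimple_def isotypic_part_eq rational_gmodule_def gspace_def)
  show ?thesis
    unfolding OG_module_def admissible_def F_comp_def
    by (cases "module A M"; cases "rational_gmodule n G (as_complex A M)")
      (simp_all only: 1 2 conj_ac simp_thms)
qed

lemma OG_moduleD:
  assumes "OG_module n G A M"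
  shows "module A M" "admissible n G (as_complex A M)" "semisimple n G (as_complex A M)"
    "gspace G (as_complex A M)"
    "g \<in> G \<Longrightarrow> a \<in> carrier A \<Longrightarrow> x \<in> carrier M \<Longrightarrow> gact M g (a \<odot>\<^bsub>M\<^esub> x) = gact A g a \<odot>\<^bsub>M\<^esub> gact M g x"
  using assms by (auto simp: OG_module_iff admissible_def semisimple_def)

text \<open>An \<open>A\<close>-submodule is also a complex subspace, so it contains the isotypic
  part as soon as it contains the images of the irreducibles that span it.\<close>

lemma generated_in_iff:
  assumes "module A M"
  shows "generated_in G A E M \<longleftrightarrow>
    (\<forall>N. submodule A N M \<and> hom_images G E (as_complex A M) \<subseteq> N \<longrightarrow> carrier M \<subseteq> N)"
proof -
  have C: "module Cx (as_complex A M)" using module_as_complex assms .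
  have U: "hom_images G E (as_complex A M) \<subseteq> carrier (as_complex A M)" by (rule hom_images_carrier)
  have i: "isotypic_part G A E M \<subseteq> carrier M"
    using module.span_is_subset2[OF C U] by (simp add: isotypic_part_eq)
  have "isotypic_part G A E M \<subseteq> N \<longleftrightarrow> hom_images G E (as_complex A M) \<subseteq> N" if "submodule A N M" for N
    using module.span_is_subset[OF C _ submodule_as_complex[OF assms that]] module.in_own_span[OF C U]
    unfolding isotypic_part_eq by blast
  then show ?thesis
    unfolding generated_in_def module_span_eq_carrier_iff[OF assms i] by blast
qed

text \<open>Surjectivity is built in, and preservation of zero is demanded explicitly, because the
  target is to be recognised as a module through the map.\<close>

definition og_map :: "('a, complex mat, 'm) gmodule \<Rightarrow> ('a, complex mat, 'k) gmodule \<Rightarrow> ('m \<Rightarrow> 'k) \<Rightarrow> bool" where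
  "og_map M M' f \<longleftrightarrow> f \<in> module_hom A M M' \<and> f ` carrier M = carrier M' \<and> f \<zero>\<^bsub>M\<^esub> = \<zero>\<^bsub>M'\<^esub> \<and>
     (\<forall>g\<in>G. \<forall>x\<in>carrier M. f (gact M g x) = gact M' g (f x))"

lemma og_map_gmap: "og_map M M' f \<Longrightarrow> gmap G (as_complex A M) (as_complex A M') f"
  by (auto simp: og_map_def gmap_def module_hom_def)

lemma og_map_module: "module A M \<Longrightarrow> og_map M M' f \<Longrightarrow> module A M'"
  using module_surj[of A M f M'] by (auto simp: og_map_def)

lemma og_map_gspace:
  assumes "module A M" "gspace G (as_complex A M)" "og_map M M' f"
  shows "gspace G (as_complex A M')"
  using gspace_surj[OF assms(2) module_as_complex[OF og_map_module[OF assms(1,3)]] og_map_gmap[OF assms(3)]] assms(3)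
  by (simp add: og_map_def)

lemma OG_module_surj:
  assumes "OG_module n G A M" "og_map M M' f"
  shows "OG_module n G A M'"
proof -
  note M = OG_moduleD[OF assms(1)]
  note f = og_map_gmap[OF assms(2)]
  have surj: "f ` carrier M = carrier M'" and z: "f \<zero>\<^bsub>M\<^esub> = \<zero>\<^bsub>M'\<^esub>" and fh: "f \<in> module_hom A M M'"
    and fg: "\<And>g x. g \<in> G \<Longrightarrow> x \<in> carrier M \<Longrightarrow> gact M' g (f x) = f (gact M g x)"
    using assms(2) by (auto simp: og_map_def)
  have fs: "\<And>a x. a \<in> carrier A \<Longrightarrow> x \<in> carrier M \<Longrightarrow> a \<odot>\<^bsub>M'\<^esub> f x = f (a \<odot>\<^bsub>M\<^esub> x)"
    using fh by (auto simp: module_hom_def)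
  have gc: "\<And>g x. g \<in> G \<Longrightarrow> x \<in> carrier M \<Longrightarrow> gact M g x \<in> carrier M" using gspaceD(2)[OF M(4)] by simp
  obtain S where S: "finite S" "S \<subseteq> carrier M" "\<And>N. submodule A N M \<Longrightarrow> S \<subseteq> N \<Longrightarrow> carrier M \<subseteq> N"
    using OG_module_iff[THEN iffD1, OF assms(1)] fin_gen_def[of M] by metis
  have "carrier M' \<subseteq> N" if N: "submodule A N M'" "f ` S \<subseteq> N" for N
  proof -
    have "S \<subseteq> {x \<in> carrier M. f x \<in> N}" using S N by auto
    then have "carrier M \<subseteq> {x \<in> carrier M. f x \<in> N}"
      using S(3)[OF submodule_vimage[OF M(1) fh N(1) z]] by blast
    then show ?thesis unfolding surj[symmetric] by auto
  qed
  moreover have "f ` S \<subseteq> carrier M'" using surj S(2) by blast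
  ultimately have 1: "fin_gen M'"
    unfolding fin_gen_def using S(1) by (intro exI[of _ "f ` S"]) auto
  have 2: "admissible n G (as_complex A M')"
    using admissible_surj[OF M(2) og_map_gspace[OF M(1,4) assms(2)] f] surj G_closed G_one by simp
  have 3: "gact M' g (a \<odot>\<^bsub>M'\<^esub> y) = gact A g a \<odot>\<^bsub>M'\<^esub> gact M' g y"
    if gay: "g \<in> G" "a \<in> carrier A" "y \<in> carrier M'" for g a y
  proof -
    obtain x where x: "x \<in> carrier M" "y = f x" using gay(3) surj by auto
    have "a \<odot>\<^bsub>M\<^esub> x \<in> carrier M" using module.smult_closed[OF M(1) gay(2) x(1)] .
    then show ?thesis
      using x gay M(5)[OF gay(1,2) x(1)] by (simp add: fs fg gc gact_A_closed)
  qed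
  show ?thesis
    unfolding OG_module_iff using og_map_module[OF M(1) assms(2)] 1 2 3 by blast
qed

lemma generated_in_surj:
  assumes "OG_module n G A M" "og_map M M' f" "E \<subseteq> Irr n G" "generated_in G A E M"
  shows "generated_in G A E M'"
proof -
  note M = OG_moduleD[OF assms(1)]
  have surj: "f ` carrier M = carrier M'" and z: "f \<zero>\<^bsub>M\<^esub> = \<zero>\<^bsub>M'\<^esub>" and fh: "f \<in> module_hom A M M'"
    using assms(2) by (auto simp: og_map_def)
  have "carrier M' \<subseteq> N" if N: "submodule A N M'" "hom_images G E (as_complex A M') \<subseteq> N" for N
  proof -
    have "hom_images G E (as_complex A M) \<subseteq> {x \<in> carrier M. f x \<in> N}"
      using hom_images_map[OF og_map_gmap[OF assms(2)] assms(3)] N(2)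
        hom_images_carrier[of G E "as_complex A M"] by auto
    then have "carrier M \<subseteq> {x \<in> carrier M. f x \<in> N}"
      using assms(4) submodule_vimage[OF M(1) fh N(1) z] unfolding generated_in_iff[OF M(1)] by blast
    then show ?thesis unfolding surj[symmetric] by auto
  qed
  then show ?thesis using generated_in_iff[OF og_map_module[OF M(1) assms(2)]] by blast
qed

lemma hom_images_mono: "N \<subseteq> carrier V \<Longrightarrow> hom_images G E (V\<lparr>carrier := N\<rparr>) \<subseteq> hom_images G E V"
proof -
  assume "N \<subseteq> carrier V"
  then have "homs G \<rho> (V\<lparr>carrier := N\<rparr>) \<subseteq> homs G \<rho> V" for \<rho>
    by (auto simp: homs_iff PiE_iff subset_iff)
  then show ?thesis unfolding hom_images_def by blast
qed

text \<open>A submodule \<open>N\<close> with all \<open>E\<close>-images contains the kernel, which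
  is generated by its own \<open>E\<close>-images. It also maps onto \<open>M'\<close>, because maps
  from irreducibles into \<open>M'\<close> lift to \<open>M\<close>. So every element of
  \<open>M\<close> differs from one of \<open>N\<close> by an element of the kernel.\<close>

lemma generated_in_extension:
  assumes "module A M" "semisimple n G (as_complex A M)" "og_map M M' f" "E \<subseteq> Irr n G"
    and K: "submodule A {x \<in> carrier M. f x = \<zero>\<^bsub>M'\<^esub>} M"
    and "generated_in G A E (M\<lparr>carrier := {x \<in> carrier M. f x = \<zero>\<^bsub>M'\<^esub>}\<rparr>)" "generated_in G A E M'"
  shows "generated_in G A E M"
proof -
  interpret M: module A M by fact
  let ?K = "{x \<in> carrier M. f x = \<zero>\<^bsub>M'\<^esub>}"
  have surj: "f ` carrier M = carrier M'" and z: "f \<zero>\<^bsub>M\<^esub> = \<zero>\<^bsub>M'\<^esub>" and fh: "f \<in> module_hom A M M'"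
    using assms(3) by (auto simp: og_map_def)
  have M': "module A M'" using og_map_module[OF assms(1,3)] .
  have gM: "gspace G (as_complex A M)" using assms(2) by (simp add: semisimple_def)
  have gM': "gspace G (as_complex A M')" using og_map_gspace[OF assms(1) gM assms(3)] .
  interpret f: mod_hom A M M' f
    using M' fh assms(1) by (simp add: mod_hom_def mod_hom_axioms_def)
  have "carrier M \<subseteq> N" if N: "submodule A N M" "hom_images G E (as_complex A M) \<subseteq> N" for N
  proof
    have Nc: "N \<subseteq> carrier M" using N by (simp add: submodule_def)
    have "submodule A (N \<inter> ?K) (M\<lparr>carrier := ?K\<rparr>)"
      using submodule_restrict[OF assms(1) K M.submodule_inter[OF N(1) K]] by blast
    moreover have "hom_images G E (as_complex A (M\<lparr>carrier := ?K\<rparr>)) \<subseteq> N \<inter> ?K"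
      using hom_images_mono[of ?K "as_complex A M" E] N(2)
        hom_images_carrier[of G E "as_complex A (M\<lparr>carrier := ?K\<rparr>)"] by auto
    ultimately have KN: "?K \<subseteq> N"
      using assms(6) unfolding generated_in_iff[OF M.submodule_is_module[OF K]] by auto
    \<comment> \<open>The section is equivariant and linear over the complex numbers, in general not
      over \<open>A\<close>; this is what lifting maps from irreducibles requires.\<close>
    obtain s where s: "gmap G (as_complex A M') (as_complex A M) s" "\<And>y. y \<in> carrier M' \<Longrightarrow> f (s y) = y"
      using semisimple_section[OF assms(2) gM' og_map_gmap[OF assms(3)]] surj by auto
    have "hom_images G E (as_complex A M') \<subseteq> f ` N"
    proof
      fix y assume y: "y \<in> hom_images G E (as_complex A M')"
      then have "s y \<in> N" using hom_images_map[OF s(1) assms(4)] N(2) by blast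
      moreover have "y \<in> carrier M'" using y hom_images_carrier[of G E "as_complex A M'"] by auto
      ultimately show "y \<in> f ` N" using s(2) by (metis imageI)
    qed
    then have fN: "carrier M' \<subseteq> f ` N"
      using assms(7) submodule_image[OF assms(1) fh z M' N(1)] unfolding generated_in_iff[OF M'] by blast
    fix x assume x: "x \<in> carrier M"
    then obtain y where y: "y \<in> N" "f x = f y" using fN surj by (metis imageE image_eqI subsetD)
    then have yc: "y \<in> carrier M" using Nc by auto
    have "f (x \<ominus>\<^bsub>M\<^esub> y) = \<zero>\<^bsub>M'\<^esub>" using x yc y f.N.diff_eq_zero f.f_im by (metis f.f_minus)
    then have "x \<ominus>\<^bsub>M\<^esub> y \<in> N" using KN x yc by auto
    then have "(x \<ominus>\<^bsub>M\<^esub> y) \<oplus>\<^bsub>M\<^esub> y \<in> N" using y N(1) by (auto simp: submodule_def)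
    then show "x \<in> N" using x yc by (simp add: a_minus_def M.a_assoc M.l_neg)
  qed
  then show ?thesis using generated_in_iff[OF assms(1)] by blast
qed

text \<open>Finite generation is left out, so that intersections and preimages qualify at once;
  \<open>OG_submoduleI\<close> recovers it for submodules generated in finitely many
  irreducibles.\<close>

definition og_stable :: "('a, complex mat, 'm) gmodule \<Rightarrow> 'm set \<Rightarrow> bool" where
  "og_stable M N \<longleftrightarrow> submodule A N M \<and> (\<forall>g\<in>G. \<forall>x\<in>N. gact M g x \<in> N)"

lemma og_stable_gsubspace: "module A M \<Longrightarrow> og_stable M N \<Longrightarrow> gsubspace G (as_complex A M) N"
  using submodule_as_complex by (auto simp: og_stable_def gsubspace_def)

lemma OG_submodule_stable: "OG_submodule n G A N M \<Longrightarrow> og_stable M N"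
  using gspaceD(2)[OF OG_moduleD(4)] by (fastforce simp: OG_submodule_def og_stable_def)

text \<open>Finite generation comes from \<open>hom_images_finite\<close>: \<open>E\<close> is
  finite and the multiplicity spaces are finite-dimensional, so a finite set of values generates all
  \<open>E\<close>-images and with them \<open>N\<close>.\<close>

lemma OG_submoduleI:
  assumes "OG_module n G A M" "og_stable M N" "finite E" "E \<subseteq> Irr n G" "generated_in G A E (M\<lparr>carrier := N\<rparr>)"
  shows "OG_submodule n G A N M"
proof -
  note M = OG_moduleD[OF assms(1)]
  interpret M: module A M by (rule M)
  have N: "submodule A N M" using assms(2) by (simp add: og_stable_def)
  then have Nc: "N \<subseteq> carrier M" by (simp add: submodule_def)
  let ?N = "M\<lparr>carrier := N\<rparr>"
  have mN: "module A ?N" using M.submodule_is_module[OF N] .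
  have adm: "admissible n G (as_complex A ?N)"
    using admissible_sub[OF M(2) og_stable_gsubspace[OF M(1) assms(2)]] G_closed G_one by simp
  then have gN: "gspace G (as_complex A ?N)" by (auto simp: admissible_def semisimple_def)
  obtain S where S: "finite S" "S \<subseteq> hom_images G E (as_complex A ?N)"
    "\<And>P. submodule Cx P (as_complex A ?N) \<Longrightarrow> S \<subseteq> P \<Longrightarrow> hom_images G E (as_complex A ?N) \<subseteq> P"
    using hom_images_finite[OF gN _ assms(3,4)] adm assms(4) unfolding admissible_def by blast
  have "S \<subseteq> carrier ?N" using S(2) hom_images_carrier[of G E "as_complex A ?N"] by auto
  moreover have "\<forall>P. submodule A P ?N \<and> S \<subseteq> P \<longrightarrow> carrier ?N \<subseteq> P"
    using S(3) submodule_as_complex[OF mN] assms(5) unfolding generated_in_iff[OF mN] by blast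
  ultimately have "fin_gen ?N" unfolding fin_gen_def using S(1) by blast
  then have "OG_module n G A ?N"
    unfolding OG_module_iff using mN adm Nc M(5) by (auto simp: subset_iff)
  then show ?thesis using N by (simp add: OG_submodule_def)
qed

lemma og_map_quot:
  assumes "OG_module n G A M" "og_stable M N"
  shows "og_map M (quot_module M N) (\<lambda>x. N +>\<^bsub>M\<^esub> x)"
    "x \<in> carrier M \<Longrightarrow> N +>\<^bsub>M\<^esub> x = \<zero>\<^bsub>quot_module M N\<^esub> \<longleftrightarrow> x \<in> N"
proof -
  note M = OG_moduleD[OF assms(1)]
  interpret M: module A M by (rule M)
  have N: "submodule A N M" using assms(2) by (simp add: og_stable_def)
  show k: "x \<in> carrier M \<Longrightarrow> N +>\<^bsub>M\<^esub> x = \<zero>\<^bsub>quot_module M N\<^esub> \<longleftrightarrow> x \<in> N" for x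
    using quot_module_ker[OF M(1) N] .
  have "gact (quot_module M N) g (N +>\<^bsub>M\<^esub> x) = N +>\<^bsub>M\<^esub> gact M g x" if "g \<in> G" "x \<in> carrier M" for g x
    using assms(2) gspaceD(2,3)[OF M(4)] that
    by (intro quot_module_gact[OF M(1) N]) (auto simp: og_stable_def)
  then show "og_map M (quot_module M N) (\<lambda>x. N +>\<^bsub>M\<^esub> x)"
    using quot_module_hom[OF M(1) N] quot_module_surj[OF M(1) N] k[of "\<zero>\<^bsub>M\<^esub>"] N
    by (auto simp: og_map_def submodule_def)
qed

end

lemma Hom_G_carrier_update:
  "Hom_G G Cx \<rho> (V\<lparr>carrier := N\<rparr>) = (Hom_G G Cx \<rho> V)\<lparr>carrier := homs G \<rho> (V\<lparr>carrier := N\<rparr>)\<rparr>"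
  by (simp add: Hom_G_def Let_def)

context equivariant
begin

text \<open>The quotient of \<open>Z\<close> by \<open>X\<close> is realised as the image of
  \<open>Z\<close> inside \<open>Q\<close>, so that a single quotient module hosts all intermediate
  \<open>Z\<close> as submodules.\<close>

lemma quot_exact:
  assumes "OG_module n G A M" "og_stable M X" "og_stable M Z" "X \<subseteq> Z"
  defines "\<pi> \<equiv> \<lambda>x. X +>\<^bsub>M\<^esub> x" and "Q \<equiv> quot_module M X"
  shows "og_map (M\<lparr>carrier := Z\<rparr>) (Q\<lparr>carrier := \<pi> ` Z\<rparr>) \<pi>"
    "{x \<in> carrier (M\<lparr>carrier := Z\<rparr>). \<pi> x = \<zero>\<^bsub>Q\<lparr>carrier := \<pi> ` Z\<rparr>\<^esub>} = X"
    "\<rho> \<in> Irr n G \<Longrightarrow> hilb G A (M\<lparr>carrier := Z\<rparr>) \<rho>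
      = hilb G A (M\<lparr>carrier := X\<rparr>) \<rho> + hilb G A (Q\<lparr>carrier := \<pi> ` Z\<rparr>) \<rho>"
proof -
  note M = OG_moduleD[OF assms(1)]
  interpret M: module A M by (rule M)
  have Z: "submodule A Z M" using assms(3) by (simp add: og_stable_def)
  then have Zc: "Z \<subseteq> carrier M" and z: "\<zero>\<^bsub>M\<^esub> \<in> Z" by (auto simp: submodule_def)
  note q = og_map_quot[OF assms(1,2), folded \<pi>_def Q_def]
  show 1: "og_map (M\<lparr>carrier := Z\<rparr>) (Q\<lparr>carrier := \<pi> ` Z\<rparr>) \<pi>"
    using q(1) Zc by (auto simp: og_map_def module_hom_def subset_iff)
  show 2: "{x \<in> carrier (M\<lparr>carrier := Z\<rparr>). \<pi> x = \<zero>\<^bsub>Q\<lparr>carrier := \<pi> ` Z\<rparr>\<^esub>} = X"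
    using q(2) Zc assms(4) by auto
  have adm: "admissible n G (as_complex A (M\<lparr>carrier := Z\<rparr>))"
    using admissible_sub[OF M(2) og_stable_gsubspace[OF M(1) assms(3)]] G_closed G_one by simp
  then have s: "semisimple n G (as_complex A (M\<lparr>carrier := Z\<rparr>))"
    and f: "\<rho> \<in> Irr n G \<Longrightarrow> hom_fin G \<rho> (as_complex A (M\<lparr>carrier := Z\<rparr>))"
    and g: "gspace G (as_complex A (M\<lparr>carrier := Z\<rparr>))"
    by (auto simp: admissible_def semisimple_def)
  have g': "gspace G (as_complex A (Q\<lparr>carrier := \<pi> ` Z\<rparr>))"
    using og_map_gspace[OF M.submodule_is_module[OF Z] g 1] .
  show "hilb G A (M\<lparr>carrier := Z\<rparr>) \<rho> = hilb G A (M\<lparr>carrier := X\<rparr>) \<rho> + hilb G A (Q\<lparr>carrier := \<pi> ` Z\<rparr>) \<rho>"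
    if "\<rho> \<in> Irr n G"
    using Hom_G_exact(2)[OF s g' og_map_gmap[OF 1] _ that f[OF that]] 2 by (simp add: hilb_eq)
qed

text \<open>Intersecting with \<open>N\<close> turns a test submodule of \<open>M\<close> into one
  of \<open>N\<close>, so members of different size can be tested by submodules of the same
  \<open>M\<close>.\<close>

lemma generated_in_sub_iff:
  assumes "module A M" "submodule A N M"
  shows "generated_in G A E (M\<lparr>carrier := N\<rparr>) \<longleftrightarrow>
    (\<forall>P. submodule A P M \<and> hom_images G E (as_complex A (M\<lparr>carrier := N\<rparr>)) \<subseteq> P \<longrightarrow> N \<subseteq> P)"
  (is "_ \<longleftrightarrow> ?R")
proof -
  interpret M: module A M by fact
  have mN: "module A (M\<lparr>carrier := N\<rparr>)" using M.submodule_is_module assms(2) .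
  have U: "hom_images G E (as_complex A (M\<lparr>carrier := N\<rparr>)) \<subseteq> N"
    using hom_images_carrier[of G E "as_complex A (M\<lparr>carrier := N\<rparr>)"] by simp
  show ?thesis
  proof
    assume g: "generated_in G A E (M\<lparr>carrier := N\<rparr>)"
    show ?R
    proof (intro allI impI)
      fix P assume P: "submodule A P M \<and> hom_images G E (as_complex A (M\<lparr>carrier := N\<rparr>)) \<subseteq> P"
      then have "submodule A (P \<inter> N) (M\<lparr>carrier := N\<rparr>)"
        using submodule_restrict[OF assms M.submodule_inter[OF _ assms(2)]] by auto
      then show "N \<subseteq> P" using g U P unfolding generated_in_iff[OF mN] by auto
    qed
  next
    assume ?R
    then show "generated_in G A E (M\<lparr>carrier := N\<rparr>)"
      unfolding generated_in_iff[OF mN] using submodule_trans[OF assms] by auto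
  qed
qed

lemma og_stable_restrict:
  "module A M \<Longrightarrow> og_stable M Y \<Longrightarrow> og_stable (M\<lparr>carrier := Y\<rparr>) X \<longleftrightarrow> og_stable M X \<and> X \<subseteq> Y"
  using submodule_trans[of A M Y X] submodule_restrict[of A M Y X]
  by (auto simp: og_stable_def submodule_def)

section \<open>The lattice of submodules generated in given irreducibles\<close>

definition sub_generated :: "irrep set \<Rightarrow> ('a, complex mat, 'm) gmodule \<Rightarrow> 'm set set" where
  "sub_generated E M = {N. OG_submodule n G A N M \<and> generated_in G A E (M\<lparr>carrier := N\<rparr>)}"

text \<open>An interior operator for \<open>sub_generated\<close>: applied to an intersection it
  gives the meet.\<close>

definition core :: "irrep set \<Rightarrow> ('a, complex mat, 'm) gmodule \<Rightarrow> 'm set \<Rightarrow> 'm set" where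
  "core E M N = module.span A M (hom_images G E (as_complex A (M\<lparr>carrier := N\<rparr>)))"

context
  fixes M :: "('a, complex mat, 'm) gmodule"
  assumes M: "OG_module n G A M"
begin

interpretation M: module A M by (rule OG_moduleD(1)[OF M])

lemma og_stable_sum:
  assumes "og_stable M X" "og_stable M Y"
  shows "og_stable M (M.submodule_sum X Y)"
proof -
  interpret V: module Cx "as_complex A M" using module_as_complex[OF M.module_axioms] .
  have "V.submodule_sum X Y = M.submodule_sum X Y"
    by (simp add: V.submodule_sum_def M.submodule_sum_def)
  then show ?thesis
    using gsubspace_sum[OF OG_moduleD(4)[OF M], of X Y] og_stable_gsubspace[OF M.module_axioms] assms
      M.sum_is_submodule[of X Y]
    by (auto simp: og_stable_def gsubspace_def)
qed

lemma og_stable_inter: "og_stable M X \<Longrightarrow> og_stable M Y \<Longrightarrow> og_stable M (X \<inter> Y)"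
  using M.submodule_inter by (auto simp: og_stable_def)

lemma hilb_modular:
  assumes "og_stable M X" "og_stable M Y" "\<rho> \<in> Irr n G"
  shows "hilb G A (M\<lparr>carrier := M.submodule_sum X Y\<rparr>) \<rho> + hilb G A (M\<lparr>carrier := X \<inter> Y\<rparr>) \<rho>
    = hilb G A (M\<lparr>carrier := X\<rparr>) \<rho> + hilb G A (M\<lparr>carrier := Y\<rparr>) \<rho>"
proof -
  interpret V: module Cx "as_complex A M" using module_as_complex[OF M.module_axioms] .
  have "V.submodule_sum X Y = M.submodule_sum X Y"
    by (simp add: V.submodule_sum_def M.submodule_sum_def)
  then show ?thesis
    using hom_dim_modular[OF OG_moduleD(3)[OF M] assms(3) _ og_stable_gsubspace[OF M.module_axioms assms(1)]
        og_stable_gsubspace[OF M.module_axioms assms(2)]] OG_moduleD(2)[OF M] assms(3)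
    by (simp add: hilb_eq admissible_def)
qed

lemma hilb_mono:
  assumes "og_stable M X" "og_stable M Y" "X \<subseteq> Y" "\<rho> \<in> Irr n G"
  shows "hilb G A (M\<lparr>carrier := X\<rparr>) \<rho> \<le> hilb G A (M\<lparr>carrier := Y\<rparr>) \<rho>"
  using hom_dim_mono[OF OG_moduleD(3)[OF M] assms(4) _ og_stable_gsubspace[OF M.module_axioms assms(1)]
      og_stable_gsubspace[OF M.module_axioms assms(2)] assms(3)] OG_moduleD(2)[OF M] assms(4)
  by (simp add: hilb_eq admissible_def)

end

context
  fixes E and M :: "('a, complex mat, 'm) gmodule"
  assumes M: "OG_module n G A M" and E: "finite E" "E \<subseteq> Irr n G"
begin

interpretation M: module A M by (rule OG_moduleD(1)[OF M])

lemma sub_generated_iff: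
  "N \<in> sub_generated E M \<longleftrightarrow> og_stable M N \<and> generated_in G A E (M\<lparr>carrier := N\<rparr>)"
  using OG_submoduleI[OF M _ E] OG_submodule_stable by (auto simp: sub_generated_def)

lemma sum_in_sub_generated:
  assumes "X \<in> sub_generated E M" "Y \<in> sub_generated E M"
  shows "M.submodule_sum X Y \<in> sub_generated E M"
    "X \<subseteq> M.submodule_sum X Y" "Y \<subseteq> M.submodule_sum X Y"
proof -
  let ?J = "M.submodule_sum X Y"
  have st: "og_stable M X" "og_stable M Y" using assms by (auto simp: sub_generated_iff)
  have sub: "submodule A X M" "submodule A Y M" using st by (auto simp: og_stable_def)
  show XJ: "X \<subseteq> ?J" and YJ: "Y \<subseteq> ?J"
    using M.in_sum[OF sub] M.in_sum[OF sub(2,1)] M.msum_comm[OF sub] by auto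
  have J: "og_stable M ?J" using og_stable_sum[OF M] st .
  then have J': "submodule A ?J M" by (simp add: og_stable_def)
  have "?J \<subseteq> P" if P: "submodule A P M" "hom_images G E (as_complex A (M\<lparr>carrier := ?J\<rparr>)) \<subseteq> P" for P
  proof -
    have "hom_images G E (as_complex A (M\<lparr>carrier := N\<rparr>)) \<subseteq> P" if "N \<subseteq> ?J" for N
      using hom_images_mono[of N "as_complex A (M\<lparr>carrier := ?J\<rparr>)" E] P that by auto
    then have "X \<subseteq> P" "Y \<subseteq> P"
      using assms XJ YJ P(1) generated_in_sub_iff[OF M.module_axioms] sub by (auto simp: sub_generated_iff)
    then show ?thesis using M.sum_is_minimal[OF sub P(1)] by auto
  qed
  then show "?J \<in> sub_generated E M"
    using J generated_in_sub_iff[OF M.module_axioms J'] by (auto simp: sub_generated_iff)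
qed

text \<open>Maps from irreducibles in \<open>E\<close> into \<open>N\<close> already land in the
  core, so the multiplicities in \<open>E\<close> agree and the core is generated by its own
  \<open>E\<close>-images. A generated \<open>Z\<close> inside \<open>N\<close> has its generators
  among those of the core.\<close>

lemma core_props:
  assumes "og_stable M N"
  shows "core E M N \<subseteq> N" "core E M N \<in> sub_generated E M"
    "\<rho> \<in> E \<Longrightarrow> hilb G A (M\<lparr>carrier := core E M N\<rparr>) \<rho> = hilb G A (M\<lparr>carrier := N\<rparr>) \<rho>"
    "Z \<in> sub_generated E M \<Longrightarrow> Z \<subseteq> N \<Longrightarrow> Z \<subseteq> core E M N"
proof -
  let ?V = "as_complex A M"
  let ?K = "core E M N" and ?U = "hom_images G E (as_complex A (M\<lparr>carrier := N\<rparr>))"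
  have gV: "gspace G ?V" using OG_moduleD(4)[OF M] .
  have N: "submodule A N M" using assms by (simp add: og_stable_def)
  then have Nc: "N \<subseteq> carrier M" by (simp add: submodule_def)
  have UN: "?U \<subseteq> N" using hom_images_carrier[of G E "as_complex A (M\<lparr>carrier := N\<rparr>)"] by simp
  have K: "submodule A ?K M" "?U \<subseteq> ?K" and Kmin: "\<And>P. submodule A P M \<Longrightarrow> ?U \<subseteq> P \<Longrightarrow> ?K \<subseteq> P"
    using M.span_is_submodule M.in_own_span M.span_is_subset UN Nc by (auto simp: core_def)
  show KN: "?K \<subseteq> N" using Kmin N UN by blast
  have gU: "gact M g x \<in> ?U" if g: "g \<in> G" and x: "x \<in> ?U" for g x
  proof -
    obtain \<rho> \<phi> v where *: "\<rho> \<in> E" "\<phi> \<in> homs G \<rho> (?V\<lparr>carrier := N\<rparr>)" "v \<in> carrier_vec (Vdim \<rho>)" "x = \<phi> v"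
      using x by (auto simp: hom_images_def)
    then have "gact M g x = \<phi> (Vact \<rho> g *\<^sub>v v)" using homsD(4)[OF *(2) g *(3)] by simp
    moreover have "Vact \<rho> g *\<^sub>v v \<in> carrier_vec (Vdim \<rho>)" using * g E by auto
    ultimately show ?thesis
      unfolding hom_images_def as_complex_carrier using * by (intro UN_I[of \<rho>] UN_I[of \<phi>]) auto
  qed
  \<comment> \<open>Stability of the \<open>A\<close>-span of a stable set: since \<open>g\<close>
    sends \<open>a x\<close> to \<open>(g a)(g x)\<close>, the elements whose translates all stay in
    the span form an \<open>A\<close>-submodule, and it contains the generators.\<close>
  define T where "T = {x \<in> ?K. \<forall>g\<in>G. gact M g x \<in> ?K}"
  have "submodule A T M"
    unfolding submodule_def
  proof (intro conjI allI impI)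
    show "module A M" by (rule M.module_axioms)
    show "T \<subseteq> carrier M" using K(1) by (auto simp: T_def submodule_def)
    show "\<zero>\<^bsub>M\<^esub> \<in> T" using K(1) gspace_zero[OF gV] by (auto simp: T_def submodule_def)
    show "x \<oplus>\<^bsub>M\<^esub> y \<in> T" if "x \<in> T" "y \<in> T" for x y
      using that K(1) gspaceD(3)[OF gV] by (auto simp: T_def submodule_def subset_iff)
    show "a \<odot>\<^bsub>M\<^esub> x \<in> T" if "a \<in> carrier A" "x \<in> T" for a x
      using that K(1) OG_moduleD(5)[OF M] gact_A_closed by (auto simp: T_def submodule_def subset_iff)
  qed
  moreover have "?U \<subseteq> T" using gU K(2) by (auto simp: T_def)
  ultimately have "?K \<subseteq> T" by (rule Kmin)
  then have st: "og_stable M ?K" using K(1) by (auto simp: og_stable_def T_def)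
  have homs: "homs G \<rho> (?V\<lparr>carrier := ?K\<rparr>) = homs G \<rho> (?V\<lparr>carrier := N\<rparr>)" if \<rho>: "\<rho> \<in> E" for \<rho>
  proof
    show "homs G \<rho> (?V\<lparr>carrier := ?K\<rparr>) \<subseteq> homs G \<rho> (?V\<lparr>carrier := N\<rparr>)"
      using KN by (auto simp: homs_iff PiE_iff subset_iff)
    show "homs G \<rho> (?V\<lparr>carrier := N\<rparr>) \<subseteq> homs G \<rho> (?V\<lparr>carrier := ?K\<rparr>)"
    proof
      fix \<phi> assume \<phi>: "\<phi> \<in> homs G \<rho> (?V\<lparr>carrier := N\<rparr>)"
      have "\<phi> v \<in> ?K" if "v \<in> carrier_vec (Vdim \<rho>)" for v
        using K(2) \<rho> \<phi> that unfolding hom_images_def as_complex_carrier by blast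
      then show "\<phi> \<in> homs G \<rho> (?V\<lparr>carrier := ?K\<rparr>)"
        using \<phi> by (auto simp: homs_iff PiE_iff)
    qed
  qed
  then have "Hom_G G Cx \<rho> (?V\<lparr>carrier := ?K\<rparr>) = Hom_G G Cx \<rho> (?V\<lparr>carrier := N\<rparr>)" if "\<rho> \<in> E" for \<rho>
    using that Hom_G_carrier_update by metis
  then show "\<rho> \<in> E \<Longrightarrow> hilb G A (M\<lparr>carrier := ?K\<rparr>) \<rho> = hilb G A (M\<lparr>carrier := N\<rparr>) \<rho>"
    by (simp add: hilb_eq)
  have "hom_images G E (as_complex A (M\<lparr>carrier := ?K\<rparr>)) = ?U"
    using homs by (simp add: hom_images_def)
  then have "generated_in G A E (M\<lparr>carrier := ?K\<rparr>)"
    using Kmin generated_in_sub_iff[OF M.module_axioms K(1)] by simp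
  then show "?K \<in> sub_generated E M" using st by (simp add: sub_generated_iff)
  assume Z: "Z \<in> sub_generated E M" "Z \<subseteq> N"
  have "hom_images G E (as_complex A (M\<lparr>carrier := Z\<rparr>)) \<subseteq> ?U"
    using hom_images_mono[of Z "as_complex A (M\<lparr>carrier := N\<rparr>)" E] Z by simp
  then show "Z \<subseteq> ?K"
    using Z K generated_in_sub_iff[OF M.module_axioms, of Z E] by (auto simp: sub_generated_iff og_stable_def)
qed

end

text \<open>Without non-zero maps from \<open>E\<close> the generating set is reduced to zero.
  Applied to quotients, this makes the rank strictly monotone.\<close>

lemma generated_nonzero:
  assumes "OG_module n G A M" "E \<subseteq> Irr n G" "generated_in G A E M" "\<And>\<rho>. \<rho> \<in> E \<Longrightarrow> hilb G A M \<rho> = 0"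
  shows "carrier M = {\<zero>\<^bsub>M\<^esub>}"
proof -
  note M = OG_moduleD[OF assms(1)]
  interpret M: module A M by (rule M)
  have "homs G \<rho> (as_complex A M) = {\<zero>\<^bsub>Hom_G G Cx \<rho> (as_complex A M)\<^esub>}" if "\<rho> \<in> E" for \<rho>
    using hom_dim_zero_iff[OF M(4), of \<rho> n] assms(2,4) that M(2) by (auto simp: hilb_eq admissible_def)
  then have "hom_images G E (as_complex A M) \<subseteq> {\<zero>\<^bsub>M\<^esub>}"
    by (auto simp: hom_images_def)
  moreover have "submodule A {\<zero>\<^bsub>M\<^esub>} M" using M.module_axioms by (auto simp: submodule_def)
  ultimately have "carrier M \<subseteq> {\<zero>\<^bsub>M\<^esub>}"
    using assms(3) unfolding generated_in_iff[OF M(1)] by blast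
  then show ?thesis by auto
qed

lemma hilb_zero:
  assumes "OG_module n G A M" "carrier M = {\<zero>\<^bsub>M\<^esub>}" "\<rho> \<in> Irr n G"
  shows "hilb G A M \<rho> = 0"
proof -
  note M = OG_moduleD[OF assms(1)]
  interpret H: module Cx "Hom_G G Cx \<rho> (as_complex A M)" using module_Hom_G[OF M(4) assms(3)] .
  have "\<phi> = \<zero>\<^bsub>Hom_G G Cx \<rho> (as_complex A M)\<^esub>" if "\<phi> \<in> homs G \<rho> (as_complex A M)" for \<phi>
    using homsD(1,5)[OF that] assms(2) by (auto simp: fun_eq_iff restrict_def)
  then have "homs G \<rho> (as_complex A M) = {\<zero>\<^bsub>Hom_G G Cx \<rho> (as_complex A M)\<^esub>}"
    using H.zero_closed by blast
  then show ?thesis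
    using hom_dim_zero_iff[OF M(4) assms(3)] M(2) assms(3) by (auto simp: hilb_eq admissible_def)
qed

end

section \<open>The filtration\<close>

locale hn_setup = equivariant n G A
  for n :: nat and G :: "complex mat set" and A :: "(complex, complex mat, 'a) gmodule" +
  fixes F :: "('a, complex mat, 'm) gmodule" and h :: "irrep \<Rightarrow> nat"
    and \<theta> \<kappa> :: "irrep \<Rightarrow> rat" and D :: "irrep set"
  assumes finite_Dneg: "finite (Dneg n G \<theta>)"
    and D: "finite D" "D \<subseteq> Irr n G" "Dneg n G \<theta> \<subseteq> D"
    and F: "OG_module n G A F" "generated_in G A (Dneg n G \<theta>) F"
begin

abbreviation "Dm \<equiv> Dneg n G \<theta>"

abbreviation "L \<equiv> sub_generated Dm F"

definition hf :: "'m set \<Rightarrow> irrep \<Rightarrow> nat" where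
  "hf N \<rho> = hilb G A (F\<lparr>carrier := N\<rparr>) \<rho>"

definition rk :: "'m set \<Rightarrow> nat" where
  "rk N = (\<Sum>\<rho>\<in>Dm. hf N \<rho>)"

definition wt :: "'m set \<Rightarrow> real" where
  "wt N = - (\<Sum>\<rho>\<in>D. kap n G h \<theta> \<kappa> D \<rho> * real (hf N \<rho>))
    - (\<Sum>\<rho>\<in>Dm. chi n G h \<theta> \<kappa> D \<rho> * real (hf N \<rho>))"

lemma Dm_Irr: "Dm \<subseteq> Irr n G"
  using D by blast

lemmas L_iff = sub_generated_iff[OF F(1) finite_Dneg Dm_Irr]

lemma L_stable: "N \<in> L \<Longrightarrow> og_stable F N"
  by (simp add: L_iff)

text \<open>Since \<open>D\<close> contains \<open>Dm\<close>, the sum \<open>S_D\<close> runs over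
  irreducibles with non-negative \<theta>, and so does the first summand of \<open>kap\<close>. This
  sign makes the degree supermodular.\<close>

lemma kap_nonneg: "\<rho> \<in> D - Dm \<Longrightarrow> 0 \<le> kap n G h \<theta> \<kappa> D \<rho>"
proof -
  assume \<rho>: "\<rho> \<in> D - Dm"
  have "\<theta> \<sigma> \<ge> 0" if "\<sigma> \<in> Irr n G" "\<sigma> \<notin> Dm" for \<sigma> using that by (auto simp: Dneg_def)
  moreover from this have "S_D n G h \<theta> D \<ge> 0"
    using D unfolding S_D_def by (intro infsum_nonneg mult_nonneg_nonneg) auto
  ultimately show ?thesis using \<rho> D by (auto simp: kap_def)
qed

lemma carrier_L: "carrier F \<in> L"
proof -
  interpret M: module A F by (rule OG_moduleD(1)[OF F(1)])
  have "submodule A (carrier F) F" using M.module_axioms by (auto simp: submodule_def)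
  then show ?thesis using F by (simp add: sub_generated_def OG_submodule_def)
qed

lemma zero_L: "{\<zero>\<^bsub>F\<^esub>} \<in> L"
proof -
  note M = OG_moduleD[OF F(1)]
  interpret M: module A F by (rule M)
  have z: "submodule A {\<zero>\<^bsub>F\<^esub>} F" using M.module_axioms by (auto simp: submodule_def)
  then have "og_stable F {\<zero>\<^bsub>F\<^esub>}" using gspace_zero[OF M(4)] by (auto simp: og_stable_def)
  moreover have "generated_in G A Dm (F\<lparr>carrier := {\<zero>\<^bsub>F\<^esub>}\<rparr>)"
    unfolding generated_in_sub_iff[OF M(1) z] by (auto simp: submodule_def)
  ultimately show ?thesis by (simp add: L_iff)
qed

text \<open>Everything is expressed through \<open>X\<close> and \<open>Z\<close>: the Hilbert
  function of the image of \<open>Z\<close> is the difference of theirs, and numerator and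
  denominator of the slope are linear in it.\<close>

lemma quot_sub:
  assumes "X \<in> L" "Y \<in> L" "X \<subseteq> Y" "og_stable F Z" "X \<subseteq> Z" "Z \<subseteq> Y"
  defines "Q \<equiv> quot_module (F\<lparr>carrier := Y\<rparr>) X" and "\<pi> \<equiv> \<lambda>x. X +>\<^bsub>F\<lparr>carrier := Y\<rparr>\<^esub> x"
  shows "og_map (F\<lparr>carrier := Z\<rparr>) (Q\<lparr>carrier := \<pi> ` Z\<rparr>) \<pi>"
    "{x \<in> carrier (F\<lparr>carrier := Z\<rparr>). \<pi> x = \<zero>\<^bsub>Q\<lparr>carrier := \<pi> ` Z\<rparr>\<^esub>} = X"
    "slope n G A h \<theta> \<kappa> D (Q\<lparr>carrier := \<pi> ` Z\<rparr>)
      = (wt Z - wt X) / (real (rk Z) - real (rk X)) + kap_h n G h \<theta> \<kappa> D / r_h n G h \<theta>"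
    "\<rho> \<in> Irr n G \<Longrightarrow> hf Z \<rho> = hf X \<rho> + hilb G A (Q\<lparr>carrier := \<pi> ` Z\<rparr>) \<rho>"
proof -
  have mF: "module A F" using OG_moduleD(1)[OF F(1)] .
  have MY: "OG_module n G A (F\<lparr>carrier := Y\<rparr>)"
    using assms(2) by (simp add: sub_generated_def OG_submodule_def)
  have stY: "og_stable F Y" using L_stable assms(2) .
  have X: "og_stable (F\<lparr>carrier := Y\<rparr>) X" and Z: "og_stable (F\<lparr>carrier := Y\<rparr>) Z"
    using og_stable_restrict[OF mF stY] L_stable assms by auto
  note q = quot_exact[OF MY X Z assms(5), folded Q_def \<pi>_def]
  show e: "hf Z \<rho> = hf X \<rho> + hilb G A (Q\<lparr>carrier := \<pi> ` Z\<rparr>) \<rho>" if "\<rho> \<in> Irr n G" for \<rho>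
    using q(3)[OF that] by (simp add: hf_def)
  have Q: "real (hilb G A (Q\<lparr>carrier := \<pi> ` Z\<rparr>) \<rho>) = real (hf Z \<rho>) - real (hf X \<rho>)"
    if "\<rho> \<in> Irr n G" for \<rho>
    using e[OF that] by simp
  have "(\<Sum>\<rho>\<in>I. c \<rho> * real (hilb G A (Q\<lparr>carrier := \<pi> ` Z\<rparr>) \<rho>))
      = (\<Sum>\<rho>\<in>I. c \<rho> * real (hf Z \<rho>)) - (\<Sum>\<rho>\<in>I. c \<rho> * real (hf X \<rho>))"
    if "I \<subseteq> Irr n G" for I and c :: "irrep \<Rightarrow> real"
  proof -
    have "(\<Sum>\<rho>\<in>I. c \<rho> * real (hilb G A (Q\<lparr>carrier := \<pi> ` Z\<rparr>) \<rho>))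
        = (\<Sum>\<rho>\<in>I. c \<rho> * real (hf Z \<rho>) - c \<rho> * real (hf X \<rho>))"
      using that Q by (intro sum.cong) (auto simp: right_diff_distrib)
    then show ?thesis by (simp add: sum_subtractf)
  qed
  from this[OF D(2)] this[OF Dm_Irr] this[OF Dm_Irr, of "\<lambda>_. 1"]
  show "slope n G A h \<theta> \<kappa> D (Q\<lparr>carrier := \<pi> ` Z\<rparr>)
      = (wt Z - wt X) / (real (rk Z) - real (rk X)) + kap_h n G h \<theta> \<kappa> D / r_h n G h \<theta>"
    by (simp add: slope_def wt_def rk_def)
  show "og_map (F\<lparr>carrier := Z\<rparr>) (Q\<lparr>carrier := \<pi> ` Z\<rparr>) \<pi>"
    "{x \<in> carrier (F\<lparr>carrier := Z\<rparr>). \<pi> x = \<zero>\<^bsub>Q\<lparr>carrier := \<pi> ` Z\<rparr>\<^esub>} = X"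
    using q(1,2) by simp_all
qed

lemma L_mono: "X \<in> L \<Longrightarrow> Y \<in> L \<Longrightarrow> X \<subseteq> Y \<Longrightarrow> \<rho> \<in> Irr n G \<Longrightarrow> hf X \<rho> \<le> hf Y \<rho>"
  unfolding hf_def using hilb_mono[OF F(1)] L_stable by blast

lemma quot_full:
  assumes "X \<in> L" "Y \<in> L" "X \<subseteq> Y"
  defines "Q \<equiv> quot_module (F\<lparr>carrier := Y\<rparr>) X" and "\<pi> \<equiv> \<lambda>x. X +>\<^bsub>F\<lparr>carrier := Y\<rparr>\<^esub> x"
  shows "\<pi> ` Y = carrier Q" "Q\<lparr>carrier := \<pi> ` Y\<rparr> = Q" "OG_module n G A Q" "generated_in G A Dm Q"
    "\<And>x. x \<in> Y \<Longrightarrow> \<pi> x = \<zero>\<^bsub>Q\<^esub> \<longleftrightarrow> x \<in> X"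
proof -
  have MY: "OG_module n G A (F\<lparr>carrier := Y\<rparr>)" and gY: "generated_in G A Dm (F\<lparr>carrier := Y\<rparr>)"
    using assms(2) by (auto simp: sub_generated_def OG_submodule_def)
  show 1: "\<pi> ` Y = carrier Q"
    using quot_module_surj[of A "F\<lparr>carrier := Y\<rparr>" X] OG_moduleD(1)[OF MY] L_stable[OF assms(1)]
      og_stable_restrict[OF OG_moduleD(1)[OF F(1)] L_stable[OF assms(2)], of X] assms(3)
    by (auto simp: \<pi>_def Q_def og_stable_def)
  then show 2: "Q\<lparr>carrier := \<pi> ` Y\<rparr> = Q" by simp
  note q = quot_sub[OF assms(1-3) L_stable[OF assms(2)] assms(3) subset_refl, folded Q_def \<pi>_def, unfolded 2]
  show "OG_module n G A Q" using OG_module_surj[OF MY q(1)] .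
  show "generated_in G A Dm Q" using generated_in_surj[OF MY q(1) Dm_Irr gY] .
  show "\<pi> x = \<zero>\<^bsub>Q\<^esub> \<longleftrightarrow> x \<in> X" if "x \<in> Y" for x
    using q(2) that assms(3) by auto
qed

text \<open>Multiplicities in \<open>Dm\<close> grow termwise, so equal ranks force all of them to
  agree. The quotient is then generated in \<open>Dm\<close> without \<open>Dm\<close>-part, hence
  zero.\<close>

lemma rk_strict_mono:
  assumes "X \<in> L" "Y \<in> L" "X \<subset> Y"
  shows "rk X < rk Y"
proof -
  have le: "hf X \<rho> \<le> hf Y \<rho>" if "\<rho> \<in> Dm" for \<rho> using L_mono assms Dm_Irr that by blast
  have "rk X \<noteq> rk Y"
  proof
    assume e: "rk X = rk Y"
    have XY: "X \<subseteq> Y" using assms by auto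
    note q = quot_full[OF assms(1,2) XY]
    let ?Q = "quot_module (F\<lparr>carrier := Y\<rparr>) X"
    have "hf X \<rho> = hf Y \<rho>" if "\<rho> \<in> Dm" for \<rho>
      using sum_mono_inv[of "hf X" Dm "hf Y"] e le finite_Dneg that
      by (metis rk_def)
    then have "hilb G A ?Q \<rho> = 0" if "\<rho> \<in> Dm" for \<rho>
      using quot_sub(4)[OF assms(1,2) XY L_stable[OF assms(2)] XY subset_refl, of \<rho>] that Dm_Irr q(2) by auto
    then have "carrier ?Q = {\<zero>\<^bsub>?Q\<^esub>}" using generated_nonzero[OF q(3) Dm_Irr q(4)] by blast
    then have "X +>\<^bsub>F\<lparr>carrier := Y\<rparr>\<^esub> y = \<zero>\<^bsub>?Q\<^esub>" if "y \<in> Y" for y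
      using that q(1) by (metis imageI singletonD)
    then have "Y \<subseteq> X" using q(5) by (meson subsetI)
    then show False using assms(3) by auto
  qed
  moreover have "rk X \<le> rk Y" unfolding rk_def using le by (rule sum_mono)
  ultimately show ?thesis by simp
qed

lemma slope_lattice:
  "slope_lattice L (module.submodule_sum F) (\<lambda>X Y. core Dm F (X \<inter> Y)) (carrier F) rk wt"
proof
  fix X Y Z :: "'m set"
  note core = core_props[OF F(1) finite_Dneg Dm_Irr]
  note stable_inter = og_stable_inter[OF F(1)]
  assume X: "X \<in> L"
  show "X \<le> carrier F" using L_stable[OF X] by (auto simp: og_stable_def submodule_def)
  assume Y: "Y \<in> L"
  have st: "og_stable F X" "og_stable F Y" using L_stable X Y by auto
  note i = stable_inter[OF st]
  let ?J = "module.submodule_sum F X Y" and ?K = "core Dm F (X \<inter> Y)"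
  show J: "?J \<in> L \<and> X \<le> ?J \<and> Y \<le> ?J"
    using sum_in_sub_generated[OF F(1) finite_Dneg Dm_Irr X Y] by auto
  show K: "?K \<in> L \<and> ?K \<le> X \<and> ?K \<le> Y" using core(1,2)[OF i] by auto
  show "Z \<le> ?K" if "Z \<in> L" "Z \<le> X" "Z \<le> Y" using core(4)[OF i] that by auto
  show "rk X < rk Y" if "X < Y" using rk_strict_mono X Y that by auto
  have eq: "hf ?J \<rho> + hf (X \<inter> Y) \<rho> = hf X \<rho> + hf Y \<rho>" if "\<rho> \<in> Irr n G" for \<rho>
    unfolding hf_def using hilb_modular[OF F(1) st that] .
  have eqK: "hf ?K \<rho> = hf (X \<inter> Y) \<rho>" if "\<rho> \<in> Dm" for \<rho>
    unfolding hf_def using core(3)[OF i that] .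
  have leK: "hf ?K \<rho> \<le> hf (X \<inter> Y) \<rho>" if "\<rho> \<in> Irr n G" for \<rho>
    unfolding hf_def using hilb_mono[OF F(1) _ i core(1)[OF i] that] K L_stable by blast
  have eqD: "hf ?J \<rho> + hf ?K \<rho> = hf X \<rho> + hf Y \<rho>" if "\<rho> \<in> Dm" for \<rho>
    using eq eqK that Dm_Irr by auto
  then show "rk ?J + rk ?K = rk X + rk Y"
    by (simp add: rk_def flip: sum.distrib)
  have chi: "(\<Sum>\<rho>\<in>Dm. chi n G h \<theta> \<kappa> D \<rho> * real (hf X \<rho>)) + (\<Sum>\<rho>\<in>Dm. chi n G h \<theta> \<kappa> D \<rho> * real (hf Y \<rho>))
      = (\<Sum>\<rho>\<in>Dm. chi n G h \<theta> \<kappa> D \<rho> * real (hf ?J \<rho>)) + (\<Sum>\<rho>\<in>Dm. chi n G h \<theta> \<kappa> D \<rho> * real (hf ?K \<rho>))"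
    unfolding sum.distrib[symmetric] distrib_left[symmetric] of_nat_add[symmetric]
    using eqD by (intro sum.cong) auto
  \<comment> \<open>On \<open>Dm\<close> the terms agree. Outside \<open>Dm\<close> the core may
    lose multiplicity against the intersection, which can only lower the left side because
    \<open>kap\<close> is non-negative there; the minus sign in \<open>wt\<close> reverses the
    inequality.\<close>
  have "(\<Sum>\<rho>\<in>D. kap n G h \<theta> \<kappa> D \<rho> * real (hf ?J \<rho>)) + (\<Sum>\<rho>\<in>D. kap n G h \<theta> \<kappa> D \<rho> * real (hf ?K \<rho>))
      \<le> (\<Sum>\<rho>\<in>D. kap n G h \<theta> \<kappa> D \<rho> * real (hf X \<rho>)) + (\<Sum>\<rho>\<in>D. kap n G h \<theta> \<kappa> D \<rho> * real (hf Y \<rho>))"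
    unfolding sum.distrib[symmetric] distrib_left[symmetric] of_nat_add[symmetric]
  proof (rule sum_mono)
    fix \<rho> assume \<rho>: "\<rho> \<in> D"
    show "kap n G h \<theta> \<kappa> D \<rho> * real (hf ?J \<rho> + hf ?K \<rho>) \<le> kap n G h \<theta> \<kappa> D \<rho> * real (hf X \<rho> + hf Y \<rho>)"
    proof (cases "\<rho> \<in> Dm")
      case False
      have "\<rho> \<in> Irr n G" using \<rho> D by auto
      then have "hf ?J \<rho> + hf ?K \<rho> \<le> hf X \<rho> + hf Y \<rho>" using eq leK by (metis add_left_mono)
      then show ?thesis using kap_nonneg[of \<rho>] \<rho> False by (intro mult_left_mono) auto
    qed (use eqD in auto)
  qed
  then show "wt X + wt Y \<le> wt ?J + wt ?K" unfolding wt_def using chi by linarith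
next
  show "carrier F \<in> L" by (rule carrier_L)
  \<comment> \<open>The degree as a function of the multiplicities on \<open>D\<close> alone. These
    are bounded by the ones of \<open>F\<close>, which leaves finitely many possibilities.\<close>
  let ?w = "\<lambda>d. - (\<Sum>\<rho>\<in>D. kap n G h \<theta> \<kappa> D \<rho> * real (d \<rho>)) - (\<Sum>\<rho>\<in>Dm. chi n G h \<theta> \<kappa> D \<rho> * real (d \<rho>))"
  have "wt N \<in> ?w ` (\<Pi>\<^sub>E \<rho>\<in>D. {..hf (carrier F) \<rho>})" if N: "N \<in> L" for N
  proof
    have "(\<Sum>\<rho>\<in>I. c \<rho> * real (restrict (hf N) D \<rho>)) = (\<Sum>\<rho>\<in>I. c \<rho> * real (hf N \<rho>))"
      if "I \<subseteq> D" for I and c :: "irrep \<Rightarrow> real"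
      using that by (intro sum.cong) auto
    then show "wt N = ?w (restrict (hf N) D)" using D(3) by (simp add: wt_def)
    have "N \<subseteq> carrier F" using L_stable[OF N] by (auto simp: og_stable_def submodule_def)
    then have "hf N \<rho> \<le> hf (carrier F) \<rho>" if "\<rho> \<in> D" for \<rho>
      using L_mono[OF N carrier_L] that D by blast
    then show "restrict (hf N) D \<in> (\<Pi>\<^sub>E \<rho>\<in>D. {..hf (carrier F) \<rho>})" by auto
  qed
  then have "wt ` L \<subseteq> ?w ` (\<Pi>\<^sub>E \<rho>\<in>D. {..hf (carrier F) \<rho>})" by blast
  then show "finite (wt ` L)"
    by (rule finite_subset) (intro finite_imageI finite_PiE D(1) finite_atMost)
qed

sublocale HN: slope_lattice L "module.submodule_sum F" "\<lambda>X Y. core Dm F (X \<inter> Y)" "carrier F" rk wt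
  by (rule slope_lattice)

lemma slope_quot:
  assumes "X \<in> L" "Y \<in> L" "X \<subseteq> Y"
  shows "slope n G A h \<theta> \<kappa> D (quot_module (F\<lparr>carrier := Y\<rparr>) X)
    = HN.rel_slope X Y + kap_h n G h \<theta> \<kappa> D / r_h n G h \<theta>"
  using quot_sub(3)[OF assms L_stable[OF assms(2)] assms(3) subset_refl] quot_full(2)[OF assms]
  by (simp add: HN.rel_slope_def)

text \<open>The correspondence between submodules of the quotient and intermediate submodules,
  restricted to those generated in \<open>Dm\<close>: images inherit generation, and preimages have
  it as extensions by \<open>X\<close>.\<close>

lemma slope_semistable_iff:
  assumes "X \<in> L" "Y \<in> L" "X \<subset> Y"
  shows "slope_semistable n G A h \<theta> \<kappa> D (quot_module (F\<lparr>carrier := Y\<rparr>) X) \<longleftrightarrow> HN.semistable X Y"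
proof -
  have XY: "X \<subseteq> Y" using assms by auto
  let ?Q = "quot_module (F\<lparr>carrier := Y\<rparr>) X" and ?c = "kap_h n G h \<theta> \<kappa> D / r_h n G h \<theta>"
  define \<pi> where "\<pi> = (\<lambda>x. X +>\<^bsub>F\<lparr>carrier := Y\<rparr>\<^esub> x)"
  note full = quot_full[OF assms(1,2) XY, folded \<pi>_def]
  note sub = quot_sub[OF assms(1,2) XY, folded \<pi>_def]
  note slQ = slope_quot[OF assms(1,2) XY]
  have mF: "module A F" using OG_moduleD(1)[OF F(1)] .
  have mQ: "module A ?Q" using OG_moduleD(1)[OF full(3)] .
  have mY: "module A (F\<lparr>carrier := Y\<rparr>)"
    using assms(2) OG_moduleD(1) by (auto simp: sub_generated_def OG_submodule_def)
  have \<pi>Y: "og_map (F\<lparr>carrier := Y\<rparr>) ?Q \<pi>"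
    using sub(1)[OF L_stable[OF assms(2)] XY subset_refl] full(2) by simp
  show ?thesis
  proof
    assume s: "slope_semistable n G A h \<theta> \<kappa> D ?Q"
    show "HN.semistable X Y"
      unfolding HN.semistable_def
    proof (intro ballI impI)
      fix Z assume Z: "Z \<in> L" "X \<subset> Z \<and> Z \<subset> Y"
      then have ZY: "X \<subseteq> Z" "Z \<subseteq> Y" by auto
      let ?N = "\<pi> ` Z"
      note q = sub[OF L_stable[OF Z(1)] ZY]
      have OZ: "OG_module n G A (F\<lparr>carrier := Z\<rparr>)" and gZ: "generated_in G A Dm (F\<lparr>carrier := Z\<rparr>)"
        using Z(1) by (auto simp: sub_generated_def OG_submodule_def)
      have "submodule A Z (F\<lparr>carrier := Y\<rparr>)"
        using og_stable_restrict[OF mF L_stable[OF assms(2)], of Z] L_stable[OF Z(1)] ZY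
        by (auto simp: og_stable_def)
      then have "submodule A ?N ?Q"
        using submodule_image[of A "F\<lparr>carrier := Y\<rparr>" \<pi> ?Q Z] mY mQ \<pi>Y by (auto simp: og_map_def)
      then have 1: "OG_submodule n G A ?N ?Q"
        using OG_module_surj[OF OZ q(1)] by (simp add: OG_submodule_def)
      have 2: "generated_in G A Dm (?Q\<lparr>carrier := ?N\<rparr>)"
        using generated_in_surj[OF OZ q(1) Dm_Irr gZ] .
      have 3: "?N \<noteq> {\<zero>\<^bsub>?Q\<^esub>}"
      proof
        assume "?N = {\<zero>\<^bsub>?Q\<^esub>}"
        then have "\<pi> x = \<zero>\<^bsub>?Q\<^esub>" if "x \<in> Z" for x using that by auto
        then have "Z \<subseteq> X" using full(5) ZY by (meson subsetD subsetI)
        then show False using Z(2) by auto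
      qed
      \<comment> \<open>If the image were everything, \<open>Z\<close> and \<open>Y\<close> would
        have the same multiplicities, hence the same rank, against strict monotonicity.\<close>
      have 4: "?N \<subset> carrier ?Q"
      proof -
        have "?N \<noteq> carrier ?Q"
        proof
          assume e: "?N = carrier ?Q"
          have "hf Z \<rho> = hf Y \<rho>" if "\<rho> \<in> Irr n G" for \<rho>
            using q(4)[OF that] sub(4)[OF L_stable[OF assms(2)] XY subset_refl that] e full(1) by simp
          then have "rk Z = rk Y" unfolding rk_def using Dm_Irr by (intro sum.cong) auto
          then show False using rk_strict_mono[OF Z(1) assms(2)] Z(2) by auto
        qed
        moreover have "?N \<subseteq> carrier ?Q" using full(1) ZY by blast
        ultimately show ?thesis by auto
      qed
      have "slope n G A h \<theta> \<kappa> D (?Q\<lparr>carrier := ?N\<rparr>) \<le> slope n G A h \<theta> \<kappa> D ?Q"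
        using s 1 2 3 4 unfolding slope_semistable_def by blast
      then show "HN.rel_slope X Z \<le> HN.rel_slope X Y" using q(3) slQ by (simp add: HN.rel_slope_def)
    qed
  next
    assume s: "HN.semistable X Y"
    have "slope n G A h \<theta> \<kappa> D (?Q\<lparr>carrier := N\<rparr>) \<le> slope n G A h \<theta> \<kappa> D ?Q"
      if N: "OG_submodule n G A N ?Q" "generated_in G A Dm (?Q\<lparr>carrier := N\<rparr>)"
        "N \<noteq> {\<zero>\<^bsub>?Q\<^esub>}" "N \<subset> carrier ?Q" for N
    proof -
      \<comment> \<open>The preimage of \<open>N\<close>. It contains \<open>X\<close>, and its
        image is again \<open>N\<close> because \<open>N\<close> lies in the image of
        \<open>Y\<close>.\<close>
      define Z where "Z = {x \<in> Y. \<pi> x \<in> N}"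
      have stN: "og_stable ?Q N" using OG_submodule_stable N(1) .
      then have N': "submodule A N ?Q" by (simp add: og_stable_def)
      have zN: "\<zero>\<^bsub>?Q\<^esub> \<in> N" using N' by (simp add: submodule_def)
      have "\<pi> x \<in> N" if "x \<in> X" for x using full(5)[of x] zN XY that by auto
      then have XZ: "X \<subseteq> Z" and ZY: "Z \<subseteq> Y" using XY by (auto simp: Z_def)
      have "N \<subseteq> \<pi> ` Y" using full(1) N(4) by auto
      then have NZ: "\<pi> ` Z = N" by (auto simp: Z_def)
      have "submodule A Z (F\<lparr>carrier := Y\<rparr>)"
        using submodule_vimage[of A "F\<lparr>carrier := Y\<rparr>" \<pi> ?Q N] mY N' \<pi>Y by (auto simp: og_map_def Z_def)
      moreover have "gact F g x \<in> Z" if "g \<in> G" "x \<in> Z" for g x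
        using \<pi>Y stN L_stable[OF assms(2)] that by (auto simp: Z_def og_map_def og_stable_def)
      ultimately have stZ: "og_stable F Z"
        using submodule_trans[OF mF _, of Y Z] L_stable[OF assms(2)] by (auto simp: og_stable_def)
      note q = sub[OF stZ XZ ZY, unfolded NZ]
      have Z': "submodule A Z F" using stZ by (simp add: og_stable_def)
      have mZ: "module A (F\<lparr>carrier := Z\<rparr>)" using module.submodule_is_module[OF mF Z'] .
      have sZ: "semisimple n G (as_complex A (F\<lparr>carrier := Z\<rparr>))"
        using admissible_sub[OF OG_moduleD(2)[OF F(1)] og_stable_gsubspace[OF mF stZ]] G_closed G_one
        by (simp add: admissible_def)
      have X': "submodule A X (F\<lparr>carrier := Z\<rparr>)"
        using submodule_restrict[OF mF Z' _ XZ] L_stable[OF assms(1)] by (simp add: og_stable_def)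
      have gX: "generated_in G A Dm (F\<lparr>carrier := X\<rparr>)" using assms(1) by (simp add: L_iff)
      \<comment> \<open>\<open>Z\<close> is an extension of \<open>N\<close> by \<open>X\<close>,
        both generated in \<open>Dm\<close>.\<close>
      have "generated_in G A Dm (F\<lparr>carrier := Z\<rparr>)"
        using generated_in_extension[OF mZ sZ q(1) Dm_Irr, unfolded q(2)] X' gX N(2) by simp
      then have ZL: "Z \<in> L" using stZ by (simp add: L_iff)
      have "X \<noteq> Z"
      proof
        assume "X = Z"
        then have "N \<subseteq> {\<zero>\<^bsub>?Q\<^esub>}" using NZ full(5) ZY by blast
        then show False using N(3) zN by auto
      qed
      moreover have "Z \<noteq> Y" using NZ N(4) full(1) by auto
      ultimately have "HN.rel_slope X Z \<le> HN.rel_slope X Y" using s ZL XZ ZY by (auto simp: HN.semistable_def)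
      then show ?thesis using q(3) slQ by (simp add: HN.rel_slope_def)
    qed
    then show "slope_semistable n G A h \<theta> \<kappa> D ?Q"
      using full(3,4) by (auto simp: slope_semistable_def)
  qed
qed

end

text \<open>The filtration is a list that includes both ends, so its length \<open>p + 2\<close>
  determines \<open>p\<close>, and uniqueness of the list covers that of the number of
  steps.\<close>

theorem theorem2p3:
  fixes n :: nat
    and G :: "complex mat set"
    and A :: "(complex, complex mat, 'a) gmodule"
    and F :: "('a, complex mat, 'm) gmodule"
    and h :: "irrep \<Rightarrow> nat"
    and \<theta> \<kappa> :: "irrep \<Rightarrow> rat"
    and D :: "irrep set"
  assumes "reductive_group n G" and "infinite G"
    and "affine_G_scheme n G A"
    and "\<exists>\<rho>\<in>Irr n G. h \<rho> \<noteq> 0"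
    and "stability_function n G h \<theta>"
    and "\<forall>\<rho>\<in>Dneg n G \<theta>. \<kappa> \<rho> > 0"
    and "hypothesis_H n G A h \<theta> D"
    and "constellation n G A h \<theta> F"
  shows "\<exists>!\<G> :: 'm set list. \<exists>p.
     length \<G> = p + 2 \<and> \<G> ! 0 = {\<zero>\<^bsub>F\<^esub>} \<and> \<G> ! (p + 1) = carrier F \<and>
     (\<forall>i \<le> p. \<G> ! i \<subset> \<G> ! (i + 1)) \<and>
     (\<forall>i \<le> p + 1. OG_submodule n G A (\<G> ! i) F \<and>
        generated_in G A (Dneg n G \<theta>) (F\<lparr>carrier := \<G> ! i\<rparr>)) \<and>
     (\<forall>i \<in> {1..p + 1}. slope_semistable n G A h \<theta> \<kappa> D
        (quot_module (F\<lparr>carrier := \<G> ! i\<rparr>) (\<G> ! (i - 1)))) \<and>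
     (\<forall>i \<in> {1..p}.
        slope n G A h \<theta> \<kappa> D (quot_module (F\<lparr>carrier := \<G> ! i\<rparr>) (\<G> ! (i - 1)))
        > slope n G A h \<theta> \<kappa> D (quot_module (F\<lparr>carrier := \<G> ! (i + 1)\<rparr>) (\<G> ! i)))"
    (is "\<exists>!\<G>. ?P \<G>")
proof -
  interpret hn_setup n G A F h \<theta> \<kappa> D
    using assms by unfold_locales
      (auto simp: reductive_group_def stability_function_def hypothesis_H_def constellation_def)
  \<comment> \<open>The filtration has at least two strictly increasing terms, so \<open>F\<close>
    must be non-zero; this is where a non-zero value of \<open>h\<close> enters.\<close>
  have nz: "{\<zero>\<^bsub>F\<^esub>} \<subset> carrier F"
  proof -
    obtain \<rho> where \<rho>: "\<rho> \<in> Irr n G" "h \<rho> \<noteq> 0" using assms(4) by auto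
    then have "hilb G A F \<rho> \<noteq> 0" using assms(8) by (simp add: constellation_def)
    then have "carrier F \<noteq> {\<zero>\<^bsub>F\<^esub>}" using hilb_zero[OF F(1) _ \<rho>(1)] by auto
    moreover have "{\<zero>\<^bsub>F\<^esub>} \<subseteq> carrier F" using HN.top(2)[OF zero_L] .
    ultimately show ?thesis by auto
  qed
  have "?P \<G> \<longleftrightarrow> HN.hn \<G> \<and> \<G> ! 0 = {\<zero>\<^bsub>F\<^esub>}" for \<G>
  proof -
    have L: "OG_submodule n G A N F \<and> generated_in G A (Dneg n G \<theta>) (F\<lparr>carrier := N\<rparr>) \<longleftrightarrow> N \<in> L" for N
      by (simp add: sub_generated_def)
    \<comment> \<open>The translation between quotients and pairs of members is valid for nested
      members of \<open>L\<close> only, so these two equivalences are proved under the chain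
      conditions that accompany them.\<close>
    have eqs: "(\<forall>i \<in> {1..p + 1}. slope_semistable n G A h \<theta> \<kappa> D
          (quot_module (F\<lparr>carrier := \<G> ! i\<rparr>) (\<G> ! (i - 1)))) \<longleftrightarrow>
        (\<forall>i \<in> {1..p + 1}. HN.semistable (\<G> ! (i - 1)) (\<G> ! i))" (is ?A)
      "(\<forall>i \<in> {1..p}. slope n G A h \<theta> \<kappa> D (quot_module (F\<lparr>carrier := \<G> ! i\<rparr>) (\<G> ! (i - 1)))
          > slope n G A h \<theta> \<kappa> D (quot_module (F\<lparr>carrier := \<G> ! (i + 1)\<rparr>) (\<G> ! i))) \<longleftrightarrow>
        (\<forall>i \<in> {1..p}. HN.rel_slope (\<G> ! (i - 1)) (\<G> ! i) > HN.rel_slope (\<G> ! i) (\<G> ! (i + 1)))" (is ?B)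
      if chain: "\<forall>i \<le> p. \<G> ! i \<subset> \<G> ! (i + 1)" and inL: "\<forall>i \<le> p + 1. \<G> ! i \<in> L" for p
    proof -
      have prev: "\<G> ! (i - 1) \<in> L \<and> \<G> ! i \<in> L \<and> \<G> ! (i - 1) \<subset> \<G> ! i" if "i \<in> {1..p + 1}" for i
      proof -
        obtain j where "i = Suc j" using \<open>i \<in> {1..p + 1}\<close> by (cases i) auto
        then show ?thesis using chain[rule_format, of j] inL that by auto
      qed
      show ?A
        using prev slope_semistable_iff by (intro ball_cong refl) blast
      show ?B
      proof (intro ball_cong refl)
        fix i assume "i \<in> {1..p}"
        then show "slope n G A h \<theta> \<kappa> D (quot_module (F\<lparr>carrier := \<G> ! i\<rparr>) (\<G> ! (i - 1)))
            > slope n G A h \<theta> \<kappa> D (quot_module (F\<lparr>carrier := \<G> ! (i + 1)\<rparr>) (\<G> ! i)) \<longleftrightarrow>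
          HN.rel_slope (\<G> ! (i - 1)) (\<G> ! i) > HN.rel_slope (\<G> ! i) (\<G> ! (i + 1))"
          using prev[of i] prev[of "i + 1"] slope_quot[of "\<G> ! (i - 1)" "\<G> ! i"]
            slope_quot[of "\<G> ! i" "\<G> ! (i + 1)"] by auto
      qed
    qed
    show ?thesis
      unfolding HN.hn_iff_nth L
      using eqs by (auto simp del: Suc_eq_plus1)
  qed
  then show ?thesis using HN.hn_ex1[OF zero_L nz] by presburger
qed

end
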